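(* Let $d\ge 2$ and let $K$ be a convex body in $\mathbb{R}^d$ with $C^1$ boundary. Then for every function $h:\mathbb{R}\to\mathbb{R}$ with continuous derivative such that $h(0)=0$, \[ \int\limits_{G\cap K\neq\emptyset} h(|G\cap K|)\,\mu_{d,1}(\mathrm{d}G)=\frac{1}{(d-1)\omega_d}\int\limits_{(\partial K)^2}\frac{h'(|x_1-x_2|)}{|x_1-x_2|^{d-2}}\cos\alpha_1\cos\alpha_2\cos\phi_0\,\sigma(\mathrm{d}x_1)\,\sigma(\mathrm{d}x_2). \] Here, for $x_1,x_2\in\partial K$, $\alpha_i$ ($i=1,2$) is the angle between the line through $x_1,x_2$ (containing the chord $[x_1,x_2]$) and its orthogonal projection onto the tangent hyperplane of $\partial K$ at $x_i$, and $\phi_0$ is the angle between the orthogonal projections of the normal vectors of $\partial K$ at $x_1$ and at $x_2$ onto the orthogonal complement of the line through $x_1,x_2$.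
   Context: $A_{d,1}$ is the set of affine lines in $\mathbb{R}^d$ with the rigid-motion-invariant Haar measure $\mu_{d,1}$ normalized so that the measure of the set of lines meeting the unit ball $\mathbb{B}^d$ equals $\kappa_{d-1}$, where $\kappa_k$ is the volume of the $k$-dimensional unit ball. $\omega_d=d\kappa_d$ is the surface area of the unit sphere $\mathbb{S}^{d-1}$. $|G\cap K|$ is the length of the chord $G\cap K$. $\sigma$ is the $(d-1)$-dimensional Hausdorff measure on $\partial K$. *)

theory Defs
  imports "HOL-Analysis.Analysis"
begin

definition convex_body :: "'a::euclidean_space set \<Rightarrow> bool" where
  "convex_body K \<longleftrightarrow> compact K \<and> convex K \<and> interior K \<noteq> {}"

definition C1_boundary :: "'a::euclidean_space set \<Rightarrow> bool" where
  "C1_boundary K \<longleftrightarrow>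
     (\<forall>x\<in>frontier K. \<exists>U g g'. open U \<and> x \<in> U \<and>
        (\<forall>y\<in>U. (g has_derivative (\<lambda>v. g' y \<bullet> v)) (at y)) \<and>
        continuous_on U g' \<and> (\<forall>y\<in>U. g' y \<noteq> 0) \<and>
        K \<inter> U = {y\<in>U. g y \<le> (0::real)})"

definition outer_normal :: "'a::euclidean_space set \<Rightarrow> 'a \<Rightarrow> 'a" where
  "outer_normal K x = (THE u. norm u = 1 \<and> (\<forall>y\<in>K. (y - x) \<bullet> u \<le> 0))"

abbreviation kappa :: "real \<Rightarrow> real" where "kappa s \<equiv> unit_ball_vol s"
definition omega :: "nat \<Rightarrow> real" where "omega d = real d * kappa (real d)"

text \<open>s-dimensional Hausdorff (outer) measure, normalized so that it agrees with
  Lebesgue measure on s-dimensional flats.\<close>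
definition hausdorff_pre :: "real \<Rightarrow> real \<Rightarrow> 'a::euclidean_space set \<Rightarrow> ennreal" where
  "hausdorff_pre s \<delta> A = (INF C \<in> {C :: nat \<Rightarrow> 'a set. A \<subseteq> (\<Union>i. C i) \<and>
        (\<forall>i. bounded (C i) \<and> diameter (C i) \<le> \<delta>)}.
        (\<Sum>i. ennreal (kappa s * (diameter (C i) / 2) powr s)))"

definition hausdorff_outer :: "real \<Rightarrow> 'a::euclidean_space set \<Rightarrow> ennreal" where
  "hausdorff_outer s A = (SUP \<delta> \<in> {0<..}. hausdorff_pre s \<delta> A)"

definition hausdorff_on :: "real \<Rightarrow> 'a::euclidean_space set \<Rightarrow> 'a measure" where
  "hausdorff_on s S = measure_of S (sets (restrict_space borel S)) (hausdorff_outer s)"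

definition line_through :: "'a::euclidean_space \<Rightarrow> 'a \<Rightarrow> 'a set" where
  "line_through y u = {y + t *\<^sub>R u | t. True}"

text \<open>Integration over the space A_{d,1} of affine lines w.r.t. the motion-invariant
  measure mu_{d,1}, normalized so that the lines meeting the unit ball have measure
  kappa_{d-1}:  int f d mu_{d,1} = (1/omega_d) int_{S^{d-1}} int_{u^perp} f(y + R u) dy du.\<close>
definition lines_integral :: "('a::euclidean_space set \<Rightarrow> real) \<Rightarrow> real" where
  "lines_integral f =
     (\<integral>u. (\<integral>y. f (line_through y u)
            \<partial>(hausdorff_on (real DIM('a) - 1) {y. y \<bullet> u = 0}))
        \<partial>(hausdorff_on (real DIM('a) - 1) (sphere 0 1))) / omega DIM('a)"

definition vangle :: "'a::euclidean_space \<Rightarrow> 'a \<Rightarrow> real" where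
  "vangle u v = arccos ((u \<bullet> v) / (norm u * norm v))"

definition proj_perp :: "'a::euclidean_space \<Rightarrow> 'a \<Rightarrow> 'a" where
  "proj_perp n v = v - (v \<bullet> n) *\<^sub>R n"

definition chord_dir :: "'a::euclidean_space \<Rightarrow> 'a \<Rightarrow> 'a" where
  "chord_dir x1 x2 = (x2 - x1) /\<^sub>R norm (x2 - x1)"

definition alpha_angle :: "'a::euclidean_space set \<Rightarrow> 'a \<Rightarrow> 'a \<Rightarrow> 'a \<Rightarrow> real" where
  "alpha_angle K x1 x2 x =
     vangle (chord_dir x1 x2) (proj_perp (outer_normal K x) (chord_dir x1 x2))"

definition phi0_angle :: "'a::euclidean_space set \<Rightarrow> 'a \<Rightarrow> 'a \<Rightarrow> real" where
  "phi0_angle K x1 x2 =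
     vangle (proj_perp (chord_dir x1 x2) (outer_normal K x1))
            (proj_perp (chord_dir x1 x2) (outer_normal K x2))"

end

theory Submission
  imports Defs
begin

text \<open>
  Write \<open>n\<^sub>i\<close> for the outer unit normal at \<open>x\<^sub>i\<close>, \<open>r = |x\<^sub>2 - x\<^sub>1|\<close> and \<open>u\<close> for the direction of the chord. The product of
  the three cosines is \<open>n\<^sub>1 \<bullet> n\<^sub>2 - (n\<^sub>1 \<bullet> u)(n\<^sub>2 \<bullet> u)\<close>, so for fixed \<open>x\<^sub>1\<close> the inner integral on the right is the flux
  through the boundary of the field \<open>h'(r) r\<^sup>2\<^sup>-\<^sup>d (n\<^sub>1 - (n\<^sub>1 \<bullet> u) u)\<close>, whose divergence is
  \<open>-(d-1) h'(r) r\<^sup>1\<^sup>-\<^sup>d (n\<^sub>1 \<bullet> u)\<close>. Integrating the divergence over \<open>K\<close> in polar coordinates around \<open>x\<^sub>1\<close>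
  turns \<open>h'\<close> into \<open>h\<close> of the length of the chord from \<open>x\<^sub>1\<close> in direction \<open>u\<close>. Exchanging the integrations over \<open>x\<^sub>1\<close> and
  \<open>u\<close> and projecting the boundary along \<open>u\<close>, where \<open>(-n\<^sub>1 \<bullet> u)\<^sup>+ d\<sigma>\<close> becomes the measure of the hyperplane
  \<open>u\<^sup>\<bottom>\<close>, gives the integral over lines.

  On hyperplanes the Hausdorff measure of dimension \<open>d - 1\<close> is only needed up to a constant factor (\<open>slice_const\<close> below):
  both sides contain exactly two integrations against this measure, so the factor cancels and the isodiametric
  inequality is not used.
\<close>

section \<open>Hausdorff measure\<close>

text \<open>The boundary measure is defined through coverings, and coverings control little more
  than Lipschitz maps. Two identities are therefore obtained by squeezing: the projection of the
  boundary along a direction (\<open>projection_measure_eq\<close>) and the comparison of the sphere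
  with volumes of cones (\<open>surface_sphere_eq_cone_measure\<close>). On a small piece the maps
  involved change lengths by factors near 1, so the two measures agree there up to
  \<open>1 + \<eta>\<close>; a countable cover makes this global, and \<eta> tends to 0. The first
  identity already carries the divergence theorem: use the fundamental theorem of calculus on each
  line of one direction and project the two ends of the chord along \<open>e\<close> and
  \<open>- e\<close>. Two obstacles remain. The field is singular at the first point, but only like
  the kernels of \<open>volume_kernel_integrable\<close> and
  \<open>surface_kernel_integrable\<close>, and the one line through that point is null because
  \<open>d \<ge> 2\<close>. And \<open>h'\<close> is merely continuous, so the field is
  differentiated only with polynomials in place of \<open>h'\<close>; both sides of the flux
  identity depend continuously on \<open>h'\<close> in the uniform norm.\<close>

lemma hausdorff_pre_le_cover:
  assumes "A \<subseteq> (\<Union>i. C i)" "\<And>i. bounded (C i)" "\<And>i. diameter (C i) \<le> \<delta>"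
  shows "hausdorff_pre s \<delta> A \<le> (\<Sum>i. ennreal (kappa s * (diameter (C i) / 2) powr s))"
  unfolding hausdorff_pre_def using assms by (intro INF_lower) auto

lemma hausdorff_pre_mono: "A \<subseteq> B \<Longrightarrow> hausdorff_pre s \<delta> A \<le> hausdorff_pre s \<delta> B"
  unfolding hausdorff_pre_def by (intro INF_superset_mono) auto

lemma hausdorff_pre_antimono: "\<delta> \<le> \<delta>' \<Longrightarrow> hausdorff_pre s \<delta>' A \<le> hausdorff_pre s \<delta> A"
  unfolding hausdorff_pre_def by (intro INF_superset_mono) (auto intro: order_trans)

lemma hausdorff_pre_single:
  assumes "bounded A" "diameter A \<le> \<delta>"
  shows "hausdorff_pre s \<delta> A \<le> ennreal (kappa s * (diameter A / 2) powr s)"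
proof -
  have "0 \<le> \<delta>" using assms diameter_ge_0 by fastforce
  then have "hausdorff_pre s \<delta> A \<le> (\<Sum>i::nat. ennreal (kappa s * (diameter (if i = 0 then A else {}) / 2) powr s))"
    using assms by (intro hausdorff_pre_le_cover) auto
  also have "\<dots> = (\<Sum>i\<in>{0::nat}. ennreal (kappa s * (diameter (if i = 0 then A else {}) / 2) powr s))"
    by (intro suminf_finite) auto
  finally show ?thesis by simp
qed

text \<open>The \<open>i\<close>-th set is covered up to an excess \<open>e / 2^(i+1)\<close>, and
  pairing of indices merges these covers into one sequence of total excess \<open>e\<close>.\<close>

lemma hausdorff_pre_countable_subadditive:
  fixes A :: "nat \<Rightarrow> 'a::euclidean_space set"
  shows "hausdorff_pre s \<delta> (\<Union>i. A i) \<le> (\<Sum>i. hausdorff_pre s \<delta> (A i))"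
proof (rule ennreal_le_epsilon)
  fix e :: real assume e: "0 < e" and fin: "(\<Sum>i. hausdorff_pre s \<delta> (A i)) < top"
  let ?w = "\<lambda>C :: 'a set. ennreal (kappa s * (diameter C / 2) powr s)"
  have "hausdorff_pre s \<delta> (A i) < top" for i
    using fin ennreal_suminf_lessD by blast
  then have "\<exists>C. A i \<subseteq> (\<Union>j. C j) \<and> (\<forall>j. bounded (C j) \<and> diameter (C j) \<le> \<delta>)
      \<and> (\<Sum>j. ?w (C j)) < hausdorff_pre s \<delta> (A i) + ennreal (e * (1/2) ^ Suc i)" for i
  proof -
    assume "\<And>i. hausdorff_pre s \<delta> (A i) < top"
    then have "hausdorff_pre s \<delta> (A i) < hausdorff_pre s \<delta> (A i) + ennreal (e * (1/2) ^ Suc i)"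
      using e by (auto simp: ennreal_add_left_cancel_less intro!: ennreal_lessI) (metis less_irrefl)
    then show ?thesis
      unfolding hausdorff_pre_def[of s \<delta> "A i"] INF_less_iff by auto
  qed
  then obtain C where C: "\<And>i. A i \<subseteq> (\<Union>j. C i j)" "\<And>i j. bounded (C i j)"
      "\<And>i j. diameter (C i j) \<le> \<delta>"
      "\<And>i. (\<Sum>j. ?w (C i j)) < hausdorff_pre s \<delta> (A i) + ennreal (e * (1/2) ^ Suc i)"
    by metis
  let ?D = "\<lambda>n. C (fst (prod_decode n)) (snd (prod_decode n))"
  have "hausdorff_pre s \<delta> (\<Union>i. A i) \<le> (\<Sum>n. ?w (?D n))"
  proof (intro hausdorff_pre_le_cover)
    show "(\<Union>i. A i) \<subseteq> (\<Union>n. ?D n)"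
    proof
      fix x assume "x \<in> (\<Union>i. A i)"
      then obtain i j where "x \<in> C i j" using C(1) by blast
      then show "x \<in> (\<Union>n. ?D n)" by (auto intro!: exI[of _ "prod_encode (i,j)"])
    qed
  qed (use C in auto)
  also have "\<dots> = (\<Sum>i. \<Sum>j. ?w (C i j))"
    using suminf_ennreal_2dimen[of "\<lambda>i. \<Sum>j. ?w (C i j)" "\<lambda>p. ?w (C (fst p) (snd p))"] by simp
  also have "\<dots> \<le> (\<Sum>i. hausdorff_pre s \<delta> (A i) + ennreal (e * (1/2) ^ Suc i))"
    using C(4) by (intro suminf_le) (auto intro: less_imp_le)
  also have "\<dots> = (\<Sum>i. hausdorff_pre s \<delta> (A i)) + (\<Sum>i. ennreal (e * (1/2) ^ Suc i))"
    by (intro suminf_add[symmetric]) auto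
  also have "(\<Sum>i. ennreal (e * (1/2) ^ Suc i)) = ennreal e"
    using e sums_mult[OF power_half_series, of e] by (intro suminf_ennreal_eq) auto
  finally show "hausdorff_pre s \<delta> (\<Union>i. A i) \<le> (\<Sum>i. hausdorff_pre s \<delta> (A i)) + ennreal e" .
qed

lemma hausdorff_pre_empty [simp]: "0 \<le> \<delta> \<Longrightarrow> hausdorff_pre s \<delta> {} = 0"
  using hausdorff_pre_single[of "{}" \<delta> s] by simp

text \<open>Padding the finite family by empty sets is what requires
  \<open>0 \<le> \<delta>\<close>: an empty covering set has diameter 0.\<close>

lemma hausdorff_pre_finite_subadditive:
  assumes "finite I" "0 \<le> \<delta>"
  shows "hausdorff_pre s \<delta> (\<Union>i\<in>I. A i) \<le> (\<Sum>i\<in>I. hausdorff_pre s \<delta> (A i))"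
  using assms(1)
proof induction
  case empty then show ?case using assms by simp
next
  case (insert a F)
  have "hausdorff_pre s \<delta> (A a \<union> (\<Union>i\<in>F. A i))
      \<le> (\<Sum>n. hausdorff_pre s \<delta> (if n = 0 then A a else if n = 1 then (\<Union>i\<in>F. A i) else {}))"
    by (rule order_trans[OF hausdorff_pre_mono hausdorff_pre_countable_subadditive])
       (auto intro!: exI[of _ "1::nat"] exI[of _ "0::nat"] split: if_splits)
  also have "\<dots> = (\<Sum>n\<in>{0,1::nat}. hausdorff_pre s \<delta> (if n = 0 then A a else if n = 1 then (\<Union>i\<in>F. A i) else {}))"
    using assms by (intro suminf_finite) auto
  also have "\<dots> = hausdorff_pre s \<delta> (A a) + hausdorff_pre s \<delta> (\<Union>i\<in>F. A i)" by simp
  finally show ?case using insert by (auto intro: order_trans add_mono)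
qed

lemma hausdorff_outer_mono: "A \<subseteq> B \<Longrightarrow> hausdorff_outer s A \<le> hausdorff_outer s B"
  unfolding hausdorff_outer_def by (intro SUP_mono) (auto intro: hausdorff_pre_mono)

lemma hausdorff_pre_le_outer: "0 < \<delta> \<Longrightarrow> hausdorff_pre s \<delta> A \<le> hausdorff_outer s A"
  unfolding hausdorff_outer_def by (intro SUP_upper) auto

lemma hausdorff_outer_empty [simp]: "hausdorff_outer s {} = 0"
  unfolding hausdorff_outer_def by (auto simp: SUP_eq_const intro!: antisym SUP_least)

lemma hausdorff_outer_countable_subadditive:
  "hausdorff_outer s (\<Union>i::nat. A i) \<le> (\<Sum>i. hausdorff_outer s (A i))"
  unfolding hausdorff_outer_def[of s "\<Union>i. A i"]
proof (rule SUP_least)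
  fix \<delta> :: real assume "\<delta> \<in> {0<..}"
  then show "hausdorff_pre s \<delta> (\<Union>i. A i) \<le> (\<Sum>i. hausdorff_outer s (A i))"
    by (intro order_trans[OF hausdorff_pre_countable_subadditive] suminf_le)
       (auto intro: hausdorff_pre_le_outer)
qed

lemma hausdorff_outer_Un: "hausdorff_outer s (A \<union> B) \<le> hausdorff_outer s A + hausdorff_outer s B"
proof -
  have "hausdorff_outer s (A \<union> B)
      \<le> (\<Sum>n. hausdorff_outer s (if n = 0 then A else if n = 1 then B else {}))"
    by (rule order_trans[OF hausdorff_outer_mono hausdorff_outer_countable_subadditive])
       (auto intro!: exI[of _ "1::nat"] exI[of _ "0::nat"] split: if_splits)
  also have "\<dots> = (\<Sum>n\<in>{0,1::nat}. hausdorff_outer s (if n = 0 then A else if n = 1 then B else {}))"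
    by (intro suminf_finite) auto
  finally show ?thesis by simp
qed

lemma hausdorff_pre_seq_incseq: "incseq (\<lambda>n. hausdorff_pre s (1 / Suc n) A)"
  by (intro incseq_SucI hausdorff_pre_antimono) (simp add: field_simps)

text \<open>In this monotone form the supremum of a sum splits by
  \<open>ennreal_SUP_add\<close>.\<close>

lemma hausdorff_outer_eq_SUP: "hausdorff_outer s A = (SUP n. hausdorff_pre s (1 / Suc n) A)"
proof (rule antisym)
  show "hausdorff_outer s A \<le> (SUP n. hausdorff_pre s (1 / Suc n) A)"
    unfolding hausdorff_outer_def
  proof (rule SUP_least)
    fix \<delta> :: real assume "\<delta> \<in> {0<..}"
    then obtain n :: nat where "1 / Suc n < \<delta>"
      using nat_approx_posE[of \<delta>] by auto
    then show "hausdorff_pre s \<delta> A \<le> (SUP n. hausdorff_pre s (1 / Suc n) A)"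
      by (intro SUP_upper2[of n] hausdorff_pre_antimono) auto
  qed
qed (auto intro!: SUP_least hausdorff_pre_le_outer)

section \<open>Additivity on separated sets and measurability of Borel sets\<close>

lemma hausdorff_pre_separated:
  assumes sep: "\<And>a b. a \<in> A \<Longrightarrow> b \<in> B \<Longrightarrow> \<delta> < dist a b"
  shows "hausdorff_pre s \<delta> A + hausdorff_pre s \<delta> B \<le> hausdorff_pre s \<delta> (A \<union> B)"
  unfolding hausdorff_pre_def[of s \<delta> "A \<union> B"]
proof (rule INF_greatest, clarify)
  fix C :: "nat \<Rightarrow> 'a set"
  assume C: "A \<union> B \<subseteq> (\<Union>i. C i)" "\<forall>i. bounded (C i) \<and> diameter (C i) \<le> \<delta>"
  let ?w = "\<lambda>C :: 'a set. ennreal (kappa s * (diameter C / 2) powr s)"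
  let ?X = "\<lambda>X i. if C i \<inter> X = {} then {} else C i"
  have d0: "0 \<le> \<delta>" using C(2) diameter_ge_0 by (meson order_trans)
  have X: "hausdorff_pre s \<delta> X \<le> (\<Sum>i. ?w (?X X i))" if "X \<subseteq> A \<union> B" for X
    using C d0 that by (intro hausdorff_pre_le_cover) (fastforce split: if_splits)+
  \<comment> \<open>Two points of a covering set are at most \<delta> apart, so the set can meet
    only one of \<open>A\<close> and \<open>B\<close>; the cover splits into two.\<close>
  have disj: "C i \<inter> A = {} \<or> C i \<inter> B = {}" for i
  proof (rule ccontr)
    assume "\<not> ?thesis"
    then obtain a b where "a \<in> C i" "a \<in> A" "b \<in> C i" "b \<in> B" by auto
    then have "\<delta> < dist a b" "dist a b \<le> diameter (C i)" "diameter (C i) \<le> \<delta>"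
      using sep C(2) by (auto intro: diameter_bounded_bound)
    then show False by linarith
  qed
  have "hausdorff_pre s \<delta> A + hausdorff_pre s \<delta> B \<le> (\<Sum>i. ?w (?X A i)) + (\<Sum>i. ?w (?X B i))"
    by (intro add_mono X) auto
  also have "\<dots> = (\<Sum>i. ?w (?X A i) + ?w (?X B i))" by (intro suminf_add) auto
  also have "\<dots> \<le> (\<Sum>i. ?w (C i))"
  proof (rule suminf_le)
    fix i show "?w (?X A i) + ?w (?X B i) \<le> ?w (C i)" using disj[of i] by auto
  qed auto
  finally show "hausdorff_pre s \<delta> A + hausdorff_pre s \<delta> B \<le> (\<Sum>i. ?w (C i))" .
qed

lemma hausdorff_outer_separated:
  assumes "0 < e" and sep: "\<And>a b. a \<in> A \<Longrightarrow> b \<in> B \<Longrightarrow> e \<le> dist a b"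
  shows "hausdorff_outer s A + hausdorff_outer s B \<le> hausdorff_outer s (A \<union> B)"
proof -
  obtain N :: nat where N: "1 / Suc N < e" using nat_approx_posE[OF assms(1)] by auto
  have "hausdorff_outer s A + hausdorff_outer s B
      = (SUP n. hausdorff_pre s (1 / Suc n) A + hausdorff_pre s (1 / Suc n) B)"
    unfolding hausdorff_outer_eq_SUP
    by (rule ennreal_SUP_add[symmetric]) (rule hausdorff_pre_seq_incseq)+
  also have "\<dots> \<le> hausdorff_outer s (A \<union> B)"
  proof (rule SUP_least)
    fix n :: nat
    let ?d = "1 / Suc (max n N) :: real"
    have d: "?d \<le> 1 / Suc n" "?d \<le> 1 / Suc N" by (auto simp: field_simps)
    have "hausdorff_pre s (1 / Suc n) A + hausdorff_pre s (1 / Suc n) B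
        \<le> hausdorff_pre s ?d A + hausdorff_pre s ?d B"
      by (intro add_mono hausdorff_pre_antimono d)
    also have "\<dots> \<le> hausdorff_pre s ?d (A \<union> B)"
      using sep d N by (intro hausdorff_pre_separated) force
    also have "\<dots> \<le> hausdorff_outer s (A \<union> B)" by (intro hausdorff_pre_le_outer) auto
    finally show "hausdorff_pre s (1 / Suc n) A + hausdorff_pre s (1 / Suc n) B
        \<le> hausdorff_outer s (A \<union> B)" .
  qed
  finally show ?thesis .
qed

lemma hausdorff_outer_UN_separated:
  fixes R :: "nat \<Rightarrow> 'a::euclidean_space set"
  assumes "\<And>i j. i < j \<Longrightarrow> \<exists>e>0. \<forall>a\<in>R i. \<forall>b\<in>R j. e \<le> dist a b"
  shows "(\<Sum>i<n. hausdorff_outer s (R i)) \<le> hausdorff_outer s (\<Union>i<n. R i)"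
proof (induction n)
  case (Suc n)
  obtain e where e: "\<And>i. i < n \<Longrightarrow> e i > 0 \<and> (\<forall>a\<in>R i. \<forall>b\<in>R n. e i \<le> dist a b)"
    using assms[of _ n] by metis
  have "(\<Sum>i<Suc n. hausdorff_outer s (R i)) \<le> hausdorff_outer s (\<Union>i<n. R i) + hausdorff_outer s (R n)"
    using Suc by (auto intro: add_right_mono)
  also have "\<dots> \<le> hausdorff_outer s ((\<Union>i<n. R i) \<union> R n)"
  proof (rule hausdorff_outer_separated)
    \<comment> \<open>\<open>insert 1\<close> keeps the minimum defined when
      \<open>n = 0\<close>.\<close>
    show "0 < Min (insert 1 (e ` {..<n}))" using e by (subst Min_gr_iff) auto
    fix a b assume "a \<in> (\<Union>i<n. R i)" "b \<in> R n"
    then obtain i where "i < n" "a \<in> R i" by auto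
    then have "e i \<le> dist a b" using e \<open>b \<in> R n\<close> by blast
    moreover have "Min (insert 1 (e ` {..<n})) \<le> e i" using \<open>i < n\<close> by (intro Min_le) auto
    ultimately show "Min (insert 1 (e ` {..<n})) \<le> dist a b" by linarith
  qed
  also have "(\<Union>i<n. R i) \<union> R n = (\<Union>i<Suc n. R i)" by (auto simp: lessThan_Suc)
  finally show ?case .
qed simp

text \<open>Caratheodory's argument for metric outer measures. \<open>X - C\<close> is exhausted by
  the sets \<open>A n\<close> of points at distance at least \<open>1 / (n + 1)\<close> from
  \<open>C\<close>, which are separated from \<open>X \<inter> C\<close>. The rings
  \<open>R n\<close> between them, taken with even or with odd indices only, are separated from one
  another; so the sum of their measures is finite, and its tail bounds what \<open>A n\<close>
  misses.\<close>

lemma hausdorff_outer_closed_caratheodory: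
  assumes "closed C"
  shows "hausdorff_outer s (X \<inter> C) + hausdorff_outer s (X - C) \<le> hausdorff_outer s X"
\<comment> \<open>\<open>infdist\<close> to the empty set is 0, so that case cannot go through the
  sets \<open>A n\<close>; finiteness of the measure of \<open>X\<close> makes the ring series
  converge.\<close>
proof (cases "C = {} \<or> hausdorff_outer s X = \<infinity>")
  case False
  then have ne: "C \<noteq> {}" and fin: "hausdorff_outer s X < \<infinity>" by (auto simp: less_top)
  let ?H = "hausdorff_outer s"
  define A where "A n = {x\<in>X. 1 / Suc n \<le> infdist x C}" for n :: nat
  define R where "R n = A (Suc n) - A n" for n
  have AX: "A n \<subseteq> X" for n by (auto simp: A_def)
  have incA: "A n \<subseteq> A m" if "n \<le> m" for n m
  proof -
    have "1 / Suc m \<le> (1 / Suc n :: real)" using that by (auto simp: field_simps)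
    then show ?thesis by (auto simp: A_def)
  qed
  have H1: "?H (X \<inter> C) + ?H (A n) \<le> ?H X" for n
  proof -
    have "?H (X \<inter> C) + ?H (A n) \<le> ?H ((X \<inter> C) \<union> A n)"
    proof (rule hausdorff_outer_separated)
      fix a b assume "a \<in> X \<inter> C" "b \<in> A n"
      then have "1 / Suc n \<le> infdist b C" "infdist b C \<le> dist b a" by (auto simp: A_def infdist_le)
      then show "1 / real (Suc n) \<le> dist a b" by (simp add: dist_commute)
    qed auto
    also have "\<dots> \<le> ?H X" using AX by (intro hausdorff_outer_mono) auto
    finally show ?thesis .
  qed
  have Rsep: "\<exists>e>0. \<forall>a\<in>R i. \<forall>b\<in>R j. e \<le> dist a b" if "Suc i < j" for i j
  proof (intro exI conjI ballI)
    have ij: "1 / Suc j < (1 / Suc (Suc i) :: real)" using that by (auto simp: field_simps)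
    then show "0 < 1 / Suc (Suc i) - (1 / Suc j :: real)" by simp
    fix a b assume ab: "a \<in> R i" "b \<in> R j"
    then have "1 / Suc (Suc i) \<le> infdist a C" "infdist b C < 1 / Suc j"
      by (auto simp: R_def A_def not_le)
    moreover have "infdist a C \<le> infdist b C + dist a b" by (rule infdist_triangle)
    ultimately show "1 / Suc (Suc i) - (1 / Suc j :: real) \<le> dist a b" by linarith
  qed
  have bnd: "(\<Sum>i<n. ?H (R (2*i+k))) \<le> ?H X" for k n
  proof -
    have "(\<Sum>i<n. ?H (R (2*i+k))) \<le> ?H (\<Union>i<n. R (2*i+k))"
      by (rule hausdorff_outer_UN_separated) (intro Rsep, linarith)
    also have "\<dots> \<le> ?H X" by (intro hausdorff_outer_mono) (auto simp: R_def A_def)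
    finally show ?thesis .
  qed
  have split: "(\<Sum>i<2*n. ?H (R i)) = (\<Sum>i<n. ?H (R (2*i))) + (\<Sum>i<n. ?H (R (2*i+1)))" for n
    by (induction n) (auto simp: algebra_simps)
  have "(\<Sum>i<n. ?H (R i)) \<le> ?H X + ?H X" for n
  proof -
    have "(\<Sum>i<n. ?H (R i)) \<le> (\<Sum>i<2*n. ?H (R i))" by (intro sum_mono2) auto
    also have "\<dots> \<le> ?H X + ?H X" unfolding split using bnd[of 0 n] bnd[of 1 n] by (intro add_mono) auto
    finally show ?thesis .
  qed
  then have "(\<Sum>i. ?H (R i)) \<le> ?H X + ?H X"
    by (subst suminf_eq_SUP) (auto intro: SUP_least)
  then have sfin: "(\<Sum>i. ?H (R i)) < top"
    using fin by (simp add: order_le_less_trans)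
  have XC: "X - C \<subseteq> A n \<union> (\<Union>i. R (i + n))" for n
  proof
    fix x assume x: "x \<in> X - C"
    then have "0 < infdist x C" using assms ne by (simp add: infdist_pos_not_in_closed)
    then obtain m where "1 / Suc m < infdist x C" using nat_approx_posE by blast
    then have m: "x \<in> A m" using x by (auto simp: A_def)
    show "x \<in> A n \<union> (\<Union>i. R (i + n))"
    proof (cases "x \<in> A n")
      case False
      define k where "k = (LEAST k. x \<in> A k)"
      have k: "x \<in> A k" unfolding k_def by (rule LeastI[of _ m]) (rule m)
      have nk: "n < k" using incA k False by (meson not_le subsetD)
      then have "x \<notin> A (k - 1)" using not_less_Least[of "k - 1" "\<lambda>k. x \<in> A k"] unfolding k_def by auto
      then have "x \<in> R (k - 1)" using k nk by (auto simp: R_def)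
      then show ?thesis using nk by (auto intro!: exI[of _ "k - 1 - n"])
    qed simp
  qed
  show ?thesis
  proof (rule ennreal_le_epsilon)
    fix e :: real assume e: "0 < e"
    have "(\<lambda>n. \<Sum>i<n. ?H (R i)) \<longlonglongrightarrow> (\<Sum>i. ?H (R i))" by (rule summable_LIMSEQ) auto
    moreover define S where "S = (\<Sum>i. ?H (R i))"
    ultimately have lim: "(\<lambda>n. \<Sum>i<n. ?H (R i)) \<longlonglongrightarrow> S" by simp
    have "\<exists>n. S < (\<Sum>i<n. ?H (R i)) + ennreal e"
    proof (rule ccontr)
      assume "\<not> ?thesis"
      then have "(\<Sum>i<n. ?H (R i)) + ennreal e \<le> S" for n by (auto simp: not_less)
      then have "S + ennreal e \<le> S"
        by (intro LIMSEQ_le_const2[OF tendsto_add[OF lim tendsto_const]]) auto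
      then show False using sfin e unfolding S_def
        by (metis add.right_neutral ennreal_add_left_cancel_le ennreal_less_zero_iff infinity_ennreal_def not_le less_irrefl)
    qed
    then obtain n where n: "S < (\<Sum>i<n. ?H (R i)) + ennreal e" ..
    have "S = (\<Sum>i<n. ?H (R i)) + (\<Sum>i. ?H (R (i+n)))" unfolding S_def
      using suminf_offset[of "\<lambda>i. ?H (R i)" n] by (simp add: add.commute)
    then have tail: "(\<Sum>i. ?H (R (i+n))) \<le> ennreal e"
      using n by (metis ennreal_add_left_cancel_less less_imp_le)
    have "?H (X - C) \<le> ?H (A n) + ?H (\<Union>i. R (i+n))"
      by (rule order_trans[OF hausdorff_outer_mono[OF XC] hausdorff_outer_Un])
    also have "\<dots> \<le> ?H (A n) + ennreal e"
      by (intro add_left_mono order_trans[OF hausdorff_outer_countable_subadditive tail])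
    finally have "?H (X \<inter> C) + ?H (X - C) \<le> ?H (X \<inter> C) + (?H (A n) + ennreal e)" by (rule add_left_mono)
    also have "\<dots> \<le> ?H X + ennreal e" using H1[of n] by (simp add: add.assoc[symmetric] add_right_mono)
    finally show "?H (X \<inter> C) + ?H (X - C) \<le> ?H X + ennreal e" .
  qed
qed auto

text \<open>Closed sets split every set additively, and they generate the Borel sets.\<close>

lemma hausdorff_outer_measure_space: "measure_space UNIV (sets borel) (hausdorff_outer s)"
proof -
  have oms: "outer_measure_space (Pow UNIV) (hausdorff_outer s)"
    unfolding outer_measure_space_def positive_def increasing_def countably_subadditive_def
    by (auto intro: hausdorff_outer_mono hausdorff_outer_countable_subadditive)
  let ?L = "lambda_system UNIV (Pow UNIV) (hausdorff_outer s)"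
  have ms: "measure_space UNIV ?L (hausdorff_outer s)"
    by (rule sigma_algebra.caratheodory_lemma[OF sigma_algebra_Pow oms])
  have "closed C \<Longrightarrow> C \<in> ?L" for C
    using hausdorff_outer_closed_caratheodory[of C s] hausdorff_outer_Un[of s "_ \<inter> C" "_ - C"]
    by (subst algebra.lambda_system_eq[OF algebra_Pow], intro CollectI conjI ballI antisym)
       (simp_all, metis Int_Diff_Un)
  then have "sigma_sets UNIV {C. closed C} \<subseteq> ?L"
    using ms by (intro sigma_algebra.sigma_sets_subset) (auto simp: measure_space_def)
  moreover have "sets borel = sigma_sets UNIV {C. closed C}"
    by (simp add: borel_eq_closed)
  ultimately show ?thesis
    by (intro measure_down[OF ms]) (auto simp: sigma_algebra_sigma_sets)
qed

text \<open>One measure on the whole space; for Borel \<open>S\<close> the measure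
  \<open>hausdorff_on s S\<close> is its restriction
  (\<open>hausdorff_on_eq_restrict\<close>).\<close>

definition hausdorff_measure :: "real \<Rightarrow> 'a::euclidean_space measure" where
  "hausdorff_measure s = measure_of UNIV (sets borel) (hausdorff_outer s)"

lemma sets_hausdorff_measure [simp, measurable_cong]: "sets (hausdorff_measure s) = sets borel"
  unfolding hausdorff_measure_def using sets.sigma_sets_eq[of borel] by auto

lemma space_hausdorff_measure [simp]: "space (hausdorff_measure s) = UNIV"
  unfolding hausdorff_measure_def by simp

lemma emeasure_hausdorff_measure: "A \<in> sets borel \<Longrightarrow> emeasure (hausdorff_measure s) A = hausdorff_outer s A"
  using hausdorff_outer_measure_space[of s]
  by (intro emeasure_measure_of[OF hausdorff_measure_def]) (auto simp: measure_space_def)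

lemma hausdorff_on_eq_restrict:
  assumes "S \<in> sets borel"
  shows "hausdorff_on s S = restrict_space (hausdorff_measure s) S"
proof -

  have "restrict_space (hausdorff_measure s) S
     = measure_of S (sets (restrict_space (hausdorff_measure s) S)) (emeasure (restrict_space (hausdorff_measure s) S))"
    using measure_of_of_measure[of "restrict_space (hausdorff_measure s) S"] by (simp add: space_restrict_space)
  also have "sets (restrict_space (hausdorff_measure s) S) = sets (restrict_space borel S)"
    by (intro sets_restrict_space_cong) simp
  also have "measure_of S (sets (restrict_space borel S)) (emeasure (restrict_space (hausdorff_measure s) S)) = hausdorff_on s S"
    unfolding hausdorff_on_def
  proof (rule measure_of_eq)
    show "sets (restrict_space borel S) \<subseteq> Pow S"
      using sets.space_closed[of "restrict_space borel S"] by (simp add: space_restrict_space)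
    fix A assume "A \<in> sigma_sets S (sets (restrict_space borel S))"
    then have "A \<in> sets (restrict_space borel S)"
      using sets.sigma_sets_eq[of "restrict_space borel S"] by (simp add: space_restrict_space)
    then have "A \<in> sets borel" "A \<subseteq> S" using assms by (auto simp: sets_restrict_space_iff)
    then show "emeasure (restrict_space (hausdorff_measure s) S) A = hausdorff_outer s A"
      using assms by (subst emeasure_restrict_space) (auto simp: emeasure_hausdorff_measure)
  qed
  finally show ?thesis by simp
qed

section \<open>Lipschitz maps, finiteness and positivity\<close>

lemma hausdorff_outer_lipschitz:
  fixes f :: "'a::euclidean_space \<Rightarrow> 'b::euclidean_space"
  assumes f: "\<And>x y. x \<in> A \<Longrightarrow> y \<in> A \<Longrightarrow> dist (f x) (f y) \<le> L * dist x y" and L: "0 < L" and s: "0 \<le> s"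
  shows "hausdorff_outer s (f ` A) \<le> ennreal (L powr s) * hausdorff_outer s A"
  unfolding hausdorff_outer_def[of s "f ` A"]
proof (rule SUP_least)
  fix \<delta> :: real assume \<delta>: "\<delta> \<in> {0<..}"
  have "hausdorff_pre s \<delta> (f ` A) \<le> ennreal (L powr s) * hausdorff_pre s (\<delta> / L) A"
  proof (cases "ennreal (L powr s) = 0")
    case True then show ?thesis using L by simp
  next
    case False
    have "hausdorff_pre s \<delta> (f ` A) / ennreal (L powr s) \<le> hausdorff_pre s (\<delta> / L) A"
      unfolding hausdorff_pre_def[of s "\<delta> / L" A]
    proof (rule INF_greatest, clarify)
      fix C :: "nat \<Rightarrow> 'a set"
      assume C: "A \<subseteq> (\<Union>i. C i)" "\<forall>i. bounded (C i) \<and> diameter (C i) \<le> \<delta> / L"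
      \<comment> \<open>Only the part of a covering set inside \<open>A\<close> is mapped, since the
        Lipschitz bound is assumed there.\<close>
      let ?D = "\<lambda>i. f ` (C i \<inter> A)"
      have diam: "bounded (?D i) \<and> diameter (?D i) \<le> L * diameter (C i)" for i
      proof
        have *: "dist (f x) (f y) \<le> L * diameter (C i)" if "x \<in> C i \<inter> A" "y \<in> C i \<inter> A" for x y
        proof -
          have "dist (f x) (f y) \<le> L * dist x y" using f that by auto
          also have "\<dots> \<le> L * diameter (C i)" using L C that by (intro mult_left_mono diameter_bounded_bound) auto
          finally show ?thesis .
        qed
        show "bounded (?D i)"
        proof (cases "C i \<inter> A = {}")
          case False
          then obtain x where "x \<in> C i \<inter> A" by auto
          then show ?thesis using * by (auto simp: bounded_def)
        qed (simp only: image_empty bounded_empty)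
        show "diameter (?D i) \<le> L * diameter (C i)"
          using * L C diameter_ge_0[of "C i"] by (intro diameter_le) (auto simp: dist_norm)
      qed
      have "hausdorff_pre s \<delta> (f ` A) \<le> (\<Sum>i. ennreal (kappa s * (diameter (?D i) / 2) powr s))"
      proof (rule hausdorff_pre_le_cover)
        show "f ` A \<subseteq> (\<Union>i. ?D i)" using C(1) by blast
        fix i show "bounded (?D i)" using diam by auto
        have "diameter (?D i) \<le> L * diameter (C i)" using diam by auto
        also have "\<dots> \<le> \<delta>" using C(2) L by (auto simp: field_simps)
        finally show "diameter (?D i) \<le> \<delta>" .
      qed
      also have "\<dots> \<le> (\<Sum>i. ennreal (L powr s) * ennreal (kappa s * (diameter (C i) / 2) powr s))"
      proof (intro suminf_le)
        fix i
        have "0 \<le> diameter (C i)" using C diameter_ge_0 by auto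
        then have "(diameter (?D i) / 2) powr s \<le> L powr s * (diameter (C i) / 2) powr s"
          using diam[of i] L s diameter_ge_0[of "?D i"]
          by (subst powr_mult[symmetric]) (auto intro!: powr_mono2)
        then have "kappa s * (diameter (?D i) / 2) powr s \<le> L powr s * (kappa s * (diameter (C i) / 2) powr s)"
          using s unit_ball_vol_nonneg[of s] by (metis mult.left_commute mult_left_mono)
        then show "ennreal (kappa s * (diameter (?D i) / 2) powr s)
            \<le> ennreal (L powr s) * ennreal (kappa s * (diameter (C i) / 2) powr s)"
          by (subst ennreal_mult'[symmetric]) (auto intro: ennreal_leI)
      qed auto
      also have "\<dots> = ennreal (L powr s) * (\<Sum>i. ennreal (kappa s * (diameter (C i) / 2) powr s))" by simp
      finally show "hausdorff_pre s \<delta> (f ` A) / ennreal (L powr s)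
          \<le> (\<Sum>i. ennreal (kappa s * (diameter (C i) / 2) powr s))"
        using False by (intro divide_le_posI_ennreal) (auto simp: zero_less_iff_neq_zero)
    qed
    then have "ennreal (L powr s) * (hausdorff_pre s \<delta> (f ` A) / ennreal (L powr s))
        \<le> ennreal (L powr s) * hausdorff_pre s (\<delta> / L) A" by (rule mult_left_mono) simp
    then show ?thesis using False
      by (simp add: ennreal_times_divide mult.commute[of "ennreal (L powr s)" "hausdorff_pre s \<delta> (f ` A)"]
          mult_divide_eq_ennreal)
  qed
  also have "\<dots> \<le> ennreal (L powr s) * hausdorff_outer s A"
    using \<delta> L by (intro mult_left_mono hausdorff_pre_le_outer) auto
  finally show "hausdorff_pre s \<delta> (f ` A) \<le> ennreal (L powr s) * hausdorff_outer s A" .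
qed

lemma hausdorff_outer_isometry:
  assumes f: "\<And>x y. x \<in> A \<Longrightarrow> y \<in> A \<Longrightarrow> dist (f x) (f y) = dist x y" and s: "0 \<le> s"
  shows "hausdorff_outer s (f ` A) = hausdorff_outer s A"
proof (rule antisym)
  show "hausdorff_outer s (f ` A) \<le> hausdorff_outer s A"
    using hausdorff_outer_lipschitz[of A f 1 s] assms by simp
  have inj: "inj_on f A" using f by (metis dist_eq_0_iff inj_onI)
  have "hausdorff_outer s (inv_into A f ` f ` A) \<le> hausdorff_outer s (f ` A)"
    using hausdorff_outer_lipschitz[of "f ` A" "inv_into A f" 1 s] f s inj by (force simp: inv_into_f_f)
  then show "hausdorff_outer s A \<le> hausdorff_outer s (f ` A)" using inj by (simp)
qed

lemma hausdorff_outer_unit_cube_finite: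
  fixes I :: "'a::euclidean_space set"
  assumes I: "I \<subseteq> Basis" "I \<noteq> {}"
  shows "hausdorff_outer (real (card I))
      {x::'a. \<forall>b\<in>Basis. if b \<in> I then 0 \<le> x \<bullet> b \<and> x \<bullet> b \<le> 1 else x \<bullet> b = 0} < \<infinity>" (is "hausdorff_outer ?s ?Q < \<infinity>")
proof -
  have finI: "finite I" using I finite_Basis finite_subset by blast
  then have cI: "0 < card I" using I by (simp add: card_gt_0_iff)
  \<comment> \<open>\<open>N ^ card I\<close> cells of diameter at most \<open>card I / N\<close>
    have total cost \<open>?B\<close>, whatever \<open>N\<close> is. The crude bound of the diameter
    by the \<open>l1\<close> norm is enough for finiteness.\<close>
  let ?B = "kappa ?s * (real (card I) / 2) ^ card I"
  have "hausdorff_pre ?s \<delta> ?Q \<le> ennreal ?B" if "\<delta> > 0" for \<delta>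
  proof -
    obtain N :: nat where N: "real (card I) / \<delta> < real N" using reals_Archimedean2 by blast
    have "0 \<le> real (card I) / \<delta>" using that by simp
    then have N0: "0 < real N" using N by linarith
    define P where "P k = {x::'a. \<forall>b\<in>Basis. if b \<in> I then real (k b) / N \<le> x \<bullet> b \<and> x \<bullet> b \<le> (real (k b) + 1) / N
        else x \<bullet> b = 0}" for k :: "'a \<Rightarrow> nat"
    let ?K = "I \<rightarrow>\<^sub>E {..<N}"
    have "?Q \<subseteq> (\<Union>k\<in>?K. P k)"
    proof
      fix x assume x: "x \<in> ?Q"
      \<comment> \<open>\<open>min (N - 1)\<close> puts the points with a coordinate equal to 1 into
        the last cell.\<close>
      define k where "k = (\<lambda>b\<in>I. min (N - 1) (nat \<lfloor>N * (x \<bullet> b)\<rfloor>))"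
      have "k \<in> ?K" using N0 by (auto simp: k_def)
      moreover have "x \<in> P k"
        unfolding P_def
      proof (intro CollectI ballI)
        fix b :: 'a assume b: "b \<in> Basis"
        show "if b \<in> I then real (k b) / N \<le> x \<bullet> b \<and> x \<bullet> b \<le> (real (k b) + 1) / N else x \<bullet> b = 0"
        proof (cases "b \<in> I")
          case True
          then have xb: "0 \<le> x \<bullet> b" "x \<bullet> b \<le> 1" using x b by auto
          let ?f = "nat \<lfloor>N * (x \<bullet> b)\<rfloor>"
          have f: "real ?f \<le> N * (x \<bullet> b)" "N * (x \<bullet> b) < real ?f + 1"
            using xb N0 by (auto simp: of_nat_nat)
          have kb: "k b = min (N - 1) ?f" using True by (simp add: k_def)
          have "real (k b) \<le> N * (x \<bullet> b)" using f(1) kb by linarith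
          moreover have "N * (x \<bullet> b) \<le> real (k b) + 1"
          proof (cases "?f \<le> N - 1")
            case False
            have "real N * (x \<bullet> b) \<le> real N * 1" using xb N0 by (intro mult_left_mono) auto
            then show ?thesis using kb False N0 by (simp add: min_def of_nat_diff)
          qed (use kb f in auto)
          ultimately show ?thesis using True N0 by (simp add: field_simps)
        qed (use x b in auto)
      qed
      ultimately show "x \<in> (\<Union>k\<in>?K. P k)" by blast
    qed
    moreover have finK: "finite ?K" using finI by (intro finite_PiE) auto
    ultimately have "hausdorff_pre ?s \<delta> ?Q \<le> (\<Sum>k\<in>?K. hausdorff_pre ?s \<delta> (P k))"
      using that by (intro order_trans[OF hausdorff_pre_mono hausdorff_pre_finite_subadditive]) auto
    also have "\<dots> \<le> (\<Sum>k\<in>?K. ennreal (kappa ?s * (real (card I) / N / 2) powr ?s))"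
    proof (rule sum_mono)
      fix k
      have *: "norm (x - y) \<le> real (card I) / N" if "x \<in> P k" "y \<in> P k" for x y
      proof -
        have "norm (x - y) \<le> (\<Sum>b\<in>Basis. \<bar>(x - y) \<bullet> b\<bar>)" by (rule norm_le_l1)
        also have "\<dots> = (\<Sum>b\<in>I. \<bar>(x - y) \<bullet> b\<bar>)"
          using I that by (intro sum.mono_neutral_right) (auto simp: P_def inner_diff_left)
        also have "\<dots> \<le> (\<Sum>b\<in>I. 1 / N)"
        proof (rule sum_mono)
          fix b assume b: "b \<in> I"
          then have "real (k b) / N \<le> x \<bullet> b" "x \<bullet> b \<le> (real (k b) + 1) / N"
              "real (k b) / N \<le> y \<bullet> b" "y \<bullet> b \<le> (real (k b) + 1) / N"
            using that I by (auto simp: P_def subset_iff)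
          then show "\<bar>(x - y) \<bullet> b\<bar> \<le> 1 / N" by (auto simp: inner_diff_left add_divide_distrib)
        qed
        also have "\<dots> = real (card I) / N" by simp
        finally show ?thesis .
      qed
      have bd: "bounded (P k)"
      proof (cases "P k = {}")
        case False
        then obtain x where "x \<in> P k" by auto
        then show ?thesis using * unfolding bounded_def by (auto simp: dist_norm)
      qed simp
      have dm: "diameter (P k) \<le> real (card I) / N" using * N0 by (intro diameter_le) auto
      also have "\<dots> \<le> \<delta>" using N that N0 by (simp add: field_simps)
      finally have "hausdorff_pre ?s \<delta> (P k) \<le> ennreal (kappa ?s * (diameter (P k) / 2) powr ?s)"
        using bd by (intro hausdorff_pre_single)
      also have "\<dots> \<le> ennreal (kappa ?s * (real (card I) / N / 2) powr ?s)"
        using dm diameter_ge_0[OF bd] by (intro ennreal_leI mult_left_mono powr_mono2) auto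
      finally show "hausdorff_pre ?s \<delta> (P k) \<le> ennreal (kappa ?s * (real (card I) / N / 2) powr ?s)" .
    qed
    also have "\<dots> = ennreal (real (N ^ card I) * (kappa ?s * (real (card I) / N / 2) powr ?s))"
      using finI by (simp add: card_PiE ennreal_of_nat_eq_real_of_nat ennreal_mult'' flip: of_nat_power)
    also have "real (N ^ card I) * (kappa ?s * (real (card I) / N / 2) powr ?s) = ?B"
      using N0 cI by (simp add: powr_realpow field_simps power_divide)
    finally show ?thesis .
  qed
  then have "hausdorff_outer ?s ?Q \<le> ennreal ?B"
    unfolding hausdorff_outer_def by (intro SUP_least) auto
  then show ?thesis by (simp add: order_le_less_trans)
qed

lemma hausdorff_outer_coordinate_bounded_finite:
  fixes A I :: "'a::euclidean_space set"
  assumes I: "I \<subseteq> Basis" "I \<noteq> {}" and A: "bounded A" "\<And>x b. x \<in> A \<Longrightarrow> b \<in> Basis - I \<Longrightarrow> x \<bullet> b = 0"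
  shows "hausdorff_outer (real (card I)) A < \<infinity>"
proof -
  let ?s = "real (card I)"
  let ?Q = "{x::'a. \<forall>b\<in>Basis. if b \<in> I then 0 \<le> x \<bullet> b \<and> x \<bullet> b \<le> 1 else x \<bullet> b = 0}"
  obtain R where R: "R > 0" "\<And>x. x \<in> A \<Longrightarrow> norm x \<le> R" using A(1) by (auto simp: bounded_pos)
  \<comment> \<open>\<open>f\<close> maps the unit cube of the coordinate plane onto the cube with
    coordinates in \<open>[-R, R]\<close>, and \<open>g\<close> is its inverse.\<close>
  define f where "f x = (2 * R) *\<^sub>R x - R *\<^sub>R (\<Sum>I)" for x :: 'a
  define g where "g x = (1 / (2 * R)) *\<^sub>R (x + R *\<^sub>R (\<Sum>I))" for x :: 'a
  have sumI: "(\<Sum>I) \<bullet> b = (if b \<in> I then 1 else 0)" if "b \<in> Basis" for b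
  proof -
    have "finite I" using I finite_Basis finite_subset by blast
    then show ?thesis using that I
      by (auto simp: inner_sum_left inner_Basis subset_iff sum.delta if_distrib cong: if_cong
          intro!: trans[OF sum.cong[OF refl, of I "\<lambda>i. i \<bullet> b" "\<lambda>i. if i = b then 1 else 0"]])
  qed
  have "A \<subseteq> f ` ?Q"
  proof
    fix x assume x: "x \<in> A"
    have "f (g x) = x" using R by (simp add: f_def g_def)
    moreover have "g x \<in> ?Q"
    proof (intro CollectI ballI)
      fix b :: 'a assume b: "b \<in> Basis"
      have "\<bar>x \<bullet> b\<bar> \<le> R" using R(2)[OF x] Basis_le_norm[OF b, of x] by linarith
      then show "if b \<in> I then 0 \<le> g x \<bullet> b \<and> g x \<bullet> b \<le> 1 else g x \<bullet> b = 0"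
        using b A(2)[OF x, of b] R(1) by (auto simp: g_def inner_add_left sumI field_simps)
    qed
    ultimately show "x \<in> f ` ?Q" by (intro image_eqI[of x f "g x"]) (simp only:)
  qed
  then have "hausdorff_outer ?s A \<le> hausdorff_outer ?s (f ` ?Q)" by (rule hausdorff_outer_mono)
  also have "\<dots> \<le> ennreal ((2 * R) powr ?s) * hausdorff_outer ?s ?Q"
  proof (rule hausdorff_outer_lipschitz)
    fix x y
    have "f x - f y = (2 * R) *\<^sub>R (x - y)" by (simp add: f_def scaleR_diff_right)
    then show "dist (f x) (f y) \<le> 2 * R * dist x y"
      using R unfolding dist_norm by simp
  qed (use R in auto)
  also have "\<dots> < \<infinity>" using hausdorff_outer_unit_cube_finite[OF I] by (simp add: ennreal_mult_less_top)
  finally show ?thesis .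
qed

text \<open>Each covering set of diameter \<open>D\<close> is thickened to a box with sides
  \<open>2 * D\<close> in the directions of \<open>I\<close> and 1 in the others. These boxes cover
  the unit cube of full dimension, so their volumes add up to at least 1.\<close>

lemma hausdorff_outer_unit_cube_pos:
  fixes I :: "'a::euclidean_space set"
  assumes I: "I \<subseteq> Basis" "I \<noteq> {}"
  shows "0 < hausdorff_outer (real (card I))
      {x::'a. \<forall>b\<in>Basis. if b \<in> I then 0 \<le> x \<bullet> b \<and> x \<bullet> b \<le> 1 else x \<bullet> b = 0}" (is "0 < hausdorff_outer ?s ?Q")
proof -
  have finI: "finite I" using I finite_Basis finite_subset by blast
  then have cI: "0 < card I" using I by (simp add: card_gt_0_iff)
  have kp: "0 < kappa ?s" by (rule unit_ball_vol_pos) simp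
  \<comment> \<open>\<open>4 ^ card I\<close> comes from
    \<open>(2 * D) ^ card I = 4 ^ card I * (D / 2) ^ card I\<close>, the volume of a box against the
    cost of its covering set.\<close>
  let ?r = "4 ^ card I / kappa ?s"
  have "ennreal (1 / ?r) \<le> hausdorff_pre ?s 1 ?Q"
    unfolding hausdorff_pre_def
  proof (rule INF_greatest, clarify)
    fix C :: "nat \<Rightarrow> 'a set"
    assume C: "?Q \<subseteq> (\<Union>i. C i)" "\<forall>i. bounded (C i) \<and> diameter (C i) \<le> 1"
    define D where "D i = diameter (C i)" for i
    have D0: "0 \<le> D i" for i using C diameter_ge_0 by (auto simp: D_def)
    define p where "p i = (SOME x. x \<in> C i)" for i
    define l where "l i = (\<Sum>b\<in>Basis. (if b \<in> I then p i \<bullet> b - D i else 0) *\<^sub>R b)" for i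
    define u where "u i = (\<Sum>b\<in>Basis. (if b \<in> I then p i \<bullet> b + D i else 1) *\<^sub>R b)" for i
    have lu: "l i \<bullet> b = (if b \<in> I then p i \<bullet> b - D i else 0)" "u i \<bullet> b = (if b \<in> I then p i \<bullet> b + D i else 1)"
      if "b \<in> Basis" for i b
      using that by (auto simp: l_def u_def)
    have cov: "cbox 0 One \<subseteq> (\<Union>i. cbox (l i) (u i))"
    proof
      fix x :: 'a assume x: "x \<in> cbox 0 One"
      define x' where "x' = (\<Sum>b\<in>Basis. (if b \<in> I then x \<bullet> b else 0) *\<^sub>R b)"
      have x': "x' \<bullet> b = (if b \<in> I then x \<bullet> b else 0)" if "b \<in> Basis" for b
        using that by (auto simp: x'_def)
      have "x' \<in> ?Q" using x by (auto simp: x' mem_box)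
      then obtain i where i: "x' \<in> C i" using C by auto
      then have "p i \<in> C i" unfolding p_def by (rule someI)
      then have d: "dist x' (p i) \<le> D i" using i C unfolding D_def by (intro diameter_bounded_bound) auto
      have "x \<in> cbox (l i) (u i)"
        unfolding mem_box
      proof
        fix b :: 'a assume b: "b \<in> Basis"
        have "\<bar>(x' - p i) \<bullet> b\<bar> \<le> D i" using d Basis_le_norm[OF b, of "x' - p i"] by (simp add: dist_norm)
        then show "l i \<bullet> b \<le> x \<bullet> b \<and> x \<bullet> b \<le> u i \<bullet> b"
          using x b by (auto simp: lu x' mem_box inner_diff_left abs_le_iff split: if_splits)
      qed
      then show "x \<in> (\<Union>i. cbox (l i) (u i))" by blast
    qed
    have vol: "emeasure lborel (cbox (l i) (u i)) = ennreal ((2 * D i) ^ card I)" for i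
    proof -
      have "emeasure lborel (cbox (l i) (u i)) = ennreal (\<Prod>b\<in>Basis. (u i - l i) \<bullet> b)"
        using D0[of i] by (subst emeasure_lborel_cbox) (auto simp: lu)
      also have "(\<Prod>b\<in>Basis. (u i - l i) \<bullet> b) = (\<Prod>b\<in>Basis. if b \<in> I then 2 * D i else 1)"
        by (intro prod.cong) (auto simp: inner_diff_left lu)
      also have "\<dots> = (\<Prod>b\<in>I. 2 * D i)" using I by (simp add: prod.If_cases Int_absorb1)
      finally show ?thesis by simp
    qed
    have "emeasure lborel (cbox 0 One :: 'a set) = 1"
      by (subst emeasure_lborel_cbox) auto
    moreover have "emeasure lborel (cbox 0 One :: 'a set) \<le> (\<Sum>i. emeasure lborel (cbox (l i) (u i)))"
      by (rule order_trans[OF emeasure_mono[OF cov] emeasure_subadditive_countably]) auto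
    ultimately have "1 \<le> (\<Sum>i. emeasure lborel (cbox (l i) (u i)))" by simp
    also have "\<dots> = (\<Sum>i. ennreal ?r * ennreal (kappa ?s * (D i / 2) powr ?s))"
    proof (rule suminf_cong)
      fix i
      have "(D i / 2) powr ?s = (D i / 2) ^ card I" using D0[of i] cI by (intro powr_realpow') auto
      moreover have "(2 * D i) ^ card I = 4 ^ card I * (D i / 2) ^ card I"
        by (subst power_mult_distrib[symmetric]) simp
      ultimately have "(2 * D i) ^ card I = ?r * (kappa ?s * (D i / 2) powr ?s)"
        using kp by (simp add: less_imp_neq[OF kp, symmetric])
      then show "emeasure lborel (cbox (l i) (u i)) = ennreal ?r * ennreal (kappa ?s * (D i / 2) powr ?s)"
        using kp unfolding vol by (subst ennreal_mult'[symmetric]) (simp_all only: divide_nonneg_pos zero_le_power zero_le_numeral)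
    qed
    also have "\<dots> = ennreal ?r * (\<Sum>i. ennreal (kappa ?s * (D i / 2) powr ?s))" by simp
    finally have "ennreal (1 / ?r) * 1 \<le> ennreal (1 / ?r) * (ennreal ?r * (\<Sum>i. ennreal (kappa ?s * (D i / 2) powr ?s)))"
      by (rule mult_left_mono) simp
    also have "\<dots> = (\<Sum>i. ennreal (kappa ?s * (D i / 2) powr ?s))"
    proof -
      have r: "0 < ?r" using kp by (intro divide_pos_pos) simp_all
      have "ennreal (1 / ?r) * (ennreal ?r * X) = X" for X
        by (subst mult.assoc[symmetric], subst ennreal_mult'[symmetric]) (use r kp in \<open>simp_all add: less_imp_neq[OF kp, symmetric]\<close>)
      then show ?thesis .
    qed
    finally show "ennreal (1 / ?r) \<le> (\<Sum>i. ennreal (kappa ?s * (diameter (C i) / 2) powr ?s))"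
      by (simp add: D_def)
  qed
  also have "\<dots> \<le> hausdorff_outer ?s ?Q" by (rule hausdorff_pre_le_outer) simp
  finally have "ennreal (1 / ?r) \<le> hausdorff_outer ?s ?Q" .
  moreover have "0 < ennreal (1 / ?r)" using kp by (subst ennreal_less_zero_iff) simp
  ultimately show ?thesis by (rule less_le_trans[rotated])
qed

text \<open>Here the exact constant matters, because this length becomes the argument of
  \<open>h\<close>. As \<open>kappa 1 = 2\<close>, the cost of a covering set is just its
  diameter.\<close>

lemma hausdorff_outer_1_interval:
  assumes ab: "a \<le> (b::real)"
  shows "hausdorff_outer 1 {a..b} = ennreal (b - a)"
proof (rule antisym)
  have k1: "kappa 1 = 2" by (simp add: unit_ball_vol_1)
  show "hausdorff_outer 1 {a..b} \<le> ennreal (b - a)"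
    unfolding hausdorff_outer_def
  proof (rule SUP_least)
    fix \<delta> :: real assume "\<delta> \<in> {0<..}"
    then have \<delta>: "\<delta> > 0" by simp
    obtain N :: nat where N: "(b - a) / \<delta> < real N" using reals_Archimedean2 by blast
    have "0 \<le> (b - a) / \<delta>" using \<delta> ab by simp
    then have N0: "0 < real N" using N by linarith
    let ?h = "(b - a) / N"
    let ?J = "\<lambda>k::nat. {a + k * ?h .. a + (k + 1) * ?h}"
    have "{a..b} \<subseteq> (\<Union>k\<in>{..<N}. ?J k)"
    proof
      fix x assume x: "x \<in> {a..b}"
      show "x \<in> (\<Union>k\<in>{..<N}. ?J k)"
      proof (cases "a = b")
        case True then show ?thesis using x N0 by auto
      next
        case False
        then have h0: "?h > 0" using ab N0 by simp
        let ?f = "nat \<lfloor>(x - a) / ?h\<rfloor>"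
        define k where "k = min (N - 1) ?f"
        have q: "0 \<le> (x - a) / ?h" using x h0 by (intro divide_nonneg_pos) auto
        have f: "real ?f \<le> (x - a) / ?h" "(x - a) / ?h < real ?f + 1"
          using q by (auto simp: of_nat_nat)
        have "real k \<le> (x - a) / ?h" using f(1) k_def by linarith
        moreover have "(x - a) / ?h \<le> real k + 1"
        proof (cases "?f \<le> N - 1")
          case False
          have "(x - a) / ?h \<le> N" using x h0 N0 by (simp add: field_simps)
          then show ?thesis using False N0 by (simp add: k_def min_def of_nat_diff)
        qed (use f in \<open>auto simp: k_def\<close>)
        ultimately have "real k * ?h \<le> x - a" "x - a \<le> (real k + 1) * ?h"
          by (simp_all only: pos_le_divide_eq[OF h0] pos_divide_le_eq[OF h0])
        moreover have "k < N" using N0 by (auto simp: k_def)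
        ultimately show ?thesis by (auto simp: algebra_simps)
      qed
    qed
    then have "hausdorff_pre 1 \<delta> {a..b} \<le> (\<Sum>k<N. hausdorff_pre 1 \<delta> (?J k))"
      using \<delta> by (intro order_trans[OF hausdorff_pre_mono hausdorff_pre_finite_subadditive]) auto
    also have "\<dots> \<le> (\<Sum>k<N. ennreal ?h)"
    proof (rule sum_mono)
      fix k
      have dm: "diameter (?J k) \<le> ?h"
        using ab N0 by (intro diameter_le)
          (auto simp: algebra_simps add_divide_distrib diff_divide_distrib intro: divide_right_mono)
      also have "\<dots> \<le> \<delta>" using N \<delta> N0 by (simp add: field_simps)
      finally have "hausdorff_pre 1 \<delta> (?J k) \<le> ennreal (kappa 1 * (diameter (?J k) / 2) powr 1)"
        by (intro hausdorff_pre_single) auto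
      also have "\<dots> \<le> ennreal ?h"
        using dm diameter_ge_0[of "?J k"] by (intro ennreal_leI) (simp add: k1)
      finally show "hausdorff_pre 1 \<delta> (?J k) \<le> ennreal ?h" .
    qed
    also have "\<dots> = ennreal (b - a)"
      using N0 ab by (simp add: ennreal_of_nat_eq_real_of_nat flip: ennreal_mult'')
    finally show "hausdorff_pre 1 \<delta> {a..b} \<le> ennreal (b - a)" .
  qed
  have "ennreal (b - a) \<le> hausdorff_pre 1 1 {a..b}"
    unfolding hausdorff_pre_def
  proof (rule INF_greatest, clarify)
    fix C :: "nat \<Rightarrow> real set"
    assume C: "{a..b} \<subseteq> (\<Union>i. C i)" "\<forall>i. bounded (C i) \<and> diameter (C i) \<le> 1"
    \<comment> \<open>The interval hull of a bounded set of reals is no longer than the diameter of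
      the set.\<close>
    let ?J = "\<lambda>i. if C i = {} then {} else {Inf (C i)..Sup (C i)}"
    have "C i \<subseteq> ?J i" for i
      using C(2) by (auto intro!: cInf_lower cSup_upper simp: bounded_imp_bdd_above bounded_imp_bdd_below)
    then have cov: "{a..b} \<subseteq> (\<Union>i. ?J i)" by (intro order_trans[OF C(1)] UN_mono) auto
    have "ennreal (b - a) = emeasure lborel {a..b}" using ab by simp
    also have "\<dots> \<le> (\<Sum>i. emeasure lborel (?J i))"
      by (rule order_trans[OF emeasure_mono[OF cov] emeasure_subadditive_countably]) auto
    also have "\<dots> \<le> (\<Sum>i. ennreal (kappa 1 * (diameter (C i) / 2) powr 1))"
    proof (rule suminf_le)
      fix i
      have d0: "0 \<le> diameter (C i)" using C diameter_ge_0 by auto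
      show "emeasure lborel (?J i) \<le> ennreal (kappa 1 * (diameter (C i) / 2) powr 1)"
      proof (cases "C i = {}")
        case False
        have xy: "x - y \<le> diameter (C i)" if "x \<in> C i" "y \<in> C i" for x y
          using diameter_bounded_bound[of "C i" x y] that C(2) by (auto simp: dist_real_def)
        have "Sup (C i) \<le> diameter (C i) + y" if "y \<in> C i" for y
          using False xy[OF _ that] by (intro cSup_least) (auto simp: algebra_simps)
        then have "Sup (C i) - diameter (C i) \<le> Inf (C i)"
          using False by (intro cInf_greatest) (auto simp: algebra_simps)
        moreover have "Inf (C i) \<le> Sup (C i)"
          using False C(2) by (intro cInf_le_cSup) (auto simp: bounded_imp_bdd_above bounded_imp_bdd_below)
        ultimately show ?thesis using False d0 by (auto simp: k1 intro!: ennreal_leI)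
      qed simp
    qed auto
    finally show "ennreal (b - a) \<le> (\<Sum>i. ennreal (kappa 1 * (diameter (C i) / 2) powr 1))" .
  qed
  also have "\<dots> \<le> hausdorff_outer 1 {a..b}" by (rule hausdorff_pre_le_outer) simp
  finally show "ennreal (b - a) \<le> hausdorff_outer 1 {a..b}" .
qed

text \<open>The integral of \<open>indicator A x * indicator B (x + y)\<close> over Lebesgue measure
  in \<open>x\<close> and \<open>M\<close> in \<open>y\<close> is computed in both orders, with
  \<open>A\<close> the centred unit cube.\<close>

lemma translation_invariant_eq_lborel:
  fixes M :: "'a::euclidean_space measure"
  assumes sets [measurable_cong]: "sets M = sets borel" and "sigma_finite_measure M"
    and inv: "\<And>v A. A \<in> sets borel \<Longrightarrow> emeasure M {x. v + x \<in> A} = emeasure M A"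
    and B: "B \<in> sets borel"
  shows "emeasure M B = emeasure M (cbox (- (1/2) *\<^sub>R One) ((1/2) *\<^sub>R One)) * emeasure lborel B"
proof -
  interpret M: sigma_finite_measure M by fact
  interpret pair_sigma_finite lborel M ..
  define A where "A = cbox (- (1/2) *\<^sub>R One) ((1/2) *\<^sub>R One :: 'a)"
  have A [measurable]: "A \<in> sets borel" by (simp add: A_def)
  note B [measurable]
  \<comment> \<open>Symmetry of the cube turns \<open>x - y \<in> A\<close> into
    \<open>- x + y \<in> A\<close>, to which the invariance of \<open>M\<close> applies.\<close>
  have symA: "x \<in> A \<longleftrightarrow> - x \<in> A" for x
  proof -
    have "x \<in> A \<longleftrightarrow> (\<forall>b\<in>Basis. - (1/2) \<le> x \<bullet> b \<and> x \<bullet> b \<le> 1/2)" for x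
      by (simp add: A_def mem_box)
    then show ?thesis by fastforce
  qed
  have lA: "emeasure lborel A = 1"
  proof -
    have "(1/2) *\<^sub>R One - (- (1/2) *\<^sub>R One) = (One :: 'a)" by (simp flip: scaleR_add_left)
    then show ?thesis unfolding A_def by (subst emeasure_lborel_cbox) auto
  qed
  have "emeasure M B = (\<integral>\<^sup>+x. indicator A x * emeasure M B \<partial>lborel)"
    by (simp add: nn_integral_multc lA)
  also have "\<dots> = (\<integral>\<^sup>+x. \<integral>\<^sup>+y. indicator A x * indicator B (x + y) \<partial>M \<partial>lborel)"
  proof (rule nn_integral_cong)
    fix x :: 'a
    have "emeasure M B = emeasure M {y. x + y \<in> B}" by (rule inv[symmetric]) (rule B)
    also have "\<dots> = (\<integral>\<^sup>+y. indicator {y. x + y \<in> B} y \<partial>M)" by (intro nn_integral_indicator[symmetric]) measurable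
    also have "\<dots> = (\<integral>\<^sup>+y. indicator B (x + y) \<partial>M)" by (intro nn_integral_cong) (auto simp: indicator_def)
    finally show "indicator A x * emeasure M B = (\<integral>\<^sup>+y. indicator A x * indicator B (x + y) \<partial>M)"
      by (simp add: nn_integral_cmult)
  qed
  also have "\<dots> = (\<integral>\<^sup>+y. \<integral>\<^sup>+x. indicator A x * indicator B (x + y) \<partial>lborel \<partial>M)"
    by (rule Fubini'[symmetric]) measurable
  also have "\<dots> = (\<integral>\<^sup>+y. \<integral>\<^sup>+x. indicator A (x - y) * indicator B x \<partial>lborel \<partial>M)"
  proof (rule nn_integral_cong)
    fix y
    have "(\<integral>\<^sup>+x. indicator A (x - y) * indicator B x \<partial>lborel)
        = (\<integral>\<^sup>+x. indicator A (x - y) * indicator B x \<partial>distr lborel borel ((+) y))"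
      by (subst lborel_distr_plus) simp
    also have "\<dots> = (\<integral>\<^sup>+x. indicator A x * indicator B (x + y) \<partial>lborel)"
      by (subst nn_integral_distr) (simp_all add: add.commute)
    finally show "(\<integral>\<^sup>+x. indicator A x * indicator B (x + y) \<partial>lborel)
        = (\<integral>\<^sup>+x. indicator A (x - y) * indicator B x \<partial>lborel)" by simp
  qed
  also have "\<dots> = (\<integral>\<^sup>+x. \<integral>\<^sup>+y. indicator A (x - y) * indicator B x \<partial>M \<partial>lborel)"
    by (rule Fubini') measurable
  also have "\<dots> = (\<integral>\<^sup>+x. emeasure M A * indicator B x \<partial>lborel)"
  proof (rule nn_integral_cong)
    fix x :: 'a
    have "(\<integral>\<^sup>+y. indicator A (x - y) \<partial>M) = (\<integral>\<^sup>+y. indicator {y. - x + y \<in> A} y \<partial>M)"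
      by (intro nn_integral_cong) (simp add: indicator_def symA[of "x - _"])
    also have "\<dots> = emeasure M {y. - x + y \<in> A}" by (intro nn_integral_indicator) measurable
    also have "\<dots> = emeasure M A" by (rule inv) (rule A)
    finally show "(\<integral>\<^sup>+y. indicator A (x - y) * indicator B x \<partial>M) = emeasure M A * indicator B x"
      by (simp add: nn_integral_multc)
  qed
  also have "\<dots> = emeasure M A * emeasure lborel B" by (simp add: nn_integral_cmult)
  finally show ?thesis by (simp add: A_def)
qed

section \<open>Slicing by hyperplanes\<close>

text \<open>Extending the measure by 0 to the whole space keeps the one sigma-algebra
  \<open>borel\<close> for all integrands and products.\<close>

definition surface :: "'a::euclidean_space set \<Rightarrow> 'a measure" where
  "surface S = density (hausdorff_measure (real DIM('a) - 1)) (indicator S)"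

lemma sets_surface [simp, measurable_cong]: "sets (surface S) = sets borel"
  by (simp add: surface_def)

lemma space_surface [simp]: "space (surface S) = UNIV"
  by (simp add: surface_def)

lemma emeasure_surface:
  fixes S :: "'a::euclidean_space set"
  assumes "S \<in> sets borel" "A \<in> sets borel"
  shows "emeasure (surface S) A = hausdorff_outer (real DIM('a) - 1) (S \<inter> A)"
  unfolding surface_def
  by (subst emeasure_density) (use assms in \<open>auto simp: emeasure_hausdorff_measure nn_integral_indicator
      simp flip: indicator_inter_arith intro!: arg_cong2[where f=emeasure]\<close>)

lemma nn_integral_surface_cong:
  assumes "S \<in> sets borel" "f \<in> borel_measurable borel" "g \<in> borel_measurable borel" "\<And>x. x \<in> S \<Longrightarrow> f x = g x"
  shows "(\<integral>\<^sup>+x. f x \<partial>surface S) = (\<integral>\<^sup>+x. g x \<partial>surface S)"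
  unfolding surface_def using assms
  by (subst (1 2) nn_integral_density) (auto intro!: nn_integral_cong simp: indicator_def)

lemma AE_surface: "S \<in> sets borel \<Longrightarrow> AE x in surface S. x \<in> S"
  unfolding surface_def by (subst AE_density) (auto simp: indicator_def)

lemma integral_hausdorff_on:
  fixes S :: "'a::euclidean_space set" and f :: "'a \<Rightarrow> real"
  assumes "S \<in> sets borel" "f \<in> borel_measurable borel"
  shows "(\<integral>x. f x \<partial>hausdorff_on (real DIM('a) - 1) S) = (\<integral>x. f x \<partial>surface S)"
proof -
  have eq: "indicator S = (\<lambda>x. ennreal (indicator S x :: real))"
    by (auto simp: fun_eq_iff indicator_def)
  have "(\<integral>x. f x \<partial>hausdorff_on (real DIM('a) - 1) S)
      = (\<integral>x. indicator S x *\<^sub>R f x \<partial>hausdorff_measure (real DIM('a) - 1))"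
    using assms by (simp add: hausdorff_on_eq_restrict integral_restrict_space)
  also have "\<dots> = (\<integral>x. f x \<partial>surface S)"
    unfolding surface_def eq using assms by (subst integral_density) auto
  finally show ?thesis .
qed

text \<open>The reflection in the hyperplane orthogonal to \<open>e - e'\<close> exchanges the two
  unit vectors.\<close>

lemma householder_reflection:
  fixes e e' :: "'a::euclidean_space"
  assumes "norm e = 1" "norm e' = 1"
  obtains R :: "'a \<Rightarrow> 'a" where "linear R" "\<And>x y. R x \<bullet> R y = x \<bullet> y" "R e = e'" "\<And>x. R (R x) = x"
proof -
  define v where "v = e - e'"
  define R where "R x = x - (2 * (x \<bullet> v) / (v \<bullet> v)) *\<^sub>R v" for x
  have lin: "linear R"
    by (rule linearI) (simp_all add: R_def inner_add_left algebra_simps add_divide_distrib)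
  have ee: "e \<bullet> e = 1" "e' \<bullet> e' = 1" using assms by (auto simp: norm_eq_1)
  show ?thesis
  proof (cases "v = 0")
    case True
    then have "R = (\<lambda>x. x)" "e = e'" by (auto simp: R_def v_def)
    then show ?thesis using that lin by auto
  next
    case False
    then have vv: "v \<bullet> v \<noteq> 0" by simp
    have Rv: "R x \<bullet> v = - (x \<bullet> v)" for x using vv by (simp add: R_def inner_diff_left)
    have RR: "R (R x) = x" for x
      unfolding R_def[of "R x"] Rv by (simp add: R_def)
    have "R x \<bullet> R y = x \<bullet> y" for x y
    proof -
      have "R x \<bullet> R y = R x \<bullet> y - (2 * (y \<bullet> v) / (v \<bullet> v)) * (R x \<bullet> v)"
        by (subst R_def[of y]) (simp add: inner_diff_right)
      also have "\<dots> = x \<bullet> y - (2 * (x \<bullet> v) / (v \<bullet> v)) * (v \<bullet> y) + (2 * (y \<bullet> v) / (v \<bullet> v)) * (x \<bullet> v)"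
        unfolding Rv by (subst R_def) (simp add: inner_diff_left)
      also have "\<dots> = x \<bullet> y" by (simp add: inner_commute)
      finally show ?thesis .
    qed
    moreover have "2 * (e \<bullet> v) = v \<bullet> v"
      by (simp add: v_def inner_diff_left inner_diff_right ee inner_commute)
    then have "R e = e'" using vv by (simp add: R_def v_def)
    ultimately show ?thesis using that lin RR by blast
  qed
qed

lemma isometry_of_inner:
  assumes "linear R" "\<And>x y. R x \<bullet> R y = x \<bullet> (y::'a::euclidean_space)"
  shows "dist (R x) (R y) = dist x y" "norm (R x) = norm x"
proof -
  have n: "norm (R x) = norm x" for x using assms(2)[of x x] by (simp add: norm_eq_sqrt_inner)
  then show "norm (R x) = norm x" .
  show "dist (R x) (R y) = dist x y" using n[of "x - y"] assms(1) by (simp add: dist_norm linear_diff)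
qed

abbreviation hplane :: "'a::euclidean_space \<Rightarrow> 'a set" where
  "hplane e \<equiv> {y. y \<bullet> e = 0}"

lemma hplane_borel [measurable]: "hplane e \<in> sets borel"
  by (intro borel_closed closed_Collect_eq continuous_intros)

text \<open>A reflection moves the hyperplane to a coordinate hyperplane, where
  \<open>hausdorff_outer_coordinate_bounded_finite\<close> applies.\<close>

lemma hausdorff_outer_hplane_finite:
  fixes e :: "'a::euclidean_space"
  assumes e: "norm e = 1" and dim: "DIM('a) \<ge> 2" and A: "bounded A" "A \<subseteq> hplane e"
  shows "hausdorff_outer (real DIM('a) - 1) A < \<infinity>"
proof -
  obtain b :: 'a where b: "b \<in> Basis" using nonempty_Basis by blast
  obtain R where R: "linear R" "\<And>x y. R x \<bullet> R y = x \<bullet> y" "R e = b"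
    using householder_reflection[OF e, of b] b by auto
  have c: "card (Basis - {b}) = DIM('a) - 1" using b by simp
  then have "Basis - {b} \<noteq> {}" using dim by (metis card.empty diff_is_0_eq not_numeral_le_zero numeral_2_eq_2 not_less_eq_eq One_nat_def)
  then have "hausdorff_outer (real (card (Basis - {b}))) (R ` A) < \<infinity>"
  proof (intro hausdorff_outer_coordinate_bounded_finite)
    show "bounded (R ` A)" using A(1) R(1) by (simp add: bounded_linear_image linear_conv_bounded_linear)
    fix x b' assume "x \<in> R ` A" "b' \<in> Basis - (Basis - {b})"
    then show "x \<bullet> b' = 0" using A(2) b R(2,3) by force
  qed auto
  moreover have "hausdorff_outer (real DIM('a) - 1) (R ` A) = hausdorff_outer (real DIM('a) - 1) A"
    using isometry_of_inner[OF R(1,2)] dim by (intro hausdorff_outer_isometry) auto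
  ultimately show ?thesis using c dim by (simp add: of_nat_diff)
qed

lemma sigma_finite_surface_hplane:
  fixes e :: "'a::euclidean_space"
  assumes "norm e = 1" "DIM('a) \<ge> 2"
  shows "sigma_finite_measure (surface (hplane e))"
proof
  show "\<exists>A. countable A \<and> A \<subseteq> sets (surface (hplane e)) \<and> \<Union> A = space (surface (hplane e)) \<and>
    (\<forall>a\<in>A. emeasure (surface (hplane e)) a \<noteq> \<infinity>)"
  proof (intro exI[of _ "range (\<lambda>n::nat. cball 0 (real n))"] conjI ballI)
    show "\<Union> (range (\<lambda>n::nat. cball 0 (real n))) = space (surface (hplane e))"
      using real_arch_simple by auto
    fix a assume "a \<in> range (\<lambda>n::nat. cball (0::'a) (real n))"
    then obtain n :: nat where a: "a = cball 0 (real n)" by auto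
    have "hausdorff_outer (real DIM('a) - 1) (hplane e \<inter> a) < \<infinity>"
      unfolding a by (intro hausdorff_outer_hplane_finite[OF assms]) (auto intro: bounded_subset[OF bounded_cball])
    then show "emeasure (surface (hplane e)) a \<noteq> \<infinity>"
      by (subst emeasure_surface) (auto simp: a)
  qed auto
qed

lemma emeasure_surface_hplane_translate:
  fixes e :: "'a::euclidean_space"
  assumes w: "w \<bullet> e = 0" and A [measurable]: "A \<in> sets borel" and "DIM('a) \<ge> 2"
  shows "emeasure (surface (hplane e)) {y. w + y \<in> A} = emeasure (surface (hplane e)) A"
proof -
  have "hplane e \<inter> A = (\<lambda>y. w + y) ` (hplane e \<inter> {y. w + y \<in> A})"
    using w by (auto simp: inner_add_left inner_diff_left image_iff intro!: bexI[of _ "_ - w"])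
  moreover have "{y. w + y \<in> A} \<in> sets borel" by measurable
  ultimately show ?thesis
    using assms hausdorff_outer_isometry[of "hplane e \<inter> {y. w + y \<in> A}" "\<lambda>y. w + y" "real DIM('a) - 1"]
    by (simp add: emeasure_surface)
qed

lemma nn_integral_surface_hplane_translate:
  fixes e :: "'a::euclidean_space"
  assumes w: "w \<bullet> e = 0" and f [measurable]: "f \<in> borel_measurable borel" and "DIM('a) \<ge> 2"
  shows "(\<integral>\<^sup>+y. f (w + y) \<partial>surface (hplane e)) = (\<integral>\<^sup>+y. f y \<partial>surface (hplane e))"
proof -
  have "distr (surface (hplane e)) borel ((+) w) = surface (hplane e)"
    by (rule measure_eqI) (use assms in \<open>simp_all add: emeasure_distr emeasure_surface_hplane_translate vimage_def\<close>)
  then have "(\<integral>\<^sup>+y. f y \<partial>surface (hplane e)) = (\<integral>\<^sup>+y. f y \<partial>distr (surface (hplane e)) borel ((+) w))" by simp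
  also have "\<dots> = (\<integral>\<^sup>+y. f (w + y) \<partial>surface (hplane e))" by (subst nn_integral_distr) auto
  finally show ?thesis by simp
qed

text \<open>Lebesgue measure up to a factor, reassembled from the Hausdorff measure of
  \<open>hplane e\<close> and the length along \<open>e\<close>; translation invariance will
  identify it.\<close>

definition slices :: "'a::euclidean_space \<Rightarrow> 'a measure" where
  "slices e = distr (surface (hplane e) \<Otimes>\<^sub>M lborel) borel (\<lambda>(y, t). y + t *\<^sub>R e)"

lemma sets_slices [simp, measurable_cong]: "sets (slices e) = sets borel"
  and space_slices [simp]: "space (slices e) = UNIV"
  by (simp_all add: slices_def)

lemma nn_integral_slices:
  fixes e :: "'a::euclidean_space"
  assumes e: "norm e = 1" "DIM('a) \<ge> 2" and f [measurable]: "f \<in> borel_measurable borel"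
  shows "(\<integral>\<^sup>+x. f x \<partial>slices e) = (\<integral>\<^sup>+y. \<integral>\<^sup>+t. f (y + t *\<^sub>R e) \<partial>lborel \<partial>surface (hplane e))"
proof -
  interpret S: sigma_finite_measure "surface (hplane e)" by (rule sigma_finite_surface_hplane[OF e])
  interpret pair_sigma_finite "surface (hplane e)" lborel ..
  show ?thesis unfolding slices_def
    by (subst nn_integral_distr) (auto simp: split_beta' lborel.nn_integral_fst[symmetric])
qed

lemma emeasure_slices:
  fixes e :: "'a::euclidean_space"
  assumes e: "norm e = 1" "DIM('a) \<ge> 2" and A [measurable]: "A \<in> sets borel"
  shows "emeasure (slices e) A = (\<integral>\<^sup>+y. \<integral>\<^sup>+t. indicator A (y + t *\<^sub>R e) \<partial>lborel \<partial>surface (hplane e))"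
  using nn_integral_slices[OF e, of "indicator A"] by simp

lemma slices_translate:
  fixes e :: "'a::euclidean_space"
  assumes e: "norm e = 1" "DIM('a) \<ge> 2" and A [measurable]: "A \<in> sets borel"
  shows "emeasure (slices e) {x. v + x \<in> A} = emeasure (slices e) A"
proof -
  have ee: "e \<bullet> e = 1" using e by (simp add: norm_eq_1)
  \<comment> \<open>The part of \<open>v\<close> along \<open>e\<close> is absorbed by the inner
    integral, the orthogonal part \<open>w\<close> by the outer one.\<close>
  define w where "w = v - (v \<bullet> e) *\<^sub>R e"
  have w: "w \<bullet> e = 0" by (simp add: w_def inner_diff_left ee)
  have v: "v = w + (v \<bullet> e) *\<^sub>R e" by (simp add: w_def)
  have m: "{x. v + x \<in> A} \<in> sets borel" by measurable
  have "emeasure (slices e) {x. v + x \<in> A} = (\<integral>\<^sup>+y. \<integral>\<^sup>+t. indicator A (v + (y + t *\<^sub>R e)) \<partial>lborel \<partial>surface (hplane e))"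
    by (subst emeasure_slices[OF e m]) (simp add: indicator_def)
  also have "\<dots> = (\<integral>\<^sup>+y. \<integral>\<^sup>+t. indicator A (w + y + t *\<^sub>R e) \<partial>lborel \<partial>surface (hplane e))"
  proof (rule nn_integral_cong)
    fix y
    have "(\<integral>\<^sup>+t. indicator A (w + y + t *\<^sub>R e) \<partial>lborel) = (\<integral>\<^sup>+t. indicator A (w + y + t *\<^sub>R e) \<partial>distr lborel borel ((+) (v \<bullet> e)))"
      by (subst lborel_distr_plus) simp
    also have "\<dots> = (\<integral>\<^sup>+t. indicator A (w + y + (v \<bullet> e + t) *\<^sub>R e) \<partial>lborel)" by (subst nn_integral_distr) auto
    also have "\<dots> = (\<integral>\<^sup>+t. indicator A (v + (y + t *\<^sub>R e)) \<partial>lborel)"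
      by (subst (2) v) (simp add: algebra_simps)
    finally show "(\<integral>\<^sup>+t. indicator A (v + (y + t *\<^sub>R e)) \<partial>lborel) = (\<integral>\<^sup>+t. indicator A (w + y + t *\<^sub>R e) \<partial>lborel)" by simp
  qed
  also have "\<dots> = (\<integral>\<^sup>+y. \<integral>\<^sup>+t. indicator A (y + t *\<^sub>R e) \<partial>lborel \<partial>surface (hplane e))"
    by (rule nn_integral_surface_hplane_translate[OF w _ e(2), where f="\<lambda>y. \<integral>\<^sup>+t. indicator A (y + t *\<^sub>R e) \<partial>lborel"]) measurable
  also have "\<dots> = emeasure (slices e) A" by (subst emeasure_slices[OF e A]) simp
  finally show ?thesis .
qed

lemma slices_bounded_finite:
  fixes e :: "'a::euclidean_space"
  assumes e: "norm e = 1" "DIM('a) \<ge> 2" and A [measurable]: "A \<in> sets borel" and "bounded A"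
  shows "emeasure (slices e) A < \<infinity>"
proof -
  have ee: "e \<bullet> e = 1" using e by (simp add: norm_eq_1)
  obtain r where r: "r > 0" "\<And>x. x \<in> A \<Longrightarrow> norm x \<le> r" using \<open>bounded A\<close> by (auto simp: bounded_pos)
  have "emeasure (slices e) A = (\<integral>\<^sup>+y. \<integral>\<^sup>+t. indicator A (y + t *\<^sub>R e) \<partial>lborel \<partial>surface (hplane e))"
    by (rule emeasure_slices[OF e A])
  also have "\<dots> \<le> (\<integral>\<^sup>+y. \<integral>\<^sup>+t. indicator (cball 0 (2*r)) y * indicator {-r..r} t \<partial>lborel \<partial>surface (hplane e))"
  proof (rule nn_integral_mono_AE)
    show "AE y in surface (hplane e). (\<integral>\<^sup>+t. indicator A (y + t *\<^sub>R e) \<partial>lborel)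
        \<le> (\<integral>\<^sup>+t. indicator (cball 0 (2*r)) y * indicator {-r..r} t \<partial>lborel)"
      using AE_surface[OF hplane_borel]
    proof eventually_elim
      case (elim y)
      show ?case
      proof (rule nn_integral_mono)
        fix t
        show "indicator A (y + t *\<^sub>R e) \<le> (indicator (cball 0 (2*r)) y * indicator {-r..r} t :: ennreal)"
        proof (cases "y + t *\<^sub>R e \<in> A")
          case True
          then have n: "norm (y + t *\<^sub>R e) \<le> r" using r by auto
          have "\<bar>(y + t *\<^sub>R e) \<bullet> e\<bar> \<le> norm (y + t *\<^sub>R e) * norm e" by (rule Cauchy_Schwarz_ineq2)
          then have t: "\<bar>t\<bar> \<le> r" using n elim e ee by (simp add: inner_add_left)
          have "norm y \<le> norm (y + t *\<^sub>R e) + norm (t *\<^sub>R e)" using norm_triangle_ineq4[of "y + t *\<^sub>R e" "t *\<^sub>R e"] by simp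
          then have "norm y \<le> 2 * r" using t n e by simp
          then show ?thesis using t by (auto simp: indicator_def)
        qed simp
      qed
    qed
  qed
  also have "\<dots> = emeasure (surface (hplane e)) (cball 0 (2*r)) * ennreal (2 * r)"
  proof -
    have "(\<integral>\<^sup>+t. indicator (cball 0 (2*r)) y * indicator {-r..r} t \<partial>lborel) = indicator (cball 0 (2*r)) y * ennreal (2 * r)"
      for y :: 'a using r by (subst nn_integral_cmult) auto
    moreover have "(indicator (cball 0 (2*r)) :: 'a \<Rightarrow> ennreal) \<in> borel_measurable (surface (hplane e))"
      by (intro borel_measurable_indicator) simp
    ultimately show ?thesis by (simp add: nn_integral_multc del: indicator_mult_ennreal)
  qed
  also have "\<dots> < \<infinity>"
    using hausdorff_outer_hplane_finite[OF e, of "hplane e \<inter> cball 0 (2*r)"]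
    by (auto simp: emeasure_surface ennreal_mult_less_top intro: bounded_subset[OF bounded_cball])
  finally show ?thesis .
qed

lemma sigma_finite_of_bounded_finite:
  fixes M :: "'a::euclidean_space measure"
  assumes "sets M = sets borel" "\<And>n::nat. emeasure M (cball 0 (real n)) < \<infinity>"
  shows "sigma_finite_measure M"
proof
  have sp: "space M = UNIV" using sets_eq_imp_space_eq[OF assms(1)] by simp
  show "\<exists>A. countable A \<and> A \<subseteq> sets M \<and> \<Union> A = space M \<and> (\<forall>a\<in>A. emeasure M a \<noteq> \<infinity>)"
    using assms real_arch_simple sp
    by (intro exI[of _ "range (\<lambda>n::nat. cball 0 (real n))"] conjI ballI) (auto simp: less_top)
qed

text \<open>The ratio is read off the unit ball because the ball is fixed by the reflection that
  carries the slicing along one direction into that along another (\<open>slices_reflect\<close>).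
  So one constant serves all directions, whichever basis vector is chosen.\<close>

definition slice_const :: "'a::euclidean_space itself \<Rightarrow> real" where
  "slice_const _ = enn2real (emeasure (slices (SOME b::'a. b \<in> Basis)) (cball 0 1) / emeasure lborel (cball (0::'a) 1))"

lemma slices_lborel_proportional:
  fixes e :: "'a::euclidean_space"
  assumes e: "norm e = 1" "DIM('a) \<ge> 2"
  obtains k where "0 \<le> k" "\<And>B. B \<in> sets borel \<Longrightarrow> emeasure (slices e) B = ennreal k * emeasure lborel B"
proof -
  let ?A = "cbox (- (1/2) *\<^sub>R One) ((1/2) *\<^sub>R One :: 'a)"
  have sf: "sigma_finite_measure (slices e)"
    by (rule sigma_finite_of_bounded_finite) (auto intro!: slices_bounded_finite[OF e, unfolded infinity_ennreal_def])
  have "emeasure (slices e) ?A < \<infinity>" by (rule slices_bounded_finite[OF e]) auto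
  then obtain k where k: "0 \<le> k" "emeasure (slices e) ?A = ennreal k" by (cases "emeasure (slices e) ?A") auto
  show ?thesis
  proof (rule that[OF k(1)])
    fix B :: "'a set" assume "B \<in> sets borel"
    then show "emeasure (slices e) B = ennreal k * emeasure lborel B"
      unfolding k(2)[symmetric] by (intro translation_invariant_eq_lborel sf slices_translate[OF e]) simp_all
  qed
qed

text \<open>The reflection exchanging \<open>e\<close> and \<open>e'\<close> transports the measure
  of one hyperplane to that of the other and fixes the ball.\<close>

lemma slices_reflect:
  fixes e e' :: "'a::euclidean_space"
  assumes e: "norm e = 1" "norm e' = 1" "DIM('a) \<ge> 2"
  shows "emeasure (slices e) (cball 0 1) = emeasure (slices e') (cball 0 1)"
proof -
  obtain R where R: "linear R" "\<And>x y. R x \<bullet> R y = x \<bullet> y" "R e = e'" "\<And>x. R (R x) = x"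
    using householder_reflection[OF e(1,2)] by auto
  note iso = isometry_of_inner[OF R(1,2)]
  have [measurable]: "cball 0 1 \<in> sets (borel :: 'a measure)" by simp
  have Re': "R e' = e" using R by metis
  have mR [measurable]: "R \<in> borel_measurable borel"
    using R(1) by (intro borel_measurable_continuous_onI linear_continuous_on) (simp add: linear_conv_bounded_linear)
  have "distr (surface (hplane e)) borel R = surface (hplane e')"
  proof (rule measure_eqI)
    fix A assume "A \<in> sets (distr (surface (hplane e)) borel R)"
    then have A [measurable]: "A \<in> sets borel" by simp
    have m: "R -` A \<in> sets borel" using measurable_sets[OF mR A] by simp
    have "hplane e' \<inter> A = R ` (hplane e \<inter> R -` A)"
    proof (intro subset_antisym subsetI)
      fix x assume x: "x \<in> hplane e' \<inter> A"
      then have "R x \<bullet> e = 0" using R(2)[of x e'] Re' by simp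
      then show "x \<in> R ` (hplane e \<inter> R -` A)" using x R(4) by (auto intro!: image_eqI[of _ _ "R x"])
    next
      fix x assume "x \<in> R ` (hplane e \<inter> R -` A)"
      then show "x \<in> hplane e' \<inter> A" using R(2,3) by force
    qed
    then show "emeasure (distr (surface (hplane e)) borel R) A = emeasure (surface (hplane e')) A"
      using m e(3) iso by (simp add: emeasure_distr emeasure_surface hausdorff_outer_isometry)
  qed simp
  then have "emeasure (slices e') (cball 0 1)
      = (\<integral>\<^sup>+y. \<integral>\<^sup>+t. indicator (cball 0 1) (y + t *\<^sub>R e') \<partial>lborel \<partial>distr (surface (hplane e)) borel R)"
    by (simp add: emeasure_slices[OF e(2,3)])
  also have "\<dots> = (\<integral>\<^sup>+y. \<integral>\<^sup>+t. indicator (cball 0 1) (R y + t *\<^sub>R e') \<partial>lborel \<partial>surface (hplane e))"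
    by (subst nn_integral_distr; measurable)
  also have "\<dots> = (\<integral>\<^sup>+y. \<integral>\<^sup>+t. indicator (cball 0 1) (y + t *\<^sub>R e) \<partial>lborel \<partial>surface (hplane e))"
  proof (intro nn_integral_cong)
    fix y t
    have "norm (R y + t *\<^sub>R e') = norm (R (y + t *\<^sub>R e))" using R(1,3) by (simp add: linear_add linear_scale)
    then show "indicator (cball 0 1) (R y + t *\<^sub>R e') = (indicator (cball 0 1) (y + t *\<^sub>R e) :: ennreal)"
      using iso by (simp add: indicator_def)
  qed
  also have "\<dots> = emeasure (slices e) (cball 0 1)" by (subst emeasure_slices[OF e(1,3)]) auto
  finally show ?thesis by simp
qed

lemma slices_eq_lborel:
  fixes e :: "'a::euclidean_space"
  assumes e: "norm e = 1" "DIM('a) \<ge> 2" and B: "B \<in> sets borel"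
  shows "emeasure (slices e) B = ennreal (slice_const TYPE('a)) * emeasure lborel B"
proof -
  obtain k where k: "0 \<le> k" "\<And>B. B \<in> sets borel \<Longrightarrow> emeasure (slices e) B = ennreal k * emeasure lborel B"
    using slices_lborel_proportional[OF e] by blast
  have b: "(SOME b::'a. b \<in> Basis) \<in> Basis" using nonempty_Basis by (metis ex_in_conv someI_ex)
  have pos: "0 < emeasure lborel (cball (0::'a) 1)"
    using emeasure_cball[of 1 "0::'a"] unit_ball_vol_pos[of "real DIM('a)"] by simp
  have fin: "emeasure lborel (cball (0::'a) 1) < top"
    using emeasure_cball[of 1 "0::'a"] by simp
  have "emeasure (slices (SOME b::'a. b \<in> Basis)) (cball 0 1) = ennreal k * emeasure lborel (cball (0::'a) 1)"
    using slices_reflect[of "SOME b::'a. b \<in> Basis" e] b e k(2)[of "cball 0 1"] by simp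
  then have "slice_const TYPE('a) = k"
    unfolding slice_const_def using pos fin k(1) by (simp add: mult_divide_eq_ennreal)
  then show ?thesis using k B by simp
qed

lemma slices_eq_density:
  fixes e :: "'a::euclidean_space"
  assumes e: "norm e = 1" "DIM('a) \<ge> 2"
  shows "slices e = density lborel (\<lambda>_. ennreal (slice_const TYPE('a)))"
  by (rule measure_eqI) (auto simp: slices_eq_lborel[OF e] emeasure_density nn_integral_cmult)

lemma nn_integral_slices_eq_lborel:
  fixes e :: "'a::euclidean_space"
  assumes e: "norm e = 1" "DIM('a) \<ge> 2" and f [measurable]: "f \<in> borel_measurable borel"
  shows "(\<integral>\<^sup>+y. \<integral>\<^sup>+t. f (y + t *\<^sub>R e) \<partial>lborel \<partial>surface (hplane e))
      = ennreal (slice_const TYPE('a)) * (\<integral>\<^sup>+x. f x \<partial>lborel)"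
proof -
  have "(\<integral>\<^sup>+x. f x \<partial>slices e) = ennreal (slice_const TYPE('a)) * (\<integral>\<^sup>+x. f x \<partial>lborel)"
    by (simp add: slices_eq_density[OF e] nn_integral_density nn_integral_cmult)
  then show ?thesis by (simp add: nn_integral_slices[OF e])
qed

text \<open>The unit cube is the product of \<open>[0, 1]\<close> and a unit cube in a coordinate
  hyperplane, whose Hausdorff measure is positive. Positivity is what allows finiteness of an
  integral to be inferred after multiplication by this constant, as in
  \<open>radial_weight_integral_finite\<close>.\<close>

lemma slice_const_pos:
  assumes "DIM('a::euclidean_space) \<ge> 2"
  shows "0 < slice_const TYPE('a)"
proof -
  obtain b :: 'a where b: "b \<in> Basis" using nonempty_Basis by blast
  then have e: "norm b = 1" by simp
  have c: "card (Basis - {b}) = DIM('a) - 1" using b by simp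
  then have ne: "Basis - {b} \<noteq> {}" using assms by (metis card.empty diff_is_0_eq not_numeral_le_zero numeral_2_eq_2 not_less_eq_eq One_nat_def)
  let ?Q = "{x::'a. \<forall>i\<in>Basis. if i \<in> Basis - {b} then 0 \<le> x \<bullet> i \<and> x \<bullet> i \<le> 1 else x \<bullet> i = 0}"
  have Q: "?Q \<in> sets borel" by measurable
  have "0 < hausdorff_outer (real DIM('a) - 1) ?Q"
    using hausdorff_outer_unit_cube_pos[of "Basis - {b}"] ne c assms by (simp add: of_nat_diff)
  also have "hausdorff_outer (real DIM('a) - 1) ?Q = emeasure (surface (hplane b)) ?Q"
    using b Q by (subst emeasure_surface) (auto intro!: arg_cong[where f="hausdorff_outer _"] simp: inner_Basis)
  also have "\<dots> = (\<integral>\<^sup>+y. \<integral>\<^sup>+t. indicator ?Q y * indicator {0..1::real} t \<partial>lborel \<partial>surface (hplane b))"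
    using Q by (simp add: nn_integral_cmult)
  also have "\<dots> = (\<integral>\<^sup>+y. \<integral>\<^sup>+t. indicator (cbox 0 One) (y + t *\<^sub>R b) \<partial>lborel \<partial>surface (hplane b))"
  proof (rule nn_integral_cong_AE)
    show "AE y in surface (hplane b). (\<integral>\<^sup>+t. indicator ?Q y * indicator {0..1::real} t \<partial>lborel)
        = (\<integral>\<^sup>+t. indicator (cbox 0 One) (y + t *\<^sub>R b) \<partial>lborel)"
      using AE_surface[OF hplane_borel]
    proof eventually_elim
      case (elim y)
      have iff: "y \<in> ?Q \<and> t \<in> {0..1} \<longleftrightarrow> y + t *\<^sub>R b \<in> cbox 0 One" for t :: real
        using elim b by (auto simp: mem_box inner_add_left inner_Basis split: if_splits)
      show ?case
        unfolding indicator_def iff[symmetric] by (intro nn_integral_cong) (simp del: mem_Collect_eq)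
    qed
  qed
  also have "\<dots> = ennreal (slice_const TYPE('a)) * emeasure lborel (cbox 0 One :: 'a set)"
    using nn_integral_slices_eq_lborel[OF e assms, of "indicator (cbox 0 One)"] by simp
  finally show ?thesis by (auto simp: ennreal_eq_0_iff zero_less_iff_neq_zero)
qed

text \<open>Turns Lipschitz bounds for Hausdorff measure into bounds for Lebesgue measure; the
  factor \<open>k\<close> stands on both sides and drops out.\<close>

lemma hausdorff_outer_DIM_eq_lborel:
  obtains k where "0 < k" "\<And>B::'a::euclidean_space set. B \<in> sets borel \<Longrightarrow>
    hausdorff_outer (real DIM('a)) B = ennreal k * emeasure lborel B"
proof -
  let ?M = "hausdorff_measure (real DIM('a)) :: 'a measure"
  have bfin: "hausdorff_outer (real DIM('a)) A < \<infinity>" if "bounded A" for A :: "'a set"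
    using hausdorff_outer_coordinate_bounded_finite[of Basis A] that by auto
  have sf: "sigma_finite_measure ?M"
    by (rule sigma_finite_of_bounded_finite) (auto simp: emeasure_hausdorff_measure bfin[unfolded infinity_ennreal_def])
  let ?A = "cbox (- (1/2) *\<^sub>R One) ((1/2) *\<^sub>R One :: 'a)"
  have "emeasure ?M ?A < \<infinity>" using bfin[of ?A] by (simp add: emeasure_hausdorff_measure)
  then obtain k where k: "0 \<le> k" "emeasure ?M ?A = ennreal k" by (cases "emeasure ?M ?A") auto
  have inv: "emeasure ?M {x. v + x \<in> A} = emeasure ?M A" if A [measurable]: "A \<in> sets borel" for v A
  proof -
    have "A = (\<lambda>x. v + x) ` {x. v + x \<in> A}" by (auto simp: image_iff intro!: exI[of _ "_ - v"])
    moreover have "{x. v + x \<in> A} \<in> sets borel" by measurable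
    ultimately show ?thesis
      using hausdorff_outer_isometry[of "{x. v + x \<in> A}" "\<lambda>x. v + x" "real DIM('a)"] A
      by (simp add: emeasure_hausdorff_measure)
  qed
  have H: "hausdorff_outer (real DIM('a)) B = ennreal k * emeasure lborel B" if "B \<in> sets borel" for B :: "'a set"
    using translation_invariant_eq_lborel[OF _ sf inv that] k that by (simp add: emeasure_hausdorff_measure)
  have "0 < hausdorff_outer (real DIM('a)) {x::'a. \<forall>b\<in>Basis. if b \<in> Basis then 0 \<le> x \<bullet> b \<and> x \<bullet> b \<le> 1 else x \<bullet> b = 0}"
    using hausdorff_outer_unit_cube_pos[of "Basis :: 'a set"] by simp
  also have "{x::'a. \<forall>b\<in>Basis. if b \<in> Basis then 0 \<le> x \<bullet> b \<and> x \<bullet> b \<le> 1 else x \<bullet> b = 0} = cbox 0 One"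
    by (auto simp: mem_box)
  finally have "0 < k" using H[of "cbox 0 One"] k by (cases "k = 0") auto
  then show ?thesis using that H by blast
qed

lemma proj_perp_inner: "norm e = 1 \<Longrightarrow> proj_perp e x \<bullet> e = 0"
  by (simp add: proj_perp_def inner_diff_left norm_eq_1)

lemma continuous_on_proj_perp [continuous_intros]: "continuous_on A f \<Longrightarrow> continuous_on A (\<lambda>x. proj_perp e (f x))"
  unfolding proj_perp_def by (intro continuous_intros)

text \<open>Both sides are multiples of the Lebesgue measure of the skew cylinder over \<open>A\<close> in
  direction \<open>e\<close>, sliced along \<open>e\<close> and along \<open>n\<close> respectively.\<close>

lemma hausdorff_outer_proj_hplane:
  fixes n e :: "'a::euclidean_space"
  assumes n: "norm n = 1" and e: "norm e = 1" and dim: "DIM('a) \<ge> 2" and ne: "0 < n \<bullet> e"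
    and A [measurable]: "A \<in> sets borel" and An: "A \<subseteq> hplane n"
  shows "hausdorff_outer (real DIM('a) - 1) (proj_perp e ` A) = ennreal (n \<bullet> e) * hausdorff_outer (real DIM('a) - 1) A"
proof -
  let ?k = "n \<bullet> e" and ?H = "hausdorff_outer (real DIM('a) - 1)"
  have nn: "n \<bullet> n = 1" "e \<bullet> e = 1" using n e by (auto simp: norm_eq_1)
  \<comment> \<open>For \<open>x = a + t e\<close> with \<open>a\<close> in \<open>A\<close> the
    quotient \<open>(x \<bullet> n) / ?k\<close> is \<open>t\<close>, because
    \<open>a \<bullet> n = 0\<close>. So this is the skew cylinder with base \<open>A\<close> and
    edge \<open>e\<close>.\<close>
  define E where "E = {x. (x \<bullet> n) / ?k \<in> {0..1} \<and> x - ((x \<bullet> n) / ?k) *\<^sub>R e \<in> A}"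
  have E [measurable]: "E \<in> sets borel" unfolding E_def by measurable
  define g where "g y = y - ((y \<bullet> n) / ?k) *\<^sub>R e" for y
  have g [measurable]: "g \<in> borel_measurable borel" unfolding g_def by measurable
  have gA: "{y. g y \<in> A} \<in> sets borel" by measurable
  have img: "hplane e \<inter> {y. g y \<in> A} = proj_perp e ` A"
  proof (intro subset_antisym subsetI)
    fix y assume y: "y \<in> hplane e \<inter> {y. g y \<in> A}"
    then have "proj_perp e (g y) = y" by (simp add: proj_perp_def g_def inner_diff_left nn)
    then show "y \<in> proj_perp e ` A" using y by (metis IntD2 image_eqI mem_Collect_eq)
  next
    fix y assume "y \<in> proj_perp e ` A"
    then obtain a where a: "a \<in> A" "y = proj_perp e a" by auto
    have "a \<bullet> n = 0" using a An by auto
    then have "y \<bullet> n = - (a \<bullet> e) * ?k"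
      using a by (simp add: proj_perp_def inner_diff_left inner_commute[of e n])
    then have "g y = a" using a ne by (simp add: g_def proj_perp_def)
    then show "y \<in> hplane e \<inter> {y. g y \<in> A}" using a by (simp add: proj_perp_inner[OF e])
  qed
  have "ennreal (slice_const TYPE('a)) * emeasure lborel E
      = (\<integral>\<^sup>+y. \<integral>\<^sup>+t. indicator E (y + t *\<^sub>R e) \<partial>lborel \<partial>surface (hplane e))"
    using nn_integral_slices_eq_lborel[OF e dim, of "indicator E"] by simp
  also have "\<dots> = (\<integral>\<^sup>+y. indicator {y. g y \<in> A} y \<partial>surface (hplane e))"
  proof (rule nn_integral_cong)
    fix y
    let ?c = "(y \<bullet> n) / ?k"
    have "y + t *\<^sub>R e \<in> E \<longleftrightarrow> t \<in> {- ?c .. 1 - ?c} \<and> g y \<in> A" for t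
    proof -
      have q: "((y + t *\<^sub>R e) \<bullet> n) / ?k = ?c + t" using ne by (simp add: inner_add_left inner_commute[of e n] add_divide_distrib)
      show ?thesis unfolding E_def mem_Collect_eq q by (auto simp: g_def algebra_simps)
    qed
    then have "(\<integral>\<^sup>+t. indicator E (y + t *\<^sub>R e) \<partial>lborel)
        = (\<integral>\<^sup>+t. indicator {y. g y \<in> A} y * indicator {- ?c .. 1 - ?c} t \<partial>lborel)"
      by (intro nn_integral_cong) (auto simp: indicator_def)
    also have "\<dots> = indicator {y. g y \<in> A} y" by (subst nn_integral_cmult) auto
    finally show "(\<integral>\<^sup>+t. indicator E (y + t *\<^sub>R e) \<partial>lborel) = indicator {y. g y \<in> A} y" .
  qed
  also have "\<dots> = ?H (proj_perp e ` A)" using gA by (simp add: emeasure_surface img)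
  finally have 1: "ennreal (slice_const TYPE('a)) * emeasure lborel E = ?H (proj_perp e ` A)" .
  \<comment> \<open>\<open>y + t n\<close> lies on the edge over the base point
    \<open>y + t w\<close>. As \<open>w\<close> is orthogonal to \<open>n\<close>, the section at
    height \<open>t\<close> is a translate of \<open>A\<close> within the hyperplane of
    \<open>n\<close>.\<close>
  define w where "w = n - (1 / ?k) *\<^sub>R e"
  have wn: "w \<bullet> n = 0" using ne by (simp add: w_def inner_diff_left nn inner_commute[of e n])
  interpret S: sigma_finite_measure "surface (hplane n)" by (rule sigma_finite_surface_hplane[OF n dim])
  interpret pair_sigma_finite "surface (hplane n)" lborel ..
  have "ennreal (slice_const TYPE('a)) * emeasure lborel E
      = (\<integral>\<^sup>+y. \<integral>\<^sup>+t. indicator E (y + t *\<^sub>R n) \<partial>lborel \<partial>surface (hplane n))"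
    using nn_integral_slices_eq_lborel[OF n dim, of "indicator E"] by simp
  also have "\<dots> = (\<integral>\<^sup>+y. \<integral>\<^sup>+t. indicator {0..?k} t * indicator A (t *\<^sub>R w + y) \<partial>lborel \<partial>surface (hplane n))"
  proof (rule nn_integral_cong_AE)
    show "AE y in surface (hplane n). (\<integral>\<^sup>+t. indicator E (y + t *\<^sub>R n) \<partial>lborel)
       = (\<integral>\<^sup>+t. indicator {0..?k} t * indicator A (t *\<^sub>R w + y) \<partial>lborel)"
      using AE_surface[OF hplane_borel]
    proof eventually_elim
      case (elim y)
      show ?case
      proof (rule nn_integral_cong)
        fix t
        have q: "(y + t *\<^sub>R n) \<bullet> n = t" using elim by (simp add: inner_add_left nn)
        have "y + t *\<^sub>R n \<in> E \<longleftrightarrow> t \<in> {0..?k} \<and> t *\<^sub>R w + y \<in> A"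
          unfolding E_def mem_Collect_eq q using ne by (auto simp: w_def algebra_simps zero_le_divide_iff)
        then show "indicator E (y + t *\<^sub>R n) = (indicator {0..?k} t * indicator A (t *\<^sub>R w + y) :: ennreal)"
          by (auto simp: indicator_def)
      qed
    qed
  qed
  also have "\<dots> = (\<integral>\<^sup>+t. \<integral>\<^sup>+y. indicator {0..?k} t * indicator A (t *\<^sub>R w + y) \<partial>surface (hplane n) \<partial>lborel)"
    by (rule Fubini'[symmetric]) measurable
  also have "\<dots> = (\<integral>\<^sup>+t. indicator {0..?k} t * ?H A \<partial>lborel)"
  proof (rule nn_integral_cong)
    fix t
    have "(\<integral>\<^sup>+y. indicator A (t *\<^sub>R w + y) \<partial>surface (hplane n)) = (\<integral>\<^sup>+y. indicator A y \<partial>surface (hplane n))"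
      by (rule nn_integral_surface_hplane_translate[OF _ _ dim]) (auto simp: wn)
    also have "\<dots> = ?H A" using An A by (simp add: emeasure_surface Int_absorb1)
    finally show "(\<integral>\<^sup>+y. indicator {0..?k} t * indicator A (t *\<^sub>R w + y) \<partial>surface (hplane n)) = indicator {0..?k} t * ?H A"
      by (simp add: nn_integral_cmult)
  qed
  also have "\<dots> = ennreal ?k * ?H A" using ne by (simp add: nn_integral_multc)
  finally show ?thesis using 1 by simp
qed

text \<open>On a compact set the inverse of an injective continuous map is continuous, so the image
  is a preimage under a measurable map.\<close>

lemma compact_injective_image_borel:
  fixes f :: "'a::euclidean_space \<Rightarrow> 'b::euclidean_space"
  assumes Q: "compact Q" "continuous_on Q f" "inj_on f Q" and B: "B \<in> sets borel" "B \<subseteq> Q"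
  shows "f ` B \<in> sets borel"
proof -
  have cont: "continuous_on (f ` Q) (inv_into Q f)"
    using Q by (intro continuous_on_inv) auto
  have Qb: "f ` Q \<in> sets borel" using Q by (intro borel_compact compact_continuous_image)
  have "inv_into Q f \<in> borel_measurable (restrict_space borel (f ` Q))"
    using cont by (rule borel_measurable_continuous_on_restrict)
  then have "inv_into Q f -` B \<inter> f ` Q \<in> sets (restrict_space borel (f ` Q))"
    using measurable_sets[of "inv_into Q f" "restrict_space borel (f ` Q)" borel B] B by (simp add: space_restrict_space)
  moreover have "inv_into Q f -` B \<inter> f ` Q = f ` B"
    using B(2) Q(3) by (auto simp: inv_into_f_f image_iff subset_iff)
  ultimately show ?thesis using Qb by (auto simp: sets_restrict_space_iff)
qed

text \<open>Lindelof reduces the local neighbourhoods to countably many; making them disjoint cuts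
  \<open>B\<close> into pieces on which the inequality is assumed.\<close>

lemma emeasure_le_of_locally_le:
  fixes M N :: "'a::euclidean_space measure"
  assumes sets [measurable_cong]: "sets M = sets borel" "sets N = sets borel"
    and loc: "\<And>x. x \<in> S \<Longrightarrow> \<exists>U. open U \<and> x \<in> U \<and> (\<forall>B\<in>sets borel. B \<subseteq> S \<inter> U \<longrightarrow> emeasure M B \<le> emeasure N B)"
    and B: "B \<in> sets borel" "B \<subseteq> S"
  shows "emeasure M B \<le> emeasure N B"
proof (cases "B = {}")
  case False
  define F where "F = {U. open U \<and> (\<forall>B\<in>sets borel. B \<subseteq> S \<inter> U \<longrightarrow> emeasure M B \<le> emeasure N B)}"
  obtain F' where F': "F' \<subseteq> F" "countable F'" "\<Union>F' = \<Union>F"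
    using Lindelof[of F] by (auto simp: F_def)
  have SF: "S \<subseteq> \<Union>F'" using loc F'(3) by (fastforce simp: F_def)
  then have ne: "F' \<noteq> {}" using False B by auto
  define U where "U = from_nat_into F'"
  have U: "U i \<in> F" for i using F'(1) ne from_nat_into[OF ne] by (auto simp: U_def)
  then have oU: "U i \<in> sets borel" for i by (auto simp: F_def)
  have UU: "(\<Union>i. U i) = \<Union>F'"
    using range_from_nat_into[OF ne F'(2)] by (auto simp: U_def)
  let ?D = "\<lambda>i. B \<inter> disjointed U i"
  have dm: "?D i \<in> sets borel" for i using B oU sets.range_disjointed_sets[of U borel] by auto
  have disj: "disjoint_family ?D" using disjoint_family_disjointed[of U] by (auto simp: disjoint_family_on_def)
  have un: "(\<Union>i. ?D i) = B"
  proof -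
    have "(\<Union>i. ?D i) = B \<inter> (\<Union>i. disjointed U i)" by auto
    also have "\<dots> = B" using SF B UU by (auto simp: UN_disjointed_eq)
    finally show ?thesis .
  qed
  have sum: "(\<Sum>i. emeasure L (?D i)) = emeasure L B" if "sets L = sets borel" for L :: "'a measure"
  proof -
    have "range ?D \<subseteq> sets L" using dm that by blast
    from suminf_emeasure[OF this disj] show ?thesis by (simp only: un)
  qed
  have "emeasure M B = (\<Sum>i. emeasure M (?D i))" using sum[OF sets(1)] by simp
  also have "\<dots> \<le> (\<Sum>i. emeasure N (?D i))"
  proof (rule suminf_le)
    fix i
    have "?D i \<subseteq> S \<inter> U i" using B disjointed_subset[of U i] by auto
    then show "emeasure M (?D i) \<le> emeasure N (?D i)" using U[of i] dm[of i] by (auto simp: F_def)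
  qed auto
  also have "\<dots> = emeasure N B"
    by (rule sum[OF sets(2)])
  finally show ?thesis .
qed simp

lemma ennreal_le_of_le_mult:
  assumes "\<And>\<eta>::real. 0 < \<eta> \<Longrightarrow> a \<le> ennreal (1 + \<eta>) * b"
  shows "a \<le> b"
proof (rule ennreal_le_epsilon)
  fix e :: real assume e: "b < top" "0 < e"
  obtain r where r: "0 \<le> r" "b = ennreal r" using e by (cases b) auto
  \<comment> \<open>With \<open>\<eta> = e / (r + 1)\<close> the excess is at most \<open>e\<close>;
    the \<open>+ 1\<close> covers the case \<open>r = 0\<close>.\<close>
  have "a \<le> ennreal (1 + e / (r + 1)) * b" using e r by (intro assms) auto
  also have "\<dots> = ennreal ((1 + e / (r + 1)) * r)" unfolding r(2) using r e by (intro ennreal_mult[symmetric]) auto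
  also have "\<dots> \<le> ennreal (r + e)"
  proof (rule ennreal_leI)
    have "e / (r + 1) * r \<le> e" using r e by (simp add: field_simps)
    then show "(1 + e / (r + 1)) * r \<le> r + e" by (simp add: algebra_simps)
  qed
  also have "\<dots> = b + ennreal e" using r e by simp
  finally show "a \<le> b + ennreal e" .
qed

lemma proj_perp_diff: "proj_perp e (x - y) = proj_perp e x - proj_perp e y"
  by (simp add: proj_perp_def inner_diff_left algebra_simps)

lemma norm_proj_perp_le: "norm e = 1 \<Longrightarrow> norm (proj_perp e x) \<le> norm x"
proof -
  assume e: "norm e = 1"
  have "(norm (proj_perp e x))\<^sup>2 = (norm x)\<^sup>2 - (x \<bullet> e)\<^sup>2"
    using e unfolding power2_norm_eq_inner proj_perp_def
    by (simp add: inner_diff_left inner_diff_right inner_commute norm_eq_1 power2_eq_square)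
  then have "(norm (proj_perp e x))\<^sup>2 \<le> (norm x)\<^sup>2" by simp
  then show ?thesis by (rule power2_le_imp_le) simp
qed

text \<open>On a set that is almost orthogonal to \<open>n\<close>, both the projection along \<open>n\<close> and the comparison
  of the projections along \<open>e\<close> of the set and of its flattening are almost isometric.\<close>

lemma flat_patch_estimates:
  fixes n e :: "'a::euclidean_space"
  assumes n: "norm n = 1" and e: "norm e = 1" and dim: "DIM('a) \<ge> 2" and ne: "0 < n \<bullet> e"
    and flat: "\<And>x y. x \<in> Q \<Longrightarrow> y \<in> Q \<Longrightarrow> \<bar>(x - y) \<bullet> n\<bar> \<le> \<epsilon> * dist x y"
    and \<epsilon>: "0 < \<epsilon>" "\<epsilon> \<le> (n \<bullet> e) / 2" and C: "C = 2 * (1 + 1 / (n \<bullet> e))" and C\<epsilon>: "C * \<epsilon> < 1"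
    and Q: "compact Q" and B: "B \<in> sets borel" "B \<subseteq> Q"
  defines "s \<equiv> real DIM('a) - 1"
  shows "hausdorff_outer s (proj_perp n ` B) \<le> hausdorff_outer s B"
    and "hausdorff_outer s B \<le> ennreal ((1 / (1 - \<epsilon>)) powr s) * hausdorff_outer s (proj_perp n ` B)"
    and "proj_perp n ` B \<in> sets borel"
    and "hausdorff_outer s (proj_perp e ` B) \<le> ennreal ((1 / (1 - C * \<epsilon>)) powr s) * (ennreal (n \<bullet> e) * hausdorff_outer s B)"
    and "ennreal (n \<bullet> e) * hausdorff_outer s B
        \<le> ennreal ((1 / (1 - \<epsilon>)) powr s * (1 + C * \<epsilon>) powr s) * hausdorff_outer s (proj_perp e ` B)"
proof -
  let ?k = "n \<bullet> e"
  have s0: "0 \<le> s" using dim by (simp add: s_def)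
  have nn: "n \<bullet> n = 1" "e \<bullet> e = 1" using n e by (auto simp: norm_eq_1)
  have C2: "C \<ge> 2" unfolding C using ne by simp
  have C0: "0 \<le> C" using C2 by simp
  have "2 * \<epsilon> \<le> C * \<epsilon>" using C2 \<epsilon> by (intro mult_right_mono) auto
  then have \<epsilon>1: "\<epsilon> < 1" using C\<epsilon> \<epsilon> by linarith
  have pn: "norm (x - y) \<le> 1 / (1 - \<epsilon>) * norm (proj_perp n (x - y))" if "x \<in> Q" "y \<in> Q" for x y
  proof -
    have "norm (x - y) \<le> norm (proj_perp n (x - y)) + norm (((x - y) \<bullet> n) *\<^sub>R n)"
      unfolding proj_perp_def by (metis diff_add_cancel norm_triangle_ineq)
    also have "norm (((x - y) \<bullet> n) *\<^sub>R n) \<le> \<epsilon> * norm (x - y)" using flat[OF that] n by (simp add: dist_norm)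
    finally show ?thesis using \<epsilon>1 by (simp add: field_simps)
  qed
  \<comment> \<open>A difference almost orthogonal to \<open>n\<close> cannot be almost parallel to
    \<open>e\<close>, because \<open>n \<bullet> e > 0\<close>: its \<open>e\<close> component is at
    most half its length plus \<open>norm z / ?k\<close>. Absorbing the half yields the constant
    \<open>C\<close>.\<close>
  have pe: "norm (x - y) \<le> C * norm (proj_perp e (x - y))" if "x \<in> Q" "y \<in> Q" for x y
  proof -
    define t where "t = (x - y) \<bullet> e"
    define z where "z = proj_perp e (x - y)"
    have z: "x - y = z + t *\<^sub>R e" by (simp add: z_def t_def proj_perp_def)
    have "(x - y) \<bullet> n = z \<bullet> n + t * ?k" by (subst z) (simp add: inner_add_left inner_commute[of e n])
    then have "\<bar>t\<bar> * ?k \<le> \<bar>(x - y) \<bullet> n\<bar> + \<bar>z \<bullet> n\<bar>"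
      using ne by (metis abs_minus_commute abs_mult abs_of_pos abs_triangle_ineq4 add_diff_cancel_left')
    also have "\<dots> \<le> \<epsilon> * norm (x - y) + norm z"
      using flat[OF that] Cauchy_Schwarz_ineq2[of z n] n by (simp add: dist_norm)
    finally have tk: "\<bar>t\<bar> * ?k \<le> \<epsilon> * norm (x - y) + norm z" .
    have "\<epsilon> * norm (x - y) \<le> ?k / 2 * norm (x - y)" using \<epsilon> by (intro mult_right_mono) auto
    then have "\<bar>t\<bar> * ?k \<le> ?k / 2 * norm (x - y) + norm z" using tk by linarith
    then have "\<bar>t\<bar> \<le> norm (x - y) / 2 + norm z / ?k" using ne by (simp add: field_simps)
    moreover have "norm (x - y) \<le> norm z + \<bar>t\<bar>" using norm_triangle_ineq[of z "t *\<^sub>R e"] z e by simp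
    moreover define q where "q = norm z / ?k"
    ultimately have "norm (x - y) \<le> 2 * (norm z + q)" by simp
    then have "norm (x - y) \<le> 2 * (norm z + norm z / ?k)" by (simp add: q_def)
    then show ?thesis by (simp add: C z_def algebra_simps)
  qed
  have injn: "inj_on (proj_perp n) Q"
  proof (rule inj_onI)
    fix x y assume "x \<in> Q" "y \<in> Q" "proj_perp n x = proj_perp n y"
    then show "x = y" using pn[of x y] by (simp add: proj_perp_diff)
  qed
  have inje: "inj_on (proj_perp e) Q"
  proof (rule inj_onI)
    fix x y assume "x \<in> Q" "y \<in> Q" "proj_perp e x = proj_perp e y"
    then show "x = y" using pe[of x y] by (simp add: proj_perp_diff)
  qed
  show A: "proj_perp n ` B \<in> sets borel"
    using B Q injn by (intro compact_injective_image_borel) (auto intro!: continuous_intros)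
  show 1: "hausdorff_outer s (proj_perp n ` B) \<le> hausdorff_outer s B"
    using hausdorff_outer_lipschitz[of B "proj_perp n" 1 s] s0 norm_proj_perp_le[OF n]
    by (auto simp: dist_norm simp flip: proj_perp_diff)
  have Bn: "inv_into Q (proj_perp n) ` proj_perp n ` B = B"
    using injn B(2) by (simp add: inv_into_image_cancel)
  have "hausdorff_outer s (inv_into Q (proj_perp n) ` proj_perp n ` B)
      \<le> ennreal ((1 / (1 - \<epsilon>)) powr s) * hausdorff_outer s (proj_perp n ` B)"
  proof (rule hausdorff_outer_lipschitz)
    fix x y assume "x \<in> proj_perp n ` B" "y \<in> proj_perp n ` B"
    then show "dist (inv_into Q (proj_perp n) x) (inv_into Q (proj_perp n) y) \<le> 1 / (1 - \<epsilon>) * dist x y"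
      using injn B(2) pn by (auto simp: inv_into_f_f subset_iff dist_norm proj_perp_diff)
  qed (use \<epsilon>1 s0 in auto)
  then show 2: "hausdorff_outer s B \<le> ennreal ((1 / (1 - \<epsilon>)) powr s) * hausdorff_outer s (proj_perp n ` B)"
    by (simp only: Bn)
  let ?A = "proj_perp n ` B"
  have L: "hausdorff_outer s (proj_perp e ` ?A) = ennreal ?k * hausdorff_outer s ?A"
    unfolding s_def using A by (intro hausdorff_outer_proj_hplane[OF n e dim ne]) (auto simp: proj_perp_inner[OF n])
  \<comment> \<open>Flattening changes a difference by its small \<open>n\<close> component;
    \<open>pe\<close> measures this error against the length of the projection along
    \<open>e\<close>.\<close>
  have cmp: "norm (proj_perp e (x - y) - proj_perp e (proj_perp n x - proj_perp n y)) \<le> C * \<epsilon> * norm (proj_perp e (x - y))"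
    if "x \<in> Q" "y \<in> Q" for x y
  proof -
    have "proj_perp e (x - y) - proj_perp e (proj_perp n x - proj_perp n y) = ((x - y) \<bullet> n) *\<^sub>R proj_perp e n"
      by (simp add: proj_perp_diff[symmetric]) (simp add: proj_perp_def algebra_simps inner_diff_left)
    then have "norm (proj_perp e (x - y) - proj_perp e (proj_perp n x - proj_perp n y))
        = \<bar>(x - y) \<bullet> n\<bar> * norm (proj_perp e n)" by simp
    also have "\<dots> \<le> (\<epsilon> * norm (x - y)) * 1"
      using flat[OF that] norm_proj_perp_le[OF e, of n] n \<epsilon> by (intro mult_mono) (auto simp: dist_norm)
    also have "\<dots> \<le> \<epsilon> * (C * norm (proj_perp e (x - y)))" using pe[OF that] \<epsilon> by simp
    finally show ?thesis by (simp add: mult_ac)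
  qed
  have c1: "norm (proj_perp e (proj_perp n x - proj_perp n y)) \<le> (1 + C * \<epsilon>) * norm (proj_perp e (x - y))"
    if "x \<in> Q" "y \<in> Q" for x y
    using cmp[OF that] norm_triangle_ineq3[of "proj_perp e (x - y)" "proj_perp e (proj_perp n x - proj_perp n y)"]
    by (simp add: algebra_simps)
  have c2: "norm (proj_perp e (x - y)) \<le> 1 / (1 - C * \<epsilon>) * norm (proj_perp e (proj_perp n x - proj_perp n y))"
    if "x \<in> Q" "y \<in> Q" for x y
    using cmp[OF that] norm_triangle_ineq3[of "proj_perp e (x - y)" "proj_perp e (proj_perp n x - proj_perp n y)"] C\<epsilon>
    by (simp add: field_simps)
  have injne: "inj_on (\<lambda>x. proj_perp e (proj_perp n x)) Q"
  proof (rule inj_onI)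
    fix x y assume "x \<in> Q" "y \<in> Q" "proj_perp e (proj_perp n x) = proj_perp e (proj_perp n y)"
    then have "norm (proj_perp e (x - y)) \<le> 0" using c2[of x y] by (simp add: proj_perp_diff)
    then have "proj_perp e x = proj_perp e y" by (simp add: proj_perp_diff)
    then show "x = y" using inje \<open>x \<in> Q\<close> \<open>y \<in> Q\<close> by (simp add: inj_on_def)
  qed
  \<comment> \<open>\<open>G\<close> takes the \<open>e\<close>-projection of a flattened point to
    the \<open>e\<close>-projection of the point itself; \<open>F\<close> below goes the opposite
    way. Their Lipschitz constants are close to 1, which transfers
    \<open>hausdorff_outer_proj_hplane\<close> from the flat set to \<open>B\<close>.\<close>
  define G where "G = (\<lambda>z. proj_perp e (inv_into Q (\<lambda>x. proj_perp e (proj_perp n x)) z))"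
  have G: "G (proj_perp e (proj_perp n x)) = proj_perp e x" if "x \<in> Q" for x
    using injne that by (simp add: G_def inv_into_f_f[where f="\<lambda>x. proj_perp e (proj_perp n x)"])
  have Gim: "G ` proj_perp e ` ?A = proj_perp e ` B"
    using G B(2) by (force simp: image_image subset_iff)
  have "hausdorff_outer s (G ` proj_perp e ` ?A) \<le> ennreal ((1 / (1 - C * \<epsilon>)) powr s) * hausdorff_outer s (proj_perp e ` ?A)"
  proof (rule hausdorff_outer_lipschitz)
    fix u v assume "u \<in> proj_perp e ` ?A" "v \<in> proj_perp e ` ?A"
    then show "dist (G u) (G v) \<le> 1 / (1 - C * \<epsilon>) * dist u v"
      using G c2 B(2) by (auto simp: subset_iff dist_norm proj_perp_diff)
  qed (use C\<epsilon> s0 in auto)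
  then have "hausdorff_outer s (proj_perp e ` B) \<le> ennreal ((1 / (1 - C * \<epsilon>)) powr s) * (ennreal ?k * hausdorff_outer s ?A)"
    by (simp only: Gim L)
  also have "\<dots> \<le> ennreal ((1 / (1 - C * \<epsilon>)) powr s) * (ennreal ?k * hausdorff_outer s B)"
    by (intro mult_left_mono 1) auto
  finally show "hausdorff_outer s (proj_perp e ` B) \<le> ennreal ((1 / (1 - C * \<epsilon>)) powr s) * (ennreal ?k * hausdorff_outer s B)" .
  define F where "F = (\<lambda>z. proj_perp e (proj_perp n (inv_into Q (proj_perp e) z)))"
  have F: "F (proj_perp e x) = proj_perp e (proj_perp n x)" if "x \<in> Q" for x
    using inje that by (simp add: F_def)
  have Fim: "F ` proj_perp e ` B = proj_perp e ` ?A"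
    using F B(2) by (force simp: image_image subset_iff)
  have "hausdorff_outer s (F ` proj_perp e ` B) \<le> ennreal ((1 + C * \<epsilon>) powr s) * hausdorff_outer s (proj_perp e ` B)"
  proof (rule hausdorff_outer_lipschitz)
    fix u v assume "u \<in> proj_perp e ` B" "v \<in> proj_perp e ` B"
    then show "dist (F u) (F v) \<le> (1 + C * \<epsilon>) * dist u v"
      using F c1 B(2) by (auto simp: subset_iff dist_norm proj_perp_diff)
  next
    have "0 \<le> C * \<epsilon>" using C0 \<epsilon> by simp
    then show "0 < 1 + C * \<epsilon>" by linarith
  qed (use s0 in auto)
  then have 3: "ennreal ?k * hausdorff_outer s ?A \<le> ennreal ((1 + C * \<epsilon>) powr s) * hausdorff_outer s (proj_perp e ` B)"
    by (simp only: Fim L)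
  have "ennreal ?k * hausdorff_outer s B \<le> ennreal ?k * (ennreal ((1 / (1 - \<epsilon>)) powr s) * hausdorff_outer s ?A)"
    by (intro mult_left_mono 2) auto
  also have "\<dots> = ennreal ((1 / (1 - \<epsilon>)) powr s) * (ennreal ?k * hausdorff_outer s ?A)" by (simp add: mult_ac)
  also have "\<dots> \<le> ennreal ((1 / (1 - \<epsilon>)) powr s) * (ennreal ((1 + C * \<epsilon>) powr s) * hausdorff_outer s (proj_perp e ` B))"
    by (intro mult_left_mono 3) auto
  also have "\<dots> = ennreal ((1 / (1 - \<epsilon>)) powr s * (1 + C * \<epsilon>) powr s) * hausdorff_outer s (proj_perp e ` B)"
    by (simp add: ennreal_mult mult.assoc)
  finally show "ennreal ?k * hausdorff_outer s B
      \<le> ennreal ((1 / (1 - \<epsilon>)) powr s * (1 + C * \<epsilon>) powr s) * hausdorff_outer s (proj_perp e ` B)" .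
qed

section \<open>Convex bodies with unique normals\<close>

text \<open>\<open>n\<close> is total and vanishes off the boundary, which makes it Borel on the
  whole space. Smoothness enters as uniqueness of the normal, so the unit ball is an instance too;
  it yields finiteness of the measure of the sphere.\<close>

locale smooth_body =
  fixes K :: "'a::euclidean_space set" and n :: "'a \<Rightarrow> 'a"
  assumes dim: "DIM('a) \<ge> 2" and compact_K: "compact K" and convex_K: "convex K" and interior_K: "interior K \<noteq> {}"
    and normal_unit: "x \<in> frontier K \<Longrightarrow> norm (n x) = 1"
    and normal_le: "x \<in> frontier K \<Longrightarrow> y \<in> K \<Longrightarrow> (y - x) \<bullet> n x \<le> 0"
    and normal_unique: "x \<in> frontier K \<Longrightarrow> norm u = 1 \<Longrightarrow> (\<And>y. y \<in> K \<Longrightarrow> (y - x) \<bullet> u \<le> 0) \<Longrightarrow> u = n x"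
    and normal_outside: "x \<notin> frontier K \<Longrightarrow> n x = 0"
begin

abbreviation "S \<equiv> frontier K"

lemma closed_K: "closed K" using compact_K by (rule compact_imp_closed)

lemma S_subset: "S \<subseteq> K" using closed_K by (simp add: frontier_subset_closed)

lemma compact_S: "compact S" using compact_K by (rule compact_frontier)

lemma S_borel [measurable]: "S \<in> sets borel" using compact_S by (rule borel_compact)

lemma K_borel [measurable]: "K \<in> sets borel" using compact_K by (rule borel_compact)

text \<open>Uniqueness of the normal makes the graph closed, and a map into a compact space with
  closed graph is continuous.\<close>

lemma normal_continuous: "continuous_on S n"
proof -
  have "closedin (top_of_set (S \<times> sphere 0 1)) ((\<lambda>x. (x, n x)) ` S)"
  proof -
    have eq: "(\<lambda>x. (x, n x)) ` S = (S \<times> sphere 0 1) \<inter> (\<Inter>y\<in>K. {p. (y - fst p) \<bullet> snd p \<le> 0})"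
    proof (intro subset_antisym subsetI)
      fix p assume "p \<in> (\<lambda>x. (x, n x)) ` S"
      then show "p \<in> (S \<times> sphere 0 1) \<inter> (\<Inter>y\<in>K. {p. (y - fst p) \<bullet> snd p \<le> 0})"
        using normal_unit normal_le by auto
    next
      fix p assume p: "p \<in> (S \<times> sphere 0 1) \<inter> (\<Inter>y\<in>K. {p. (y - fst p) \<bullet> snd p \<le> 0})"
      then have "snd p = n (fst p)" by (intro normal_unique) auto
      then show "p \<in> (\<lambda>x. (x, n x)) ` S" using p by (auto simp: image_iff prod_eq_iff)
    qed
    have "closed {p. (y - fst p) \<bullet> snd p \<le> 0}" for y :: 'a
      by (intro closed_Collect_le continuous_intros)
    then have "closed (\<Inter>y\<in>K. {p. (y - fst p) \<bullet> snd p \<le> 0})" by auto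
    then show ?thesis unfolding eq by (rule closedin_closed_Int)
  qed
  then show ?thesis
    using continuous_closed_graph_eq[of "sphere 0 1" n S] normal_unit by auto
qed

lemma normal_measurable [measurable]: "n \<in> borel_measurable borel"
proof -
  have "(\<lambda>x. if x \<in> S then n x else 0) \<in> borel_measurable borel"
    using normal_continuous S_borel by (intro borel_measurable_continuous_on_if) auto
  moreover have "(\<lambda>x. if x \<in> S then n x else 0) = n" using normal_outside by auto
  ultimately show ?thesis by simp
qed

lemma norm_normal_le: "norm (n x) \<le> 1"
  using normal_unit[of x] normal_outside[of x] by (cases "x \<in> S") auto

text \<open>The supporting inequalities at \<open>x\<close> and at \<open>y\<close>, with normals
  close to \<open>n x0\<close>, bound the inner product from both sides.\<close>

lemma locally_flat:
  assumes x0: "x0 \<in> S" and \<epsilon>: "0 < \<epsilon>"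
  obtains \<delta> where "0 < \<delta>" "\<And>x. x \<in> S \<inter> cball x0 \<delta> \<Longrightarrow> norm (n x - n x0) \<le> \<epsilon>"
    "\<And>x y. x \<in> S \<inter> cball x0 \<delta> \<Longrightarrow> y \<in> S \<inter> cball x0 \<delta> \<Longrightarrow> \<bar>(x - y) \<bullet> n x0\<bar> \<le> \<epsilon> * dist x y"
proof -
  obtain d where d: "d > 0" "\<And>x. x \<in> S \<Longrightarrow> dist x x0 < d \<Longrightarrow> dist (n x) (n x0) < \<epsilon>"
    using normal_continuous x0 \<epsilon> unfolding continuous_on_iff by metis
  have nd: "norm (n x - n x0) \<le> \<epsilon>" if "x \<in> S \<inter> cball x0 (d/2)" for x
    using d(2)[of x] that d(1) by (auto simp: dist_norm norm_minus_commute)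
  have one: "(y - x) \<bullet> n x0 \<le> \<epsilon> * dist x y" if "x \<in> S \<inter> cball x0 (d/2)" "y \<in> S" for x y
  proof -
    have "(y - x) \<bullet> n x0 = (y - x) \<bullet> n x + (y - x) \<bullet> (n x0 - n x)" by (simp add: inner_diff_right)
    also have "\<dots> \<le> 0 + norm (y - x) * norm (n x0 - n x)"
      using normal_le[of x y] that S_subset by (intro add_mono norm_cauchy_schwarz) auto
    also have "\<dots> \<le> norm (y - x) * \<epsilon>"
      using nd[OF that(1)] by (simp add: norm_minus_commute mult_left_mono)
    finally show ?thesis by (simp add: dist_norm norm_minus_commute mult.commute)
  qed
  show ?thesis
  proof (rule that[of "d/2"])
    fix x y assume xy: "x \<in> S \<inter> cball x0 (d/2)" "y \<in> S \<inter> cball x0 (d/2)"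
    have "(x - y) \<bullet> n x0 = - ((y - x) \<bullet> n x0)" by (simp add: inner_diff_left)
    then show "\<bar>(x - y) \<bullet> n x0\<bar> \<le> \<epsilon> * dist x y"
      using one[of x y] one[of y x] xy by (auto simp: abs_le_iff dist_commute)
  qed (use d nd in auto)
qed

text \<open>Otherwise a hyperplane separates the interior of \<open>K\<close> from the open ray that
  leaves \<open>x\<close> in direction \<open>- e\<close>. It supports \<open>K\<close> at
  \<open>x\<close>, so by uniqueness its normal is a multiple of \<open>n x\<close>; but then
  \<open>n x \<bullet> e \<le> 0\<close>, as the ray lies on the outer side.\<close>

lemma interior_below:
  assumes x: "x \<in> S" and e: "0 < n x \<bullet> e"
  obtains s where "0 < s" "x - s *\<^sub>R e \<in> interior K"
proof -
  have "\<exists>s>0. x - s *\<^sub>R e \<in> interior K"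
  proof (rule ccontr)
    assume no: "\<not> ?thesis"
    let ?T = "(\<lambda>s. x - s *\<^sub>R e) ` {0<..}"
    have "convex ?T"
    proof -
      have "?T = (\<lambda>z. x + z) ` (\<lambda>s. s *\<^sub>R (- e)) ` {0<..}" by (auto simp: image_image)
      moreover have "linear (\<lambda>s. s *\<^sub>R (- e))" by (intro linearI) (auto simp: algebra_simps)
      ultimately show ?thesis by (simp add: convex_linear_image convex_translation)
    qed
    moreover have "interior K \<inter> ?T = {}" using no by auto
    ultimately obtain a b where ab: "a \<noteq> 0" "\<forall>y\<in>interior K. a \<bullet> y \<le> b" "\<forall>y\<in>?T. b \<le> a \<bullet> y"
      using separating_hyperplane_sets[of "interior K" ?T] interior_K convex_K by (auto simp: convex_interior)
    have "K \<subseteq> {y. a \<bullet> y \<le> b}"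
    proof -
      have "closure (interior K) \<subseteq> {y. a \<bullet> y \<le> b}"
        using ab(2) by (intro closure_minimal closed_halfspace_le) auto
      then show ?thesis using convex_closure_interior[OF convex_K interior_K] closed_K by simp
    qed
    then have Kb: "a \<bullet> y \<le> b" if "y \<in> K" for y using that by auto
    have T: "b \<le> a \<bullet> x - s * (a \<bullet> e)" if "s > 0" for s
      using ab(3) that by (auto simp: inner_diff_right)
    have "b \<le> a \<bullet> x"
    proof (rule field_le_epsilon)
      fix \<epsilon> :: real assume "0 < \<epsilon>"
      \<comment> \<open>Small enough for
        \<open>s * \<bar>a \<bullet> e\<bar> \<le> \<epsilon>\<close>; this lets the ray parameter
        tend to 0.\<close>
      define s where "s = \<epsilon> / (\<bar>a \<bullet> e\<bar> + 1)"
      have s: "0 < s" using \<open>0 < \<epsilon>\<close> by (simp add: s_def)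
      have "- (s * (a \<bullet> e)) \<le> s * \<bar>a \<bullet> e\<bar>" using s by (metis abs_ge_minus_self abs_mult abs_of_pos)
      also have "\<dots> \<le> \<epsilon>" using \<open>0 < \<epsilon>\<close> by (simp add: s_def field_simps)
      finally show "b \<le> a \<bullet> x + \<epsilon>" using T[OF s] by linarith
    qed
    then have bx: "b = a \<bullet> x" using Kb[of x] x S_subset by force
    have ae: "a \<bullet> e \<le> 0" using T[of 1] bx by simp
    have "a /\<^sub>R norm a = n x"
    proof (rule normal_unique[OF x])
      show "norm (a /\<^sub>R norm a) = 1" using ab(1) by simp
      fix y assume "y \<in> K"
      then have "a \<bullet> y \<le> a \<bullet> x" using Kb bx by auto
      then show "(y - x) \<bullet> (a /\<^sub>R norm a) \<le> 0"
        using ab(1) by (simp add: inner_diff_right inner_commute[of _ a] mult_le_0_iff)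
    qed
    then have "n x \<bullet> e = (a \<bullet> e) / norm a" by (metis inner_scaleR_left inverse_eq_divide mult.commute times_divide_eq_right mult.right_neutral)
    then show False using e ae ab(1) by (simp add: divide_le_0_iff not_less zero_less_divide_iff)
  qed
  then show ?thesis using that by blast
qed

lemma normal_pos_of_interior_below:
  assumes x: "x \<in> S" and s: "0 < s" "x - s *\<^sub>R e \<in> interior K"
  shows "0 < n x \<bullet> e"
proof -
  obtain d where d: "d > 0" "ball (x - s *\<^sub>R e) d \<subseteq> K" using s(2) by (auto simp: mem_interior)
  \<comment> \<open>The ball around the interior point leaves room for a step of
    \<open>d / 2\<close> along \<open>n x\<close>, which makes the supporting inequality
    strict.\<close>
  have "x - s *\<^sub>R e + (d/2) *\<^sub>R n x \<in> K"
    using d normal_unit[OF x] by (intro subsetD[OF d(2)]) (auto simp: dist_norm)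
  then have "(x - s *\<^sub>R e + (d/2) *\<^sub>R n x - x) \<bullet> n x \<le> 0" by (rule normal_le[OF x])
  moreover have "n x \<bullet> n x = 1" using normal_unit[OF x] by (simp add: norm_eq_1)
  ultimately have "d / 2 \<le> s * (n x \<bullet> e)" by (simp add: inner_add_left inner_diff_left inner_commute[of e])
  then have "0 < s * (n x \<bullet> e)" using d by linarith
  then show ?thesis using s by (simp add: zero_less_mult_iff)
qed

text \<open>The shadow of the interior rather than of \<open>K\<close>: it leaves out the lines that
  only touch \<open>K\<close>, a null set by \<open>AE_shadow\<close>, and over it the upper
  boundary point has a normal with positive \<open>e\<close> component.\<close>

definition shadow :: "'a \<Rightarrow> 'a set" where
  "shadow e = {y. y \<bullet> e = 0 \<and> (\<exists>t. y + t *\<^sub>R e \<in> interior K)}"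

text \<open>The default 0 on lines that miss \<open>K\<close> makes this a Borel function on the
  whole space.\<close>

definition height :: "'a \<Rightarrow> 'a \<Rightarrow> real" where
  "height e y = (if \<exists>t. y + t *\<^sub>R e \<in> K then Sup {t. y + t *\<^sub>R e \<in> K} else 0)"

definition top_point :: "'a \<Rightarrow> 'a \<Rightarrow> 'a" where
  "top_point e y = y + height e y *\<^sub>R e"

lemma line_slice_compact:
  assumes e: "norm e = 1"
  shows "compact {t. y + t *\<^sub>R e \<in> K}"
proof -
  obtain r where r: "\<And>x. x \<in> K \<Longrightarrow> norm x \<le> r" using compact_imp_bounded[OF compact_K] by (auto simp: bounded_iff)
  have "closed ((\<lambda>t. y + t *\<^sub>R e) -` K)"
    using closed_K by (intro continuous_closed_vimage) (auto intro!: continuous_intros)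
  moreover have "bounded {t. y + t *\<^sub>R e \<in> K}"
  proof (rule boundedI)
    fix t assume "t \<in> {t. y + t *\<^sub>R e \<in> K}"
    then have "norm (y + t *\<^sub>R e) \<le> r" using r by auto
    moreover have "norm (t *\<^sub>R e) \<le> norm (y + t *\<^sub>R e) + norm y"
      using norm_triangle_ineq4[of "y + t *\<^sub>R e" y] by simp
    ultimately show "norm t \<le> r + norm y" using e by simp
  qed
  ultimately show ?thesis by (simp add: compact_eq_bounded_closed vimage_def)
qed

lemma height_max:
  assumes e: "norm e = 1" and t: "y + t *\<^sub>R e \<in> K"
  shows "top_point e y \<in> K" "t \<le> height e y"
proof -
  let ?T = "{t. y + t *\<^sub>R e \<in> K}"
  have ne: "?T \<noteq> {}" using t by auto
  have c: "compact ?T" by (rule line_slice_compact[OF e])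
  have h: "height e y = Sup ?T" using t by (auto simp: height_def)
  have "Sup ?T \<in> ?T"
    using c ne by (intro closed_contains_Sup bounded_imp_bdd_above) (auto simp: compact_imp_bounded compact_imp_closed)
  then show "top_point e y \<in> K" by (simp add: top_point_def h)
  show "t \<le> height e y" unfolding h
    using t c by (intro cSup_upper bounded_imp_bdd_above) (auto simp: compact_imp_bounded)
qed

lemma top_point_shadow:
  assumes e: "norm e = 1" and y: "y \<in> shadow e"
  shows "top_point e y \<in> S" "0 < n (top_point e y) \<bullet> e" "proj_perp e (top_point e y) = y"
proof -
  have ee: "e \<bullet> e = 1" using e by (simp add: norm_eq_1)
  obtain t where t: "y + t *\<^sub>R e \<in> interior K" and ye: "y \<bullet> e = 0" using y by (auto simp: shadow_def)
  have not_int: "top_point e y \<notin> interior K"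
  proof
    assume "top_point e y \<in> interior K"
    then obtain d where d: "d > 0" "ball (top_point e y) d \<subseteq> K" by (auto simp: mem_interior)
    have "y + (height e y + d/2) *\<^sub>R e \<in> K"
      using d e by (intro subsetD[OF d(2)]) (auto simp: top_point_def dist_norm algebra_simps)
    then show False using height_max(2)[OF e, of y "height e y + d/2"] d by simp
  qed
  moreover have tK: "y + t *\<^sub>R e \<in> K" using t interior_subset by auto
  ultimately show S: "top_point e y \<in> S"
    using height_max(1)[OF e tK] closed_K by (simp add: frontier_def)
  have "t \<noteq> height e y" using not_int t by (auto simp: top_point_def)
  then have lt: "t < height e y" using height_max(2)[OF e tK] by simp
  show "0 < n (top_point e y) \<bullet> e"
    using S lt t by (intro normal_pos_of_interior_below[of _ "height e y - t"]) (auto simp: top_point_def algebra_simps)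
  show "proj_perp e (top_point e y) = y" by (simp add: proj_perp_def top_point_def inner_add_left ye ee)
qed

text \<open>Together with \<open>top_point_shadow\<close> this makes \<open>proj_perp e\<close> and
  \<open>top_point e\<close> inverse bijections between the part of the boundary with
  \<open>n x \<bullet> e > 0\<close> and the shadow. The supporting inequality at \<open>x\<close>
  leaves no point of \<open>K\<close> above \<open>x\<close>.\<close>

lemma top_point_proj:
  assumes e: "norm e = 1" and x: "x \<in> S" "0 < n x \<bullet> e"
  shows "proj_perp e x \<in> shadow e" "top_point e (proj_perp e x) = x"
proof -
  obtain s where s: "s > 0" "x - s *\<^sub>R e \<in> interior K" using interior_below[OF x] by blast
  have px: "proj_perp e x + t *\<^sub>R e = x + (t - x \<bullet> e) *\<^sub>R e" for t by (simp add: proj_perp_def algebra_simps)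
  have "proj_perp e x + (x \<bullet> e - s) *\<^sub>R e \<in> interior K" using s by (simp add: px)
  then show "proj_perp e x \<in> shadow e" using proj_perp_inner[OF e] by (auto simp: shadow_def)
  have xK: "proj_perp e x + (x \<bullet> e) *\<^sub>R e \<in> K" using x S_subset by (auto simp: px)
  have "(top_point e (proj_perp e x) - x) \<bullet> n x \<le> 0" using height_max(1)[OF e xK] by (rule normal_le[OF x(1)])
  moreover have eq: "top_point e (proj_perp e x) = x + (height e (proj_perp e x) - x \<bullet> e) *\<^sub>R e"
    by (simp add: top_point_def px)
  ultimately have "(height e (proj_perp e x) - x \<bullet> e) * (n x \<bullet> e) \<le> 0" by (simp add: inner_commute)
  then have "height e (proj_perp e x) \<le> x \<bullet> e" using x(2) by (simp add: mult_le_0_iff)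
  then have "height e (proj_perp e x) = x \<bullet> e" using height_max(2)[OF e xK] by simp
  then show "top_point e (proj_perp e x) = x" using eq by simp
qed

lemma height_measurable [measurable]:
  assumes e: "norm e = 1"
  shows "height e \<in> borel_measurable borel"
proof -
  \<comment> \<open>\<open>C a\<close> consists of the differences of points of the compact
    \<open>K\<close> and of a closed half-line, hence is closed. On the lines that meet
    \<open>K\<close> it is the superlevel set of the height.\<close>
  define C where "C a = {y. \<exists>t\<ge>a. y + t *\<^sub>R e \<in> K}" for a :: real
  have C: "C a \<in> sets borel" for a
  proof -
    let ?T = "(\<lambda>t. t *\<^sub>R e) ` {a..}"
    have "closed ?T"
    proof (rule closed_injective_linear_image)
      show "linear (\<lambda>t::real. t *\<^sub>R e)" by (intro linearI) (auto simp: algebra_simps)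
      show "inj (\<lambda>t::real. t *\<^sub>R e)" using e by (intro injI) auto
    qed simp
    then have "closed (\<Union>x\<in>K. \<Union>y\<in>?T. {x - y})" by (rule compact_closed_differences[OF compact_K])
    moreover have "(\<Union>x\<in>K. \<Union>y\<in>?T. {x - y}) = C a"
    proof (intro subset_antisym subsetI)
      fix y assume "y \<in> C a"
      then obtain t where "t \<ge> a" "y + t *\<^sub>R e \<in> K" by (auto simp: C_def)
      then show "y \<in> (\<Union>x\<in>K. \<Union>y\<in>?T. {x - y})" by (intro UN_I[of "y + t *\<^sub>R e"] UN_I[of "t *\<^sub>R e"]) auto
    qed (auto simp: C_def)
    ultimately show ?thesis by auto
  qed
  have ex: "(\<exists>t. y + t *\<^sub>R e \<in> K) \<longleftrightarrow> y \<in> (\<Union>i::nat. C (- real i))" for y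
  proof
    assume "\<exists>t. y + t *\<^sub>R e \<in> K"
    then obtain t where t: "y + t *\<^sub>R e \<in> K" ..
    obtain i :: nat where "- t \<le> real i" using real_arch_simple by blast
    then show "y \<in> (\<Union>i::nat. C (- real i))" using t by (auto simp: C_def intro!: exI[of _ i] exI[of _ t])
  qed (auto simp: C_def)
  have E: "(\<Union>i::nat. C (- real i)) \<in> sets borel" using C by auto
  show ?thesis
  proof (subst borel_measurable_iff_ge, rule allI)
    fix a
    \<comment> \<open>The complement accounts for the default height 0, which reaches the level
      exactly for \<open>a \<le> 0\<close>.\<close>
    have "{y \<in> space borel. a \<le> height e y} = C a \<union> (if a \<le> 0 then - (\<Union>i::nat. C (- real i)) else {})"
    proof (intro set_eqI)
      fix y
      show "y \<in> {y \<in> space borel. a \<le> height e y} \<longleftrightarrow> y \<in> C a \<union> (if a \<le> 0 then - (\<Union>i::nat. C (- real i)) else {})"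
      proof (cases "\<exists>t. y + t *\<^sub>R e \<in> K")
        case True
        then obtain t where t: "y + t *\<^sub>R e \<in> K" ..
        have "y \<in> C a \<longleftrightarrow> a \<le> height e y"
          using height_max[OF e] t unfolding C_def top_point_def by (auto intro: order_trans)
        then show ?thesis using True ex[of y] by auto
      next
        case False
        then have "y \<notin> C a" "height e y = 0" by (auto simp: C_def height_def)
        then show ?thesis using False ex[of y] by auto
      qed
    qed
    then show "{y \<in> space borel. a \<le> height e y} \<in> sets borel" using C E by auto
  qed
qed

lemma top_point_measurable:
  assumes e: "norm e = 1"
  shows "top_point e \<in> borel_measurable borel"
  using height_measurable[OF e] unfolding top_point_def by measurable

lemma shadow_borel [measurable]: "shadow e \<in> sets borel"
proof -
  have "open {y. \<exists>t. y + t *\<^sub>R e \<in> interior K}"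
  proof -
    have "{y. \<exists>t. y + t *\<^sub>R e \<in> interior K} = (\<Union>t. (\<lambda>y. y + t *\<^sub>R e) -` interior K)" by auto
    moreover have "open ((\<lambda>y. y + t *\<^sub>R e) -` interior K)" for t
      by (intro open_vimage continuous_intros) auto
    ultimately show ?thesis by auto
  qed
  then have "hplane e \<inter> {y. \<exists>t. y + t *\<^sub>R e \<in> interior K} \<in> sets borel" by auto
  moreover have "shadow e = hplane e \<inter> {y. \<exists>t. y + t *\<^sub>R e \<in> interior K}" by (auto simp: shadow_def)
  ultimately show ?thesis by simp
qed

end

text \<open>This holds even for \<open>s = 0\<close>, because \<open>0 powr 0 = 0\<close>.\<close>

lemma hausdorff_outer_singleton [simp]: "hausdorff_outer s {p} = 0"
proof -
  have "hausdorff_pre s \<delta> {p} \<le> 0" if "0 < \<delta>" for \<delta>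
    using hausdorff_pre_single[of "{p}" \<delta> s] that by simp
  then have "hausdorff_outer s {p} \<le> 0" unfolding hausdorff_outer_def by (intro SUP_least) auto
  then show ?thesis by simp
qed

lemma AE_surface_neq:
  assumes "T \<in> sets borel"
  shows "AE y in surface T. y \<noteq> p"
proof -
  have "emeasure (surface T) {p} \<le> hausdorff_outer (real DIM('a) - 1) {p :: 'a}"
    using assms by (subst emeasure_surface) (auto intro: hausdorff_outer_mono simp del: hausdorff_outer_singleton)
  then have "{p} \<in> null_sets (surface T)" by (auto simp: null_sets_def)
  then show ?thesis by (rule AE_I') auto
qed

context smooth_body
begin

text \<open>Near \<open>x0\<close> the density \<open>n x \<bullet> e\<close> is within \<epsilon>
  of its value at \<open>x0\<close>, and \<open>flat_patch_estimates\<close> compares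
  \<open>B\<close> with its projection. All error factors tend to 1 with \<epsilon>.\<close>

lemma projection_local_estimate:
  assumes e: "norm e = 1" and x0: "x0 \<in> S" "0 < n x0 \<bullet> e" and \<eta>: "0 < \<eta>"
  shows "\<exists>U. open U \<and> x0 \<in> U \<and> (\<forall>B\<in>sets borel. B \<subseteq> S \<inter> U \<longrightarrow>
     hausdorff_outer (real DIM('a) - 1) (proj_perp e ` B)
        \<le> ennreal (1 + \<eta>) * emeasure (density (surface S) (\<lambda>x. ennreal (n x \<bullet> e))) B \<and>
     emeasure (density (surface S) (\<lambda>x. ennreal (n x \<bullet> e))) B
        \<le> ennreal (1 + \<eta>) * hausdorff_outer (real DIM('a) - 1) (proj_perp e ` B))"
proof -
  let ?k = "n x0 \<bullet> e" and ?s = "real DIM('a) - 1" and ?M = "density (surface S) (\<lambda>x. ennreal (n x \<bullet> e))"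
  define C where "C = 2 * (1 + 1 / ?k)"
  have n0: "norm (n x0) = 1" using x0 by (simp add: normal_unit)
  have k0: "?k \<noteq> 0" using x0 by simp
  have l1: "((\<lambda>\<epsilon>. (1 / (1 - C * \<epsilon>)) powr ?s * (?k / (?k - \<epsilon>))) \<longlongrightarrow> (1 / (1 - C * 0)) powr ?s * (?k / (?k - 0))) (at_right 0)"
    using k0 by (intro tendsto_intros) auto
  have l2: "((\<lambda>\<epsilon>. (?k + \<epsilon>) / ?k * ((1 / (1 - \<epsilon>)) powr ?s * (1 + C * \<epsilon>) powr ?s))
      \<longlongrightarrow> (?k + 0) / ?k * ((1 / (1 - 0)) powr ?s * (1 + C * 0) powr ?s)) (at_right 0)"
    using k0 by (intro tendsto_intros) auto
  have l3: "((\<lambda>\<epsilon>. C * \<epsilon>) \<longlongrightarrow> C * 0) (at_right 0)" by (intro tendsto_intros)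
  have "\<forall>\<^sub>F \<epsilon> in at_right 0. (1 / (1 - C * \<epsilon>)) powr ?s * (?k / (?k - \<epsilon>)) < 1 + \<eta>"
    using order_tendstoD(2)[OF l1, of "1 + \<eta>"] k0 \<eta> by simp
  moreover have "\<forall>\<^sub>F \<epsilon> in at_right 0. (?k + \<epsilon>) / ?k * ((1 / (1 - \<epsilon>)) powr ?s * (1 + C * \<epsilon>) powr ?s) < 1 + \<eta>"
    using order_tendstoD(2)[OF l2, of "1 + \<eta>"] k0 \<eta> by simp
  moreover have "\<forall>\<^sub>F \<epsilon> in at_right 0. C * \<epsilon> < 1"
    using order_tendstoD(2)[OF l3, of 1] by simp
  moreover have "\<forall>\<^sub>F \<epsilon> in at_right 0. \<epsilon> < ?k / 2" using x0 by (auto intro!: eventually_at_rightI[of 0 "?k / 2"])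
  moreover have "\<forall>\<^sub>F \<epsilon> in at_right (0::real). 0 < \<epsilon>" by (auto intro!: eventually_at_rightI[of 0 1])
  ultimately have "\<forall>\<^sub>F \<epsilon> in at_right 0. (1 / (1 - C * \<epsilon>)) powr ?s * (?k / (?k - \<epsilon>)) < 1 + \<eta> \<and>
     (?k + \<epsilon>) / ?k * ((1 / (1 - \<epsilon>)) powr ?s * (1 + C * \<epsilon>) powr ?s) < 1 + \<eta> \<and> C * \<epsilon> < 1 \<and> \<epsilon> < ?k / 2 \<and> 0 < \<epsilon>"
    by eventually_elim auto
  then obtain \<epsilon> where ep: "(1 / (1 - C * \<epsilon>)) powr ?s * (?k / (?k - \<epsilon>)) < 1 + \<eta>"
     "(?k + \<epsilon>) / ?k * ((1 / (1 - \<epsilon>)) powr ?s * (1 + C * \<epsilon>) powr ?s) < 1 + \<eta>" "C * \<epsilon> < 1" "\<epsilon> < ?k / 2" "0 < \<epsilon>"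
    using eventually_happens[of _ "at_right (0::real)"] by (auto simp: trivial_limit_at_right_real)
  obtain \<delta> where d: "0 < \<delta>" "\<And>x. x \<in> S \<inter> cball x0 \<delta> \<Longrightarrow> norm (n x - n x0) \<le> \<epsilon>"
    "\<And>x y. x \<in> S \<inter> cball x0 \<delta> \<Longrightarrow> y \<in> S \<inter> cball x0 \<delta> \<Longrightarrow> \<bar>(x - y) \<bullet> n x0\<bar> \<le> \<epsilon> * dist x y"
    using locally_flat[OF x0(1) ep(5)] by blast
  have Q: "compact (S \<inter> cball x0 \<delta>)" using compact_S by (simp add: compact_Int)
  show ?thesis
  proof (intro exI[of _ "ball x0 \<delta>"] conjI ballI impI)
    fix B :: "'a set" assume B [measurable]: "B \<in> sets borel" and "B \<subseteq> S \<inter> ball x0 \<delta>"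
    then have BQ: "B \<subseteq> S \<inter> cball x0 \<delta>" by auto
    note fp = flat_patch_estimates[OF n0 e dim x0(2) d(3) ep(5) less_imp_le[OF ep(4)] C_def ep(3) Q B BQ]
    let ?H = "hausdorff_outer ?s"
    have MB: "emeasure ?M B = (\<integral>\<^sup>+x. ennreal (n x \<bullet> e) * indicator B x \<partial>surface S)"
      by (subst emeasure_density) auto
    have HB: "emeasure (surface S) B = ?H B" using BQ by (subst emeasure_surface) (auto simp: Int_absorb1)
    have ne: "\<bar>n x \<bullet> e - ?k\<bar> \<le> \<epsilon>" if "x \<in> B" for x
    proof -
      have "\<bar>(n x - n x0) \<bullet> e\<bar> \<le> norm (n x - n x0) * norm e" by (rule Cauchy_Schwarz_ineq2)
      moreover have "norm (n x - n x0) \<le> \<epsilon>" using that BQ by (intro d(2)) auto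
      ultimately show ?thesis using e by (simp add: inner_diff_left)
    qed
    have lo: "ennreal (?k - \<epsilon>) * ?H B \<le> emeasure ?M B"
    proof -
      have "ennreal (?k - \<epsilon>) * ?H B = (\<integral>\<^sup>+x. ennreal (?k - \<epsilon>) * indicator B x \<partial>surface S)"
        by (simp add: nn_integral_cmult HB)
      also have "\<dots> \<le> emeasure ?M B" unfolding MB
        using ne by (intro nn_integral_mono) (force simp: indicator_def intro!: ennreal_leI)
      finally show ?thesis .
    qed
    have hi: "emeasure ?M B \<le> ennreal (?k + \<epsilon>) * ?H B"
    proof -
      have "emeasure ?M B \<le> (\<integral>\<^sup>+x. ennreal (?k + \<epsilon>) * indicator B x \<partial>surface S)" unfolding MB
        using ne by (intro nn_integral_mono) (force simp: indicator_def intro!: ennreal_leI)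
      also have "\<dots> = ennreal (?k + \<epsilon>) * ?H B" by (simp add: nn_integral_cmult HB)
      finally show ?thesis .
    qed
    let ?a = "(1 / (1 - C * \<epsilon>)) powr ?s" and ?b = "(1 / (1 - \<epsilon>)) powr ?s * (1 + C * \<epsilon>) powr ?s"
    have ke: "0 < ?k - \<epsilon>" using ep x0 by linarith
    have "?H (proj_perp e ` B) \<le> ennreal ?a * (ennreal ?k * ?H B)" by (rule fp(4))
    also have "ennreal ?k = ennreal (?k / (?k - \<epsilon>)) * ennreal (?k - \<epsilon>)"
      using ke x0 by (subst ennreal_mult[symmetric]) auto
    also have "ennreal ?a * (ennreal (?k / (?k - \<epsilon>)) * ennreal (?k - \<epsilon>) * ?H B)
        = ennreal (?a * (?k / (?k - \<epsilon>))) * (ennreal (?k - \<epsilon>) * ?H B)"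
      using ke x0 by (subst ennreal_mult) (auto simp: mult_ac)
    also have "\<dots> \<le> ennreal (1 + \<eta>) * emeasure ?M B"
      using ep(1) lo by (intro mult_mono ennreal_leI) auto
    finally show "?H (proj_perp e ` B) \<le> ennreal (1 + \<eta>) * emeasure ?M B" .
    have "emeasure ?M B \<le> ennreal (?k + \<epsilon>) * ?H B" by (rule hi)
    also have "ennreal (?k + \<epsilon>) = ennreal ((?k + \<epsilon>) / ?k) * ennreal ?k"
      using x0 ep by (subst ennreal_mult[symmetric]) auto
    also have "ennreal ((?k + \<epsilon>) / ?k) * ennreal ?k * ?H B \<le> ennreal ((?k + \<epsilon>) / ?k) * (ennreal ?b * ?H (proj_perp e ` B))"
      unfolding mult.assoc by (intro mult_left_mono fp(5)) auto
    also have "\<dots> = ennreal ((?k + \<epsilon>) / ?k * ?b) * ?H (proj_perp e ` B)"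
      using x0 ep by (subst ennreal_mult) (auto simp: mult_ac)
    also have "\<dots> \<le> ennreal (1 + \<eta>) * ?H (proj_perp e ` B)"
      using ep(2) by (intro mult_right_mono ennreal_leI) auto
    finally show "emeasure ?M B \<le> ennreal (1 + \<eta>) * ?H (proj_perp e ` B)" .
  qed (use d in auto)
qed

text \<open>The area formula for projections. \<open>ennreal\<close> truncates negative values, so
  the density on the left is the positive part of \<open>n x \<bullet> e\<close>. Both measures live
  on \<open>P\<close>, where the local estimates are glued together and \<eta> tends to 0.\<close>

lemma projection_measure_eq:
  assumes e: "norm e = 1"
  shows "density (surface S) (\<lambda>x. ennreal (n x \<bullet> e))
    = distr (density (surface (hplane e)) (indicator (shadow e))) borel (top_point e)" (is "?M1 = ?M2")
proof -
  note [measurable] = top_point_measurable[OF e]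
  let ?H = "hausdorff_outer (real DIM('a) - 1)"
  define P where "P = {x\<in>S. 0 < n x \<bullet> e}"
  have P [measurable]: "P \<in> sets borel"
  proof -
    have "{x. 0 < n x \<bullet> e} \<in> sets borel" by measurable
    then have "S \<inter> {x. 0 < n x \<bullet> e} \<in> sets borel" by measurable
    moreover have "S \<inter> {x. 0 < n x \<bullet> e} = P" by (auto simp: P_def)
    ultimately show ?thesis by simp
  qed
  have M2: "emeasure ?M2 B = ?H (shadow e \<inter> top_point e -` B)" if B [measurable]: "B \<in> sets borel" for B
  proof -
    have m: "top_point e -` B \<in> sets borel" using measurable_sets[OF top_point_measurable[OF e] B] by simp
    have "emeasure ?M2 B = (\<integral>\<^sup>+y. indicator (shadow e) y * indicator (top_point e -` B) y \<partial>surface (hplane e))"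
      using m by (simp add: emeasure_distr emeasure_density)
    also have "\<dots> = emeasure (surface (hplane e)) (shadow e \<inter> top_point e -` B)"
      using m by (simp flip: indicator_inter_arith)
    also have "\<dots> = ?H (hplane e \<inter> (shadow e \<inter> top_point e -` B))"
      using m by (intro emeasure_surface) auto
    also have "hplane e \<inter> (shadow e \<inter> top_point e -` B) = shadow e \<inter> top_point e -` B"
      by (auto simp: shadow_def)
    finally show ?thesis .
  qed
  \<comment> \<open>On subsets of \<open>P\<close> the preimage under \<open>top_point e\<close> is
    the projection, which is the set in the local estimate.\<close>
  have proj: "shadow e \<inter> top_point e -` B = proj_perp e ` B" if "B \<subseteq> P" for B
  proof (intro subset_antisym subsetI)
    fix y assume "y \<in> shadow e \<inter> top_point e -` B"
    then show "y \<in> proj_perp e ` B" using top_point_shadow(3)[OF e, of y] by (metis IntD1 IntD2 image_eqI vimage_eq)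
  next
    fix y assume "y \<in> proj_perp e ` B"
    then show "y \<in> shadow e \<inter> top_point e -` B" using top_point_proj[OF e] that by (auto simp: P_def)
  qed
  have M2P: "emeasure ?M2 B = emeasure ?M2 (B \<inter> P)" if "B \<in> sets borel" for B
  proof -
    have "shadow e \<inter> top_point e -` B = shadow e \<inter> top_point e -` (B \<inter> P)"
      using top_point_shadow[OF e] by (auto simp: P_def)
    then show ?thesis using that by (simp add: M2)
  qed
  have M1P: "emeasure ?M1 B = emeasure ?M1 (B \<inter> P)" if B [measurable]: "B \<in> sets borel" for B
  proof -
    have "(\<integral>\<^sup>+x. ennreal (n x \<bullet> e) * indicator B x \<partial>surface S) = (\<integral>\<^sup>+x. ennreal (n x \<bullet> e) * indicator (B \<inter> P) x \<partial>surface S)"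
    proof (rule nn_integral_surface_cong[OF S_borel])
      fix x assume "x \<in> S"
      then show "ennreal (n x \<bullet> e) * indicator B x = ennreal (n x \<bullet> e) * indicator (B \<inter> P) x"
        by (auto simp: indicator_def P_def ennreal_neg not_less)
    qed auto
    then show ?thesis by (simp add: emeasure_density)
  qed
  have le: "emeasure ?M1 B \<le> emeasure ?M2 B \<and> emeasure ?M2 B \<le> emeasure ?M1 B" if B: "B \<in> sets borel" "B \<subseteq> P" for B
  proof
    show "emeasure ?M1 B \<le> emeasure ?M2 B"
    proof (rule ennreal_le_of_le_mult)
      fix \<eta> :: real assume \<eta>: "0 < \<eta>"
      have "emeasure ?M1 B \<le> emeasure (scale_measure (ennreal (1 + \<eta>)) ?M2) B"
      proof (rule emeasure_le_of_locally_le[OF _ _ _ B])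
        fix x assume "x \<in> P"
        then obtain U where U: "open U" "x \<in> U" "\<And>B. B \<in> sets borel \<Longrightarrow> B \<subseteq> S \<inter> U \<Longrightarrow>
            emeasure ?M1 B \<le> ennreal (1 + \<eta>) * ?H (proj_perp e ` B)"
          using projection_local_estimate[OF e _ _ \<eta>, of x] unfolding P_def by blast
        show "\<exists>U. open U \<and> x \<in> U \<and> (\<forall>B\<in>sets borel. B \<subseteq> P \<inter> U \<longrightarrow>
            emeasure ?M1 B \<le> emeasure (scale_measure (ennreal (1 + \<eta>)) ?M2) B)"
        proof (intro exI[of _ U] conjI ballI impI U(1,2))
          fix B assume B: "B \<in> sets borel" "B \<subseteq> P \<inter> U"
          then have "emeasure ?M1 B \<le> ennreal (1 + \<eta>) * ?H (proj_perp e ` B)"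
            by (intro U(3)) (auto simp: P_def)
          then show "emeasure ?M1 B \<le> emeasure (scale_measure (ennreal (1 + \<eta>)) ?M2) B"
            using B proj[of B] by (simp add: M2)
        qed
      qed auto
      then show "emeasure ?M1 B \<le> ennreal (1 + \<eta>) * emeasure ?M2 B" by simp
    qed
    show "emeasure ?M2 B \<le> emeasure ?M1 B"
    proof (rule ennreal_le_of_le_mult)
      fix \<eta> :: real assume \<eta>: "0 < \<eta>"
      have "emeasure ?M2 B \<le> emeasure (scale_measure (ennreal (1 + \<eta>)) ?M1) B"
      proof (rule emeasure_le_of_locally_le[OF _ _ _ B])
        fix x assume "x \<in> P"
        then obtain U where U: "open U" "x \<in> U" "\<And>B. B \<in> sets borel \<Longrightarrow> B \<subseteq> S \<inter> U \<Longrightarrow>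
            ?H (proj_perp e ` B) \<le> ennreal (1 + \<eta>) * emeasure ?M1 B"
          using projection_local_estimate[OF e _ _ \<eta>, of x] unfolding P_def by blast
        show "\<exists>U. open U \<and> x \<in> U \<and> (\<forall>B\<in>sets borel. B \<subseteq> P \<inter> U \<longrightarrow>
            emeasure ?M2 B \<le> emeasure (scale_measure (ennreal (1 + \<eta>)) ?M1) B)"
        proof (intro exI[of _ U] conjI ballI impI U(1,2))
          fix B assume B: "B \<in> sets borel" "B \<subseteq> P \<inter> U"
          then have "?H (proj_perp e ` B) \<le> ennreal (1 + \<eta>) * emeasure ?M1 B"
            by (intro U(3)) (auto simp: P_def)
          then show "emeasure ?M2 B \<le> emeasure (scale_measure (ennreal (1 + \<eta>)) ?M1) B"
            using B proj[of B] by (simp add: M2)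
        qed
      qed auto
      then show "emeasure ?M2 B \<le> ennreal (1 + \<eta>) * emeasure ?M1 B" by simp
    qed
  qed
  show ?thesis
  proof (rule measure_eqI)
    fix B assume "B \<in> sets ?M1"
    then have B: "B \<in> sets borel" by simp
    have "emeasure ?M1 (B \<inter> P) = emeasure ?M2 (B \<inter> P)" using le[of "B \<inter> P"] B by (auto intro: antisym)
    then show "emeasure ?M1 B = emeasure ?M2 B" using M1P[OF B] M2P[OF B] by simp
  qed simp
qed

lemma nn_integral_projection:
  assumes e: "norm e = 1" and f [measurable]: "f \<in> borel_measurable borel"
  shows "(\<integral>\<^sup>+x. ennreal (n x \<bullet> e) * f x \<partial>surface S)
    = (\<integral>\<^sup>+y. indicator (shadow e) y * f (top_point e y) \<partial>surface (hplane e))"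
proof -
  note [measurable] = top_point_measurable[OF e]
  have "(\<integral>\<^sup>+x. ennreal (n x \<bullet> e) * f x \<partial>surface S) = (\<integral>\<^sup>+x. f x \<partial>density (surface S) (\<lambda>x. ennreal (n x \<bullet> e)))"
    by (subst nn_integral_density) auto
  also have "\<dots> = (\<integral>\<^sup>+y. indicator (shadow e) y * f (top_point e y) \<partial>surface (hplane e))"
    unfolding projection_measure_eq[OF e] by (simp add: nn_integral_distr nn_integral_density)
  finally show ?thesis .
qed

lemma finite_surface: "finite_measure (surface S)"
proof
  let ?H = "hausdorff_outer (real DIM('a) - 1)"
  have "\<exists>\<delta>>0. ?H (S \<inter> cball x0 \<delta>) < \<infinity>" if x0: "x0 \<in> S" for x0
  proof -
    have n0: "norm (n x0) = 1" "n x0 \<bullet> n x0 = 1" using normal_unit[OF x0] by (simp_all add: norm_eq_1)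
    \<comment> \<open>Projecting along the normal at the centre gives
      \<open>n \<bullet> e = 1\<close>, hence \<open>C = 4\<close>; then
      \<open>\<epsilon> = 1/8\<close> satisfies \<open>\<epsilon> \<le> 1/2\<close> and
      \<open>C * \<epsilon> < 1\<close>.\<close>
    have "(0::real) < 1/8" by simp
    from locally_flat[OF x0 this] obtain \<delta> where d: "0 < \<delta>"
      "\<And>x y. x \<in> S \<inter> cball x0 \<delta> \<Longrightarrow> y \<in> S \<inter> cball x0 \<delta> \<Longrightarrow> \<bar>(x - y) \<bullet> n x0\<bar> \<le> 1/8 * dist x y"
      by metis
    have Q: "compact (S \<inter> cball x0 \<delta>)" using compact_S by (simp add: compact_Int)
    have "?H (S \<inter> cball x0 \<delta>) \<le> ennreal ((1 / (1 - 1/8)) powr (real DIM('a) - 1)) * ?H (proj_perp (n x0) ` (S \<inter> cball x0 \<delta>))"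
      by (rule flat_patch_estimates(2)[OF n0(1) n0(1) dim _ d(2), where C=4])
         (use n0 Q in \<open>auto intro: borel_compact\<close>)
    also have "\<dots> < \<infinity>"
    proof -
      have "bounded (proj_perp (n x0) ` (S \<inter> cball x0 \<delta>))"
        using Q by (intro compact_imp_bounded compact_continuous_image continuous_intros) auto
      then have "?H (proj_perp (n x0) ` (S \<inter> cball x0 \<delta>)) < \<infinity>"
        by (intro hausdorff_outer_hplane_finite[OF n0(1) dim]) (auto simp: proj_perp_inner[OF n0(1)])
      then show ?thesis by (simp add: ennreal_mult_less_top)
    qed
    finally show ?thesis using d(1) by blast
  qed
  then obtain \<delta> where d: "\<And>x. x \<in> S \<Longrightarrow> 0 < \<delta> x \<and> ?H (S \<inter> cball x (\<delta> x)) < \<infinity>" by metis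
  have cov: "S \<subseteq> (\<Union>x\<in>S. ball x (\<delta> x))" using d by auto
  obtain F where F: "F \<subseteq> S" "finite F" "S \<subseteq> (\<Union>x\<in>F. ball x (\<delta> x))"
    by (rule compactE_image[OF compact_S _ cov]) auto
  have "emeasure (surface S) UNIV = emeasure (surface S) (\<Union>x\<in>F. S \<inter> cball x (\<delta> x))"
  proof -
    have "(\<Union>x\<in>F. S \<inter> cball x (\<delta> x)) = S"
    proof (intro subset_antisym subsetI)
      fix x assume x: "x \<in> S"
      then obtain z where z: "z \<in> F" "x \<in> ball z (\<delta> z)" using F(3) by blast
      then have "x \<in> S \<inter> cball z (\<delta> z)" using x by simp
      then show "x \<in> (\<Union>x\<in>F. S \<inter> cball x (\<delta> x))" using z(1) by blast
    qed blast
    then show ?thesis by (simp add: emeasure_surface)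
  qed
  also have "\<dots> \<le> (\<Sum>x\<in>F. emeasure (surface S) (S \<inter> cball x (\<delta> x)))"
    using F(2) by (intro emeasure_subadditive_finite) auto
  also have "\<dots> < \<infinity>"
  proof -
    have "emeasure (surface S) (S \<inter> cball x (\<delta> x)) < top" if "x \<in> F" for x
    proof -
      have "S \<inter> (S \<inter> cball x (\<delta> x)) = S \<inter> cball x (\<delta> x)" by blast
      moreover have "x \<in> S" using that F(1) by blast
      ultimately show ?thesis using d[of x] by (subst emeasure_surface) simp_all
    qed
    then show ?thesis using F(2) by simp
  qed
  finally show "emeasure (surface S) (space (surface S)) \<noteq> \<infinity>" by simp
qed

text \<open>A line that meets \<open>K\<close> but not its interior lies in the boundary of the
  cylinder \<open>V\<close> over the interior. \<open>V\<close> is convex, so its boundary is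
  Lebesgue null, and slicing along \<open>e\<close> carries this over to the hyperplane.\<close>

lemma AE_shadow:
  assumes e: "norm e = 1"
  shows "AE y in surface (hplane e). (\<exists>t. y + t *\<^sub>R e \<in> K) \<longrightarrow> y \<in> shadow e"
proof -
  define V where "V = {x. \<exists>t. x + t *\<^sub>R e \<in> interior K}"
  define W where "W = {x. \<exists>t. x + t *\<^sub>R e \<in> K}"
  have VU: "V = (\<Union>t. (\<lambda>y. y + t *\<^sub>R e) -` interior K)" by (auto simp: V_def)
  have "open ((\<lambda>y. y + t *\<^sub>R e) -` interior K)" for t
    by (intro open_vimage continuous_intros) auto
  then have oV: "open V" by (auto simp: VU)
  have cV: "convex V"
  proof (rule convexI)
    fix x y and u v :: real assume xy: "x \<in> V" "y \<in> V" and uv: "0 \<le> u" "0 \<le> v" "u + v = 1"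
    then obtain t t' where "x + t *\<^sub>R e \<in> interior K" "y + t' *\<^sub>R e \<in> interior K" by (auto simp: V_def)
    then have "u *\<^sub>R (x + t *\<^sub>R e) + v *\<^sub>R (y + t' *\<^sub>R e) \<in> interior K"
      using uv convex_K by (intro convexD[OF convex_interior]) auto
    then show "u *\<^sub>R x + v *\<^sub>R y \<in> V"
      by (auto simp: V_def algebra_simps intro!: exI[of _ "u * t + v * t'"])
  qed
  have "W \<subseteq> closure V"
  proof
    fix x assume "x \<in> W"
    then obtain t where "x + t *\<^sub>R e \<in> K" by (auto simp: W_def)
    then have "x + t *\<^sub>R e \<in> closure (interior K)"
      using convex_closure_interior[OF convex_K interior_K] closed_K by simp
    then have "- (t *\<^sub>R e) + (x + t *\<^sub>R e) \<in> (+) (- (t *\<^sub>R e)) ` closure (interior K)" by (rule imageI)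
    then have "x \<in> closure ((+) (- (t *\<^sub>R e)) ` interior K)" unfolding closure_translation by simp
    moreover have "(+) (- (t *\<^sub>R e)) ` interior K \<subseteq> V" by (auto simp: V_def intro!: exI[of _ t])
    ultimately show "x \<in> closure V" using closure_mono by blast
  qed
  then have sub: "W - V \<subseteq> frontier V" using oV by (auto simp: frontier_def interior_open)
  define N where "N = frontier V"
  have "negligible N" unfolding N_def by (rule negligible_convex_frontier[OF cV])
  then have N0: "emeasure lborel N = 0"
    by (simp add: negligible_iff_null_sets null_sets_completion_iff N_def null_sets_def)
  have N [measurable]: "N \<in> sets borel" by (simp add: N_def)
  have Vinv: "x + t *\<^sub>R e \<in> V \<longleftrightarrow> x \<in> V" for x t
  proof
    assume "x + t *\<^sub>R e \<in> V"
    then obtain r where "x + t *\<^sub>R e + r *\<^sub>R e \<in> interior K" by (auto simp: V_def)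
    then show "x \<in> V" by (auto simp: V_def algebra_simps intro!: exI[of _ "t + r"])
  next
    assume "x \<in> V"
    then obtain r where "x + r *\<^sub>R e \<in> interior K" by (auto simp: V_def)
    then show "x + t *\<^sub>R e \<in> V" by (auto simp: V_def algebra_simps intro!: exI[of _ "r - t"])
  qed
  have Ninv: "x + t *\<^sub>R e \<in> N \<longleftrightarrow> x \<in> N" for x t
  proof -
    have "(+) (t *\<^sub>R e) ` V = V"
      using Vinv[of _ t] Vinv[of _ "-t"] by (force simp: image_iff add.commute intro!: bexI[of _ "_ - t *\<^sub>R e"])
    then have "(+) (t *\<^sub>R e) ` N = N" unfolding N_def by (metis frontier_translation)
    then show ?thesis by (metis add.commute add_left_cancel imageE imageI)
  qed
  \<comment> \<open>A line in direction \<open>e\<close> lies in \<open>N\<close> or misses it, so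
    its length in \<open>N\<close> is infinite or 0; the integral can vanish only if almost every
    line misses \<open>N\<close>.\<close>
  have "(\<integral>\<^sup>+y. \<infinity> * indicator N y \<partial>surface (hplane e)) = (\<integral>\<^sup>+y. \<integral>\<^sup>+t. indicator N (y + t *\<^sub>R e) \<partial>lborel \<partial>surface (hplane e))"
  proof (rule nn_integral_cong)
    fix y
    have "(\<integral>\<^sup>+t. indicator N (y + t *\<^sub>R e) \<partial>lborel) = (\<integral>\<^sup>+t. indicator N y \<partial>(lborel :: real measure))"
      using Ninv by (intro nn_integral_cong) (simp add: indicator_def)
    then show "\<infinity> * indicator N y = (\<integral>\<^sup>+t. indicator N (y + t *\<^sub>R e) \<partial>lborel)" by (simp add: mult.commute)
  qed
  also have "\<dots> = 0" using nn_integral_slices_eq_lborel[OF e dim, of "indicator N"] N0 by simp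
  finally have "AE y in surface (hplane e). \<infinity> * indicator N y = (0::ennreal)"
    by (subst (asm) nn_integral_0_iff_AE) auto
  with AE_surface[OF hplane_borel] show ?thesis
  proof eventually_elim
    case (elim y)
    then have "y \<notin> N" by (auto simp: indicator_def split: if_splits)
    then show ?case using sub elim by (auto simp: N_def V_def W_def shadow_def)
  qed
qed

end

section \<open>Polar coordinates\<close>

lemma nn_integral_lborel_scale:
  fixes f :: "'a::euclidean_space \<Rightarrow> ennreal"
  assumes [measurable]: "f \<in> borel_measurable borel" and c: "0 < c"
  shows "(\<integral>\<^sup>+x. f x \<partial>lborel) = ennreal (c ^ DIM('a)) * (\<integral>\<^sup>+x. f (c *\<^sub>R x) \<partial>lborel)"
  using c by (subst lborel_affine[of c "0::'a"])
    (auto simp: nn_integral_density nn_integral_distr nn_integral_cmult)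

text \<open>Its use is to obtain, from \<open>finite_surface\<close>, that the measure of the sphere
  is finite.\<close>

lemma smooth_body_ball:
  assumes "DIM('a::euclidean_space) \<ge> 2"
  shows "smooth_body (cball 0 1) (\<lambda>x::'a. if x \<in> sphere 0 1 then x else 0)"
proof
  fix x y :: 'a assume x: "x \<in> frontier (cball 0 1)" and y: "y \<in> cball 0 1"
  then have "y \<bullet> x \<le> 1" using norm_cauchy_schwarz[of y x] by simp
  then show "(y - x) \<bullet> (if x \<in> sphere 0 1 then x else 0) \<le> 0"
    using x by (auto simp: inner_diff_left norm_eq_1)
next
  fix x u :: 'a assume x: "x \<in> frontier (cball 0 1)" and u: "norm u = 1" and le: "\<And>y. y \<in> cball 0 1 \<Longrightarrow> (y - x) \<bullet> u \<le> 0"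
  have "(u - x) \<bullet> u \<le> 0" using u by (intro le) simp
  then have "1 \<le> x \<bullet> u" using u by (simp add: inner_diff_left norm_eq_1)
  moreover have "(u - x) \<bullet> (u - x) = 2 - 2 * (x \<bullet> u)"
    using u x by (simp add: inner_diff_left inner_diff_right inner_commute norm_eq_1)
  ultimately have "(u - x) \<bullet> (u - x) \<le> 0" by simp
  then have "u - x = 0" by (metis inner_eq_zero_iff inner_ge_zero order_antisym)
  then show "u = (if x \<in> sphere 0 1 then x else 0)" using x by simp
qed (use assms in auto)

text \<open>A set of directions gets the volume of the cone over it within the unit ball;
  \<open>sgn\<close> is the radial projection, and it sends only the origin off the sphere.\<close>

definition cone_measure :: "'a::euclidean_space measure" where
  "cone_measure = distr (density lborel (indicator (cball 0 1))) borel sgn"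

lemma sets_cone_measure [simp, measurable_cong]: "sets cone_measure = sets borel"
  by (simp add: cone_measure_def)

lemma borel_measurable_sgn_vec [measurable]: "(sgn :: 'a::euclidean_space \<Rightarrow> 'a) \<in> borel_measurable borel"
  unfolding sgn_div_norm[abs_def] by measurable

lemma norm_scaleR_sgn: "norm z *\<^sub>R sgn z = (z :: 'a::real_normed_vector)"
  by (cases "z = 0") (auto simp: sgn_div_norm)

lemma cball_borel [measurable]: "cball a r \<in> sets borel"
  by simp

lemma emeasure_cone_measure:
  assumes [measurable]: "B \<in> sets borel"
  shows "emeasure cone_measure B = emeasure lborel {z. norm z \<le> 1 \<and> sgn z \<in> (B :: 'a::euclidean_space set)}"
proof -
  have m: "sgn -` B \<in> sets borel" using measurable_sets[OF borel_measurable_sgn_vec assms] by simp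
  have "emeasure cone_measure B = (\<integral>\<^sup>+z. indicator (cball 0 1) z * indicator (sgn -` B) z \<partial>lborel)"
    unfolding cone_measure_def using m by (simp add: emeasure_distr emeasure_density)
  also have "\<dots> = emeasure lborel (cball 0 1 \<inter> sgn -` B)"
    using m by (simp flip: indicator_inter_arith)
  also have "cball 0 1 \<inter> sgn -` B = {z. norm z \<le> 1 \<and> sgn z \<in> B}" by auto
  finally show ?thesis .
qed

lemma nn_integral_cone_measure:
  assumes [measurable]: "f \<in> borel_measurable borel"
  shows "(\<integral>\<^sup>+u. f u \<partial>cone_measure) = (\<integral>\<^sup>+x. indicator (cball 0 1) x * f (sgn x) \<partial>(lborel :: 'a::euclidean_space measure))"
  unfolding cone_measure_def by (simp add: nn_integral_distr nn_integral_density)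

text \<open>The part of norm at most \<open>1 - \<delta>\<close> is a scaled copy of the whole cone.
  Writing \<open>1 - (1 - \<delta>) ^ d\<close> as \<delta> times a geometric sum isolates the
  thickness, which cancels later, from a factor that tends to the dimension.\<close>

lemma emeasure_shell:
  fixes B :: "'a::euclidean_space set"
  assumes B [measurable]: "B \<in> sets borel" and \<delta>: "0 < \<delta>" "\<delta> < 1"
  shows "emeasure lborel {z. 1 - \<delta> < norm z \<and> norm z \<le> 1 \<and> sgn z \<in> B}
    = ennreal (\<delta> * (\<Sum>i<DIM('a). (1 - \<delta>) ^ i)) * emeasure cone_measure B"
proof -
  let ?a = "1 - \<delta>" and ?E = "{z. 1 - \<delta> < norm z \<and> norm z \<le> 1 \<and> sgn z \<in> B}" and ?C = "{z. norm z \<le> 1 \<and> sgn z \<in> B}"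
  let ?I = "{z. norm z \<le> ?a \<and> sgn z \<in> B}"
  have a: "0 < ?a" using \<delta> by simp
  have [measurable]: "?E \<in> sets borel" "?C \<in> sets borel" "?I \<in> sets borel" by measurable
  have "emeasure lborel ?C \<le> emeasure lborel (cball 0 1 :: 'a set)" by (intro emeasure_mono) auto
  also have "\<dots> < \<infinity>" using emeasure_cball[of 1 "0::'a"] by simp
  finally obtain q where q: "0 \<le> q" "emeasure lborel ?C = ennreal q" by (cases "emeasure lborel ?C") auto
  have "emeasure lborel ?I = (\<integral>\<^sup>+x. indicator ?I x \<partial>lborel)" by simp
  also have "\<dots> = ennreal (?a ^ DIM('a)) * (\<integral>\<^sup>+x. indicator ?I (?a *\<^sub>R x) \<partial>lborel)"
    using a by (intro nn_integral_lborel_scale) auto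
  also have "(\<integral>\<^sup>+x. indicator ?I (?a *\<^sub>R x) \<partial>lborel) = (\<integral>\<^sup>+x. indicator ?C x \<partial>lborel)"
    using a by (intro nn_integral_cong) (auto simp: indicator_def sgn_scaleR abs_of_pos)
  also have "\<dots> = ennreal q" using q by simp
  finally have I: "emeasure lborel ?I = ennreal (?a ^ DIM('a) * q)" using q a by (simp add: ennreal_mult)
  have "emeasure lborel ?C = emeasure lborel (?E \<union> ?I)" using \<delta> by (intro arg_cong[where f="emeasure lborel"]) auto
  also have "\<dots> = emeasure lborel ?E + emeasure lborel ?I" by (intro plus_emeasure[symmetric]) auto
  finally have sum: "emeasure lborel ?E + ennreal (?a ^ DIM('a) * q) = ennreal q" using q I by simp
  then have "emeasure lborel ?E \<noteq> top" by auto
  then obtain p where p: "0 \<le> p" "emeasure lborel ?E = ennreal p" by (cases "emeasure lborel ?E") auto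
  have "p + ?a ^ DIM('a) * q = q" using sum p q a by (simp flip: ennreal_plus)
  then have "p = (1 - ?a ^ DIM('a)) * q" by (simp add: algebra_simps)
  also have "1 - ?a ^ DIM('a) = \<delta> * (\<Sum>i<DIM('a). ?a ^ i)" by (subst one_diff_power_eq) simp
  finally have pq: "p = \<delta> * (\<Sum>i<DIM('a). ?a ^ i) * q" .
  show ?thesis
    unfolding emeasure_cone_measure[OF B] q(2) p(2) pq using \<delta> q(1) a by (intro ennreal_mult) (auto intro!: mult_nonneg_nonneg sum_nonneg)
qed

lemma sphere_flat:
  fixes x0 :: "'a::euclidean_space"
  assumes "norm x = 1" "norm y = 1" "dist x x0 \<le> \<delta>" "dist y x0 \<le> \<delta>"
  shows "\<bar>(x - y) \<bullet> x0\<bar> \<le> \<delta> * dist x y"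
proof -
  \<comment> \<open>On the sphere \<open>x - y\<close> is orthogonal to \<open>x + y\<close>, so the
    midpoint of \<open>x\<close> and \<open>y\<close> may be subtracted from
    \<open>x0\<close>.\<close>
  have "(x - y) \<bullet> (x + y) = 0" using assms by (simp add: inner_diff_left inner_add_right inner_commute[of y x] norm_eq_1)
  then have "(x - y) \<bullet> x0 = (x - y) \<bullet> ((1/2) *\<^sub>R (x0 - x) + (1/2) *\<^sub>R (x0 - y))"
    by (simp add: inner_add_right inner_diff_right inner_diff_left add_divide_distrib diff_divide_distrib)
  then have "\<bar>(x - y) \<bullet> x0\<bar> \<le> norm (x - y) * norm ((1/2) *\<^sub>R (x0 - x) + (1/2) *\<^sub>R (x0 - y))"
    by (simp only: Cauchy_Schwarz_ineq2)
  also have "\<dots> \<le> norm (x - y) * \<delta>"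
  proof (rule mult_left_mono)
    have "norm ((1/2) *\<^sub>R (x0 - x) + (1/2) *\<^sub>R (x0 - y)) \<le> norm ((1/2) *\<^sub>R (x0 - x)) + norm ((1/2) *\<^sub>R (x0 - y))"
      by (rule norm_triangle_ineq)
    also have "\<dots> = 1/2 * dist x x0 + 1/2 * dist y x0" by (simp add: dist_norm norm_minus_commute)
    also have "\<dots> \<le> \<delta>" using assms by simp
    finally show "norm ((1/2) *\<^sub>R (x0 - x) + (1/2) *\<^sub>R (x0 - y)) \<le> \<delta>" .
  qed simp
  finally show ?thesis by (simp add: dist_norm mult.commute)
qed

text \<open>The map \<open>F\<close> straightens the radial segments of a thin shell over a small piece of the sphere.\<close>

lemma shell_straightening:
  fixes x0 :: "'a::euclidean_space"
  assumes \<delta>: "0 < \<delta>" "\<delta> \<le> 1/2"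
    and z: "1 - \<delta> \<le> norm z" "norm z \<le> 1" "dist (sgn z) x0 \<le> \<delta>"
    and z': "1 - \<delta> \<le> norm z'" "norm z' \<le> 1" "dist (sgn z') x0 \<le> \<delta>"
  defines "F \<equiv> \<lambda>z. sgn z - (1 - norm z) *\<^sub>R x0"
  shows "norm ((F z - F z') - (z - z')) \<le> 5 * \<delta> * norm (z - z')"
proof -
  define r r' b b' where "r = norm z" "r' = norm z'" "b = sgn z" "b' = sgn z'"
  have zr: "z = r *\<^sub>R b" "z' = r' *\<^sub>R b'" by (auto simp: r_r'_b_b'_def norm_scaleR_sgn)
  have rr: "\<bar>r - r'\<bar> \<le> norm (z - z')" unfolding r_r'_b_b'_def by (rule norm_triangle_ineq3)
  have "z' \<noteq> 0" using z' \<delta> by auto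
  then have nb: "norm b' = 1" by (simp add: r_r'_b_b'_def norm_sgn)
  \<comment> \<open>Since \<open>r \<ge> 1/2\<close>, the directions differ by at most four times
    the distance of the points.\<close>
  have "r * norm (b - b') = norm (r *\<^sub>R (b - b'))" using z \<delta> by (simp add: r_r'_b_b'_def)
  also have "r *\<^sub>R (b - b') = (z - z') - (r - r') *\<^sub>R b'" by (simp add: zr algebra_simps)
  also have "norm \<dots> \<le> norm (z - z') + norm ((r - r') *\<^sub>R b')" by (rule norm_triangle_ineq4)
  also have "\<dots> \<le> 2 * norm (z - z')" using rr nb by simp
  finally have "r * norm (b - b') \<le> 2 * norm (z - z')" .
  moreover have "1/2 * norm (b - b') \<le> r * norm (b - b')" using z \<delta> by (intro mult_right_mono) (auto simp: r_r'_b_b'_def)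
  ultimately have bb: "norm (b - b') \<le> 4 * norm (z - z')" by linarith
  have "(F z - F z') - (z - z') = (1 - r) *\<^sub>R (b - b') + (r' - r) *\<^sub>R (b' - x0)"
    unfolding F_def r_r'_b_b'_def(1,2)[symmetric] r_r'_b_b'_def(3,4)[symmetric] by (simp add: zr algebra_simps)
  also have "norm \<dots> \<le> norm ((1 - r) *\<^sub>R (b - b')) + norm ((r' - r) *\<^sub>R (b' - x0))" by (rule norm_triangle_ineq)
  also have "\<dots> = \<bar>1 - r\<bar> * norm (b - b') + \<bar>r - r'\<bar> * norm (b' - x0)" by (simp add: abs_minus_commute)
  also have "\<dots> \<le> \<delta> * (4 * norm (z - z')) + norm (z - z') * \<delta>"
    using z z' \<delta> rr bb by (intro add_mono mult_mono) (auto simp: r_r'_b_b'_def dist_norm)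
  finally show ?thesis by (simp add: algebra_simps)
qed

text \<open>Two nearly equal volumes are evaluated. The shell \<open>E\<close> over \<open>B\<close>
  has volume \<open>\<delta> * \<sigma>\<close> times the cone measure of \<open>B\<close>.
  \<open>F\<close> maps it onto the straight cylinder swept out by moving \<open>B\<close> by
  \<delta> along \<open>- x0\<close>, whose volume is \<delta> times the measure of the projection
  of \<open>B\<close>, up to \<open>slice_const\<close>. \<open>F\<close> changes lengths by factors
  between \<open>1 - 5 * \<delta>\<close> and \<open>1 + 5 * \<delta>\<close>.\<close>

lemma sphere_local_estimates:
  fixes x0 :: "'a::euclidean_space"
  assumes dim: "DIM('a) \<ge> 2" and x0: "norm x0 = 1" and \<delta>: "0 < \<delta>" "\<delta> \<le> 1/10"
    and B [measurable]: "B \<in> sets borel" and Bs: "B \<subseteq> sphere 0 1 \<inter> cball x0 \<delta>"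
  defines "s \<equiv> real DIM('a) - 1" and "\<sigma> \<equiv> (\<Sum>i<DIM('a). (1 - \<delta>) ^ i)"
  shows "ennreal (slice_const TYPE('a) * \<sigma>) * emeasure cone_measure B
      \<le> ennreal ((1 / (1 - 5 * \<delta>)) powr real DIM('a)) * hausdorff_outer s B"
    and "hausdorff_outer s B \<le> ennreal ((1 / (1 - \<delta>)) powr s * (1 + 5 * \<delta>) powr real DIM('a)) *
        (ennreal (slice_const TYPE('a) * \<sigma>) * emeasure cone_measure B)"
proof -
  let ?c = "slice_const TYPE('a)"
  have c0: "0 < ?c" by (rule slice_const_pos[OF dim])
  define Q where "Q = sphere 0 1 \<inter> cball x0 \<delta>"
  have Q: "compact Q" unfolding Q_def by (simp add: compact_Int)
  have BQ: "B \<subseteq> Q" using Bs by (simp add: Q_def)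
  have xx: "x0 \<bullet> x0 = 1" using x0 by (simp add: norm_eq_1)
  have flat: "\<bar>(x - y) \<bullet> x0\<bar> \<le> \<delta> * dist x y" if "x \<in> Q" "y \<in> Q" for x y
    using that by (intro sphere_flat) (auto simp: Q_def dist_commute)
  \<comment> \<open>Here \<open>n = e = x0\<close>, so \<open>C = 2 * (1 + 1) = 4\<close>, and
    \<delta> itself serves as the flatness by \<open>sphere_flat\<close>.\<close>
  note fp = flat_patch_estimates[OF x0 x0 dim _ flat, where C=4, OF _ _ _ \<delta>(1) _ _ _ Q B BQ]
  have fp1: "hausdorff_outer s (proj_perp x0 ` B) \<le> hausdorff_outer s B"
    and fp2: "hausdorff_outer s B \<le> ennreal ((1 / (1 - \<delta>)) powr s) * hausdorff_outer s (proj_perp x0 ` B)"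
    and fp3: "proj_perp x0 ` B \<in> sets borel"
    unfolding s_def using \<delta> xx by (auto intro!: fp)
  have inj: "b = b'" if "b \<in> B" "b' \<in> B" "proj_perp x0 b = proj_perp x0 b'" for b b'
  proof -
    have "b - b' = ((b - b') \<bullet> x0) *\<^sub>R x0" using that(3) by (simp add: proj_perp_def inner_diff_left algebra_simps)
    then have "norm (b - b') = \<bar>(b - b') \<bullet> x0\<bar>" using x0 by (metis norm_scaleR mult.right_neutral)
    also have "\<dots> \<le> \<delta> * norm (b - b')" using flat[of b b'] that BQ by (auto simp: dist_norm)
    finally have "(1 - \<delta>) * norm (b - b') \<le> 0" by (simp add: algebra_simps)
    then show ?thesis using \<delta> by (auto simp: mult_le_0_iff)
  qed
  define F where "F z = sgn z - (1 - norm z) *\<^sub>R x0" for z :: 'a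
  define E where "E = {z. 1 - \<delta> < norm z \<and> norm z \<le> 1 \<and> sgn z \<in> B}"
  define Z where "Z = {z. 1 - \<delta> \<le> norm z \<and> norm z \<le> 1 \<and> sgn z \<in> Q}"
  have E [measurable]: "E \<in> sets borel" unfolding E_def by measurable
  have EZ: "E \<subseteq> Z" using BQ by (auto simp: E_def Z_def)
  have Fz: "norm ((F z - F z') - (z - z')) \<le> 5 * \<delta> * norm (z - z')" if "z \<in> Z" "z' \<in> Z" for z z'
    unfolding F_def using that \<delta> by (intro shell_straightening) (auto simp: Z_def Q_def dist_commute)
  have up: "norm (F z - F z') \<le> (1 + 5 * \<delta>) * norm (z - z')" if "z \<in> Z" "z' \<in> Z" for z z'
    using Fz[OF that] norm_triangle_ineq2[of "F z - F z'" "z - z'"] by (simp add: algebra_simps)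
  have lo: "norm (z - z') \<le> 1 / (1 - 5 * \<delta>) * norm (F z - F z')" if "z \<in> Z" "z' \<in> Z" for z z'
    using Fz[OF that] norm_triangle_ineq3[of "F z - F z'" "z - z'"] \<delta> by (simp add: field_simps)
  have injF: "inj_on F Z"
  proof (rule inj_onI)
    fix z z' assume "z \<in> Z" "z' \<in> Z" "F z = F z'"
    then show "z = z'" using lo[of z z'] by simp
  qed
  have Z: "compact Z"
  proof -
    have "Z = (\<lambda>(r, b). r *\<^sub>R b) ` ({1 - \<delta>..1} \<times> Q)"
    proof (intro subset_antisym subsetI)
      fix z assume "z \<in> Z"
      then show "z \<in> (\<lambda>(r, b). r *\<^sub>R b) ` ({1 - \<delta>..1} \<times> Q)"
        by (intro image_eqI[of _ _ "(norm z, sgn z)"]) (auto simp: Z_def norm_scaleR_sgn)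
    next
      fix z assume "z \<in> (\<lambda>(r, b). r *\<^sub>R b) ` ({1 - \<delta>..1} \<times> Q)"
      then obtain r b where "z = r *\<^sub>R b" "1 - \<delta> \<le> r" "r \<le> 1" "b \<in> Q" by auto
      moreover from this have "sgn z = b" "norm z = r" using \<delta> by (auto simp: Q_def sgn_scaleR sgn_div_norm[of b])
      ultimately show "z \<in> Z" by (simp add: Z_def)
    qed
    moreover have "compact \<dots>" using Q
      by (intro compact_continuous_image compact_Times) (auto intro!: continuous_intros simp: split_beta)
    ultimately show ?thesis by simp
  qed
  have contF: "continuous_on Z F"
    unfolding F_def sgn_div_norm using \<delta> by (intro continuous_intros) (auto simp: Z_def)
  have D [measurable]: "F ` E \<in> sets borel"
    by (rule compact_injective_image_borel[OF Z contF injF E EZ])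
  obtain k where k: "0 < k" "\<And>A::'a set. A \<in> sets borel \<Longrightarrow> hausdorff_outer (real DIM('a)) A = ennreal k * emeasure lborel A"
    using hausdorff_outer_DIM_eq_lborel by blast
  \<comment> \<open>Lipschitz bounds speak of the Hausdorff measure of full dimension, a positive
    multiple of Lebesgue measure; the multiple cancels.\<close>
  have cancel: "emeasure lborel X \<le> ennreal L * emeasure lborel Y"
    if "hausdorff_outer (real DIM('a)) X \<le> ennreal L * hausdorff_outer (real DIM('a)) Y"
      "X \<in> sets borel" "Y \<in> sets borel" for X Y :: "'a set" and L
  proof -
    have "ennreal k * emeasure lborel X \<le> ennreal k * (ennreal L * emeasure lborel Y)"
      using that by (simp add: k(2) mult.left_commute)
    then show ?thesis using k(1) by (subst (asm) ennreal_mult_le_mult_iff) auto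
  qed
  have DE: "emeasure lborel (F ` E) \<le> ennreal ((1 + 5 * \<delta>) powr real DIM('a)) * emeasure lborel E"
    by (rule cancel[OF hausdorff_outer_lipschitz]) (use up EZ \<delta> in \<open>auto simp: dist_norm subset_iff\<close>)
  have ED: "emeasure lborel E \<le> ennreal ((1 / (1 - 5 * \<delta>)) powr real DIM('a)) * emeasure lborel (F ` E)"
  proof -
    have im: "inv_into Z F ` F ` E = E" using injF EZ by (rule inv_into_image_cancel)
    have "hausdorff_outer (real DIM('a)) (inv_into Z F ` F ` E)
        \<le> ennreal ((1 / (1 - 5 * \<delta>)) powr real DIM('a)) * hausdorff_outer (real DIM('a)) (F ` E)"
    proof (rule hausdorff_outer_lipschitz)
      fix x y assume "x \<in> F ` E" "y \<in> F ` E"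
      then show "dist (inv_into Z F x) (inv_into Z F y) \<le> 1 / (1 - 5 * \<delta>) * dist x y"
        using injF EZ lo by (auto simp: inv_into_f_f subset_iff dist_norm)
    qed (use \<delta> in auto)
    then show ?thesis unfolding im by (rule cancel) auto
  qed
  have cyl: "ennreal ?c * emeasure lborel (F ` E) = ennreal \<delta> * hausdorff_outer s (proj_perp x0 ` B)"
  proof -
    have "ennreal ?c * emeasure lborel (F ` E)
        = (\<integral>\<^sup>+y. \<integral>\<^sup>+t. indicator (F ` E) (y + t *\<^sub>R x0) \<partial>lborel \<partial>surface (hplane x0))"
      using nn_integral_slices_eq_lborel[OF x0 dim, of "indicator (F ` E)"] by simp
    also have "\<dots> = (\<integral>\<^sup>+y. ennreal \<delta> * indicator (proj_perp x0 ` B) y \<partial>surface (hplane x0))"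
    proof (rule nn_integral_cong_AE)
      show "AE y in surface (hplane x0). (\<integral>\<^sup>+t. indicator (F ` E) (y + t *\<^sub>R x0) \<partial>lborel) = ennreal \<delta> * indicator (proj_perp x0 ` B) y"
        using AE_surface[OF hplane_borel]
      proof eventually_elim
        case (elim y)
        have FE: "w \<in> F ` E \<longleftrightarrow> (\<exists>b\<in>B. \<exists>\<tau>. 0 \<le> \<tau> \<and> \<tau> < \<delta> \<and> w = b - \<tau> *\<^sub>R x0)" for w
        proof
          assume "w \<in> F ` E"
          then show "\<exists>b\<in>B. \<exists>\<tau>. 0 \<le> \<tau> \<and> \<tau> < \<delta> \<and> w = b - \<tau> *\<^sub>R x0"
            by (auto simp: F_def E_def intro!: bexI[of _ "sgn _"] exI[of _ "1 - norm _"])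
        next
          assume "\<exists>b\<in>B. \<exists>\<tau>. 0 \<le> \<tau> \<and> \<tau> < \<delta> \<and> w = b - \<tau> *\<^sub>R x0"
          then obtain b \<tau> where b: "b \<in> B" "0 \<le> \<tau>" "\<tau> < \<delta>" "w = b - \<tau> *\<^sub>R x0" by auto
          have "norm b = 1" using b BQ by (auto simp: Q_def)
          then have "norm ((1 - \<tau>) *\<^sub>R b) = 1 - \<tau>" "sgn ((1 - \<tau>) *\<^sub>R b) = b"
            using b \<delta> by (auto simp: sgn_scaleR sgn_div_norm[of b])
          then show "w \<in> F ` E" using b by (intro image_eqI[of _ _ "(1 - \<tau>) *\<^sub>R b"]) (auto simp: F_def E_def)
        qed
        show ?case
        proof (cases "y \<in> proj_perp x0 ` B")
          case True
          then obtain b where b: "b \<in> B" "y = proj_perp x0 b" by auto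
          \<comment> \<open>Exactly one segment of length \<delta> is hit, because
            \<open>proj_perp x0\<close> is injective on \<open>B\<close>.\<close>
          have "y + t *\<^sub>R x0 \<in> F ` E \<longleftrightarrow> t \<in> {b \<bullet> x0 - \<delta> <.. b \<bullet> x0}" for t
          proof
            assume "y + t *\<^sub>R x0 \<in> F ` E"
            then obtain b' \<tau> where b': "b' \<in> B" "0 \<le> \<tau>" "\<tau> < \<delta>" "y + t *\<^sub>R x0 = b' - \<tau> *\<^sub>R x0" by (auto simp: FE)
            have "proj_perp x0 (y + t *\<^sub>R x0) = y" using elim by (simp add: proj_perp_def inner_add_left xx)
            moreover have "proj_perp x0 (b' - \<tau> *\<^sub>R x0) = proj_perp x0 b'" by (simp add: proj_perp_def inner_diff_left xx algebra_simps)
            ultimately have "b' = b" using inj[OF b'(1) b(1)] b b'(4) by simp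
            then have "t = b \<bullet> x0 - \<tau>" using arg_cong[OF b'(4), of "\<lambda>v. v \<bullet> x0"] elim
              by (simp add: inner_add_left inner_diff_left xx)
            then show "t \<in> {b \<bullet> x0 - \<delta> <.. b \<bullet> x0}" using b' by auto
          next
            assume "t \<in> {b \<bullet> x0 - \<delta> <.. b \<bullet> x0}"
            then show "y + t *\<^sub>R x0 \<in> F ` E" unfolding FE using b
              by (intro bexI[of _ b] exI[of _ "b \<bullet> x0 - t"]) (auto simp: proj_perp_def algebra_simps)
          qed
          then have "(\<integral>\<^sup>+t. indicator (F ` E) (y + t *\<^sub>R x0) \<partial>lborel) = (\<integral>\<^sup>+t. indicator {b \<bullet> x0 - \<delta> <.. b \<bullet> x0} t \<partial>lborel)"
            by (intro nn_integral_cong) (simp add: indicator_def)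
          then show ?thesis using True \<delta> by simp
        next
          case False
          have "y + t *\<^sub>R x0 \<notin> F ` E" for t
          proof
            assume "y + t *\<^sub>R x0 \<in> F ` E"
            then obtain b' \<tau> where b': "b' \<in> B" "y + t *\<^sub>R x0 = b' - \<tau> *\<^sub>R x0" by (auto simp: FE)
            have "proj_perp x0 (y + t *\<^sub>R x0) = y" using elim by (simp add: proj_perp_def inner_add_left xx)
            moreover have "proj_perp x0 (b' - \<tau> *\<^sub>R x0) = proj_perp x0 b'" by (simp add: proj_perp_def inner_diff_left xx algebra_simps)
            ultimately show False using False b' by auto
          qed
          then show ?thesis using False by simp
        qed
      qed
    qed
    also have "\<dots> = ennreal \<delta> * hausdorff_outer s (proj_perp x0 ` B)"
    proof -
      have "hplane x0 \<inter> proj_perp x0 ` B = proj_perp x0 ` B" using proj_perp_inner[OF x0] by auto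
      then show ?thesis using fp3 by (simp add: nn_integral_cmult emeasure_surface s_def)
    qed
    finally show ?thesis .
  qed
  have \<sigma>0: "0 \<le> \<sigma>" unfolding \<sigma>_def using \<delta> by (intro sum_nonneg) auto
  have Econe: "ennreal ?c * emeasure lborel E = ennreal \<delta> * (ennreal (?c * \<sigma>) * emeasure cone_measure B)"
    unfolding E_def using \<delta> c0 \<sigma>0 by (subst emeasure_shell[OF B]) (auto simp: \<sigma>_def[symmetric] ennreal_mult mult_ac)
  have cancel\<delta>: "X \<le> Y" if "ennreal \<delta> * X \<le> ennreal \<delta> * Y" for X Y
    using that \<delta> by (subst (asm) ennreal_mult_le_mult_iff) auto
  have "ennreal \<delta> * (ennreal (?c * \<sigma>) * emeasure cone_measure B)
      \<le> ennreal ?c * (ennreal ((1 / (1 - 5 * \<delta>)) powr real DIM('a)) * emeasure lborel (F ` E))"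
    unfolding Econe[symmetric] by (intro mult_left_mono ED) auto
  also have "\<dots> = ennreal ((1 / (1 - 5 * \<delta>)) powr real DIM('a)) * (ennreal \<delta> * hausdorff_outer s (proj_perp x0 ` B))"
    unfolding cyl[symmetric] by (simp add: mult_ac)
  also have "\<dots> \<le> ennreal ((1 / (1 - 5 * \<delta>)) powr real DIM('a)) * (ennreal \<delta> * hausdorff_outer s B)"
    by (intro mult_left_mono fp1) auto
  also have "\<dots> = ennreal \<delta> * (ennreal ((1 / (1 - 5 * \<delta>)) powr real DIM('a)) * hausdorff_outer s B)" by (simp add: mult_ac)
  finally show "ennreal (?c * \<sigma>) * emeasure cone_measure B
      \<le> ennreal ((1 / (1 - 5 * \<delta>)) powr real DIM('a)) * hausdorff_outer s B" by (rule cancel\<delta>)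
  have "ennreal \<delta> * hausdorff_outer s (proj_perp x0 ` B) \<le> ennreal ?c * (ennreal ((1 + 5 * \<delta>) powr real DIM('a)) * emeasure lborel E)"
    unfolding cyl[symmetric] by (intro mult_left_mono DE) auto
  also have "\<dots> = ennreal ((1 + 5 * \<delta>) powr real DIM('a)) * (ennreal ?c * emeasure lborel E)" by (simp add: mult_ac)
  also have "\<dots> = ennreal \<delta> * (ennreal ((1 + 5 * \<delta>) powr real DIM('a)) * (ennreal (?c * \<sigma>) * emeasure cone_measure B))"
    unfolding Econe by (simp add: mult_ac)
  finally have h: "hausdorff_outer s (proj_perp x0 ` B) \<le> ennreal ((1 + 5 * \<delta>) powr real DIM('a)) * (ennreal (?c * \<sigma>) * emeasure cone_measure B)"
    by (rule cancel\<delta>)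
  have "hausdorff_outer s B \<le> ennreal ((1 / (1 - \<delta>)) powr s) * hausdorff_outer s (proj_perp x0 ` B)" by (rule fp2)
  also have "\<dots> \<le> ennreal ((1 / (1 - \<delta>)) powr s) * (ennreal ((1 + 5 * \<delta>) powr real DIM('a)) * (ennreal (?c * \<sigma>) * emeasure cone_measure B))"
    by (intro mult_left_mono h) auto
  also have "\<dots> = ennreal ((1 / (1 - \<delta>)) powr s * (1 + 5 * \<delta>) powr real DIM('a)) * (ennreal (?c * \<sigma>) * emeasure cone_measure B)"
    by (subst ennreal_mult) (auto simp: mult_ac)
  finally show "hausdorff_outer s B \<le> ennreal ((1 / (1 - \<delta>)) powr s * (1 + 5 * \<delta>) powr real DIM('a)) *
        (ennreal (?c * \<sigma>) * emeasure cone_measure B)" .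
qed

lemma sphere_local_comparison:
  fixes x0 :: "'a::euclidean_space"
  assumes dim: "DIM('a) \<ge> 2" and x0: "norm x0 = 1" and \<eta>: "0 < \<eta>"
  defines "d \<equiv> real DIM('a)"
  shows "\<exists>U. open U \<and> x0 \<in> U \<and> (\<forall>B\<in>sets borel. B \<subseteq> sphere 0 1 \<inter> U \<longrightarrow>
     emeasure (surface (sphere 0 1)) B \<le> ennreal (1 + \<eta>) * (ennreal (slice_const TYPE('a) * d) * emeasure cone_measure B) \<and>
     ennreal (slice_const TYPE('a) * d) * emeasure cone_measure B \<le> ennreal (1 + \<eta>) * emeasure (surface (sphere 0 1)) B)"
proof -
  let ?c = "slice_const TYPE('a)"
  have c0: "0 < ?c" by (rule slice_const_pos[OF dim])
  have d0: "0 < d" using dim by (simp add: d_def)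
  let ?\<sigma> = "\<lambda>\<delta>. \<Sum>i<DIM('a). (1 - \<delta> :: real) ^ i"
  \<comment> \<open>The geometric sum tends to the dimension, the ratio between the surface of the
    sphere and the volume of the ball.\<close>
  have l0: "(?\<sigma> \<longlongrightarrow> (\<Sum>i<DIM('a). (1 - 0) ^ i)) (at_right 0)" by (intro tendsto_intros)
  then have l\<sigma>: "(?\<sigma> \<longlongrightarrow> d) (at_right 0)" by (simp add: d_def)
  have l1: "((\<lambda>\<delta>. (1 / (1 - \<delta>)) powr (d - 1) * (1 + 5 * \<delta>) powr d * (?\<sigma> \<delta> / d))
      \<longlongrightarrow> (1 / (1 - 0)) powr (d - 1) * (1 + 5 * 0) powr d * (d / d)) (at_right 0)"
    using d0 by (intro tendsto_intros l\<sigma>) auto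
  have l2: "((\<lambda>\<delta>. d / ?\<sigma> \<delta> * (1 / (1 - 5 * \<delta>)) powr d) \<longlongrightarrow> d / d * (1 / (1 - 5 * 0)) powr d) (at_right 0)"
    using d0 by (intro tendsto_intros l\<sigma>) auto
  have "\<forall>\<^sub>F \<delta> in at_right 0. (1 / (1 - \<delta>)) powr (d - 1) * (1 + 5 * \<delta>) powr d * (?\<sigma> \<delta> / d) < 1 + \<eta>"
    using order_tendstoD(2)[OF l1, of "1 + \<eta>"] d0 \<eta> by simp
  moreover have "\<forall>\<^sub>F \<delta> in at_right 0. d / ?\<sigma> \<delta> * (1 / (1 - 5 * \<delta>)) powr d < 1 + \<eta>"
    using order_tendstoD(2)[OF l2, of "1 + \<eta>"] d0 \<eta> by simp
  moreover have "\<forall>\<^sub>F \<delta> in at_right (0::real). 0 < \<delta> \<and> \<delta> < 1/10" by (auto intro!: eventually_at_rightI[of 0 "1/10"])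
  ultimately have "\<forall>\<^sub>F \<delta> in at_right 0. (1 / (1 - \<delta>)) powr (d - 1) * (1 + 5 * \<delta>) powr d * (?\<sigma> \<delta> / d) < 1 + \<eta> \<and>
      d / ?\<sigma> \<delta> * (1 / (1 - 5 * \<delta>)) powr d < 1 + \<eta> \<and> 0 < \<delta> \<and> \<delta> < 1/10" by eventually_elim auto
  then obtain \<delta> where \<delta>: "(1 / (1 - \<delta>)) powr (d - 1) * (1 + 5 * \<delta>) powr d * (?\<sigma> \<delta> / d) < 1 + \<eta>"
      "d / ?\<sigma> \<delta> * (1 / (1 - 5 * \<delta>)) powr d < 1 + \<eta>" "0 < \<delta>" "\<delta> < 1/10"
    using eventually_happens[of _ "at_right (0::real)"] by (auto simp: trivial_limit_at_right_real)
  let ?s = "?\<sigma> \<delta>"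
  have s0: "0 < ?s" using \<delta> by (intro sum_pos) (auto simp: lessThan_empty_iff)
  show ?thesis
  proof (intro exI[of _ "ball x0 \<delta>"] conjI ballI impI)
    fix B :: "'a set" assume B [measurable]: "B \<in> sets borel" and Bs: "B \<subseteq> sphere 0 1 \<inter> ball x0 \<delta>"
    then have Bc: "B \<subseteq> sphere 0 1 \<inter> cball x0 \<delta>" by auto
    have HB: "emeasure (surface (sphere 0 1)) B = hausdorff_outer (d - 1) B"
      unfolding d_def using Bs by (subst emeasure_surface) (auto simp: Int_absorb1)
    note est = sphere_local_estimates[OF dim x0 \<delta>(3) less_imp_le[OF \<delta>(4)] B Bc, folded d_def]
    let ?X = "emeasure cone_measure B"
    have cs: "ennreal (?c * ?s) = ennreal (?s / d) * ennreal (?c * d)"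
      using c0 d0 s0 by (subst ennreal_mult[symmetric]) auto
    have cd: "ennreal (?c * d) = ennreal (d / ?s) * ennreal (?c * ?s)"
      using c0 d0 s0 by (subst ennreal_mult[symmetric]) auto
    have "emeasure (surface (sphere 0 1)) B \<le> ennreal ((1 / (1 - \<delta>)) powr (d - 1) * (1 + 5 * \<delta>) powr d) * (ennreal (?c * ?s) * ?X)"
      unfolding HB by (rule est(2))
    also have "\<dots> = ennreal ((1 / (1 - \<delta>)) powr (d - 1) * (1 + 5 * \<delta>) powr d * (?s / d)) * (ennreal (?c * d) * ?X)"
    proof -
      have "ennreal ((1 / (1 - \<delta>)) powr (d - 1) * (1 + 5 * \<delta>) powr d * (?s / d))
          = ennreal ((1 / (1 - \<delta>)) powr (d - 1) * (1 + 5 * \<delta>) powr d) * ennreal (?s / d)"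
        using s0 d0 by (intro ennreal_mult) auto
      then show ?thesis unfolding cs by (simp only: mult.assoc)
    qed
    also have "\<dots> \<le> ennreal (1 + \<eta>) * (ennreal (?c * d) * ?X)"
      using \<delta>(1) by (intro mult_right_mono ennreal_leI) auto
    finally show "emeasure (surface (sphere 0 1)) B \<le> ennreal (1 + \<eta>) * (ennreal (?c * d) * ?X)" .
    have "ennreal (?c * d) * ?X = ennreal (d / ?s) * (ennreal (?c * ?s) * ?X)" unfolding cd by (simp add: mult.assoc)
    also have "\<dots> \<le> ennreal (d / ?s) * (ennreal ((1 / (1 - 5 * \<delta>)) powr d) * emeasure (surface (sphere 0 1)) B)"
      unfolding HB by (intro mult_left_mono est(1)) auto
    also have "\<dots> = ennreal (d / ?s * (1 / (1 - 5 * \<delta>)) powr d) * emeasure (surface (sphere 0 1)) B"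
      using s0 d0 by (subst ennreal_mult) (auto simp: mult_ac)
    also have "\<dots> \<le> ennreal (1 + \<eta>) * emeasure (surface (sphere 0 1)) B"
      using \<delta>(2) by (intro mult_right_mono ennreal_leI) auto
    finally show "ennreal (?c * d) * ?X \<le> ennreal (1 + \<eta>) * emeasure (surface (sphere 0 1)) B" .
  qed (use \<delta> in auto)
qed

text \<open>The factor \<open>DIM('a)\<close> relates area to the volume of cones, and
  \<open>slice_const\<close> accounts for the normalization of Hausdorff measure. As for
  projections, local comparisons are glued and \<eta> tends to 0.\<close>

lemma surface_sphere_eq_cone_measure:
  assumes dim: "DIM('a::euclidean_space) \<ge> 2"
  shows "surface (sphere (0::'a) 1) = scale_measure (ennreal (slice_const TYPE('a) * real DIM('a))) cone_measure"
    (is "?M1 = ?M2")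
proof -
  have Sb: "sphere (0::'a) 1 \<in> sets borel" by simp
  have M2: "emeasure ?M2 B = ennreal (slice_const TYPE('a) * real DIM('a)) * emeasure cone_measure B" for B by simp
  have le: "emeasure ?M1 B \<le> emeasure ?M2 B \<and> emeasure ?M2 B \<le> emeasure ?M1 B" if B: "B \<in> sets borel" "B \<subseteq> sphere 0 1" for B
  proof
    show "emeasure ?M1 B \<le> emeasure ?M2 B"
    proof (rule ennreal_le_of_le_mult)
      fix \<eta> :: real assume \<eta>: "0 < \<eta>"
      have "emeasure ?M1 B \<le> emeasure (scale_measure (ennreal (1 + \<eta>)) ?M2) B"
      proof (rule emeasure_le_of_locally_le[OF _ _ _ B])
        fix x :: 'a assume "x \<in> sphere 0 1"
        then show "\<exists>U. open U \<and> x \<in> U \<and> (\<forall>B\<in>sets borel. B \<subseteq> sphere 0 1 \<inter> U \<longrightarrow>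
            emeasure ?M1 B \<le> emeasure (scale_measure (ennreal (1 + \<eta>)) ?M2) B)"
          using sphere_local_comparison[OF dim _ \<eta>, of x] by (simp only: emeasure_scale_measure) auto
      qed auto
      then show "emeasure ?M1 B \<le> ennreal (1 + \<eta>) * emeasure ?M2 B" by (simp only: emeasure_scale_measure)
    qed
    show "emeasure ?M2 B \<le> emeasure ?M1 B"
    proof (rule ennreal_le_of_le_mult)
      fix \<eta> :: real assume \<eta>: "0 < \<eta>"
      have "emeasure ?M2 B \<le> emeasure (scale_measure (ennreal (1 + \<eta>)) ?M1) B"
      proof (rule emeasure_le_of_locally_le[OF _ _ _ B])
        fix x :: 'a assume "x \<in> sphere 0 1"
        then show "\<exists>U. open U \<and> x \<in> U \<and> (\<forall>B\<in>sets borel. B \<subseteq> sphere 0 1 \<inter> U \<longrightarrow>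
            emeasure ?M2 B \<le> emeasure (scale_measure (ennreal (1 + \<eta>)) ?M1) B)"
          using sphere_local_comparison[OF dim _ \<eta>, of x] by (simp only: emeasure_scale_measure) auto
      qed auto
      then show "emeasure ?M2 B \<le> ennreal (1 + \<eta>) * emeasure ?M1 B" by (simp only: emeasure_scale_measure)
    qed
  qed
  have M1S: "emeasure ?M1 B = emeasure ?M1 (B \<inter> sphere 0 1)" if "B \<in> sets borel" for B
    using that by (auto simp: emeasure_surface intro!: arg_cong[where f="hausdorff_outer _"])
  have M2S: "emeasure ?M2 B = emeasure ?M2 (B \<inter> sphere 0 1)" if B [measurable]: "B \<in> sets borel" for B
  proof -
    have [measurable]: "B \<inter> sphere 0 1 \<in> sets borel" using B by simp
    have "emeasure lborel {z. norm z \<le> 1 \<and> sgn z \<in> B} = emeasure lborel {z. norm z \<le> 1 \<and> sgn z \<in> B \<inter> sphere 0 1}"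
    \<comment> \<open>The two sets differ at most in the origin, whose \<open>sgn\<close> is
      0.\<close>
    proof (rule emeasure_eq_AE)
      show "AE z in lborel. z \<in> {z. norm z \<le> 1 \<and> sgn z \<in> B} \<longleftrightarrow> z \<in> {z. norm z \<le> 1 \<and> sgn z \<in> B \<inter> sphere 0 1}"
        using AE_lborel_singleton[of "0::'a"] by eventually_elim (auto simp: norm_sgn)
    qed measurable
    then show ?thesis using B by (simp add: emeasure_cone_measure)
  qed
  show ?thesis
  proof (rule measure_eqI)
    fix B assume "B \<in> sets ?M1"
    then have B: "B \<in> sets borel" by simp
    have "emeasure ?M1 (B \<inter> sphere 0 1) = emeasure ?M2 (B \<inter> sphere 0 1)"
      using le[of "B \<inter> sphere 0 1"] B Sb by (intro antisym) auto
    then show "emeasure ?M1 B = emeasure ?M2 B" using M1S[OF B] M2S[OF B] by (simp only:)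
  qed simp
qed

text \<open>Supplies the factor \<open>1 / d\<close> that compensates the factor \<open>d\<close> of
  \<open>surface_sphere_eq_cone_measure\<close> in polar coordinates.\<close>

lemma nn_integral_inverse_power_tail:
  assumes a: "0 < a" and d: "0 < d"
  shows "(\<integral>\<^sup>+s. indicator {a..} s * ennreal (1 / s ^ Suc d) \<partial>lborel) = ennreal (1 / (real d * a ^ d))"
proof -
  let ?F = "\<lambda>s::real. - (1 / (real d * s ^ d))"
  have "(\<integral>\<^sup>+s. ennreal (1 / s ^ Suc d) * indicator {a..} s \<partial>lborel) = 0 - ?F a"
  proof (rule nn_integral_FTC_atLeast)
    fix s assume s: "a \<le> s"
    then have "0 < s" using a by simp
    obtain m where m: "d = Suc m" using d by (cases d) auto
    have "(?F has_real_derivative (real d * (real d * s ^ (d - 1))) / (real d * s ^ d)\<^sup>2) (at s)"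
      using d \<open>0 < s\<close> by (auto intro!: derivative_eq_intros simp: power2_eq_square)
    also have "(real d * (real d * s ^ (d - 1))) / (real d * s ^ d)\<^sup>2 = 1 / s ^ Suc d"
    proof -
      have "(real d * (real d * s ^ (d - 1))) * s ^ Suc d = (real d * s ^ d)\<^sup>2"
        by (simp add: m power2_eq_square)
      then show ?thesis using d \<open>0 < s\<close> by (simp add: divide_eq_eq eq_divide_eq)
    qed
    finally show "(?F has_real_derivative 1 / s ^ Suc d) (at s)" .
    show "0 \<le> 1 / s ^ Suc d" using \<open>0 < s\<close> by simp
  next
    have "filterlim (\<lambda>s::real. real d * s ^ d) at_top at_top"
      using d by (intro filterlim_tendsto_pos_mult_at_top[OF tendsto_const] filterlim_pow_at_top filterlim_ident) auto
    then have "((\<lambda>s::real. 1 / (real d * s ^ d)) \<longlongrightarrow> 0) at_top"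
      by (intro tendsto_divide_0[OF tendsto_const] filterlim_at_top_imp_at_infinity)
    then show "(?F \<longlongrightarrow> 0) at_top" using tendsto_minus by fastforce
  qed simp
  then show ?thesis by (simp add: mult.commute)
qed

text \<open>Averaging \<open>f\<close> over all dilations of the unit ball turns the cone measure into polar coordinates.\<close>

lemma polar_coordinates:
  fixes f :: "'a::euclidean_space \<Rightarrow> ennreal"
  assumes dim: "DIM('a) \<ge> 2" and f [measurable]: "f \<in> borel_measurable borel"
  shows "(\<integral>\<^sup>+u. \<integral>\<^sup>+t. indicator {0<..} t * ennreal (t ^ (DIM('a) - 1)) * f (t *\<^sub>R u) \<partial>lborel \<partial>surface (sphere 0 1))
    = ennreal (slice_const TYPE('a)) * (\<integral>\<^sup>+x. f x \<partial>lborel)"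
proof -
  let ?d = "DIM('a)"
  define G where "G u = (\<integral>\<^sup>+t. indicator {0<..} t * ennreal (t ^ (?d - 1)) * f (t *\<^sub>R u) \<partial>lborel)" for u
  have G [measurable]: "G \<in> borel_measurable borel" unfolding G_def by measurable
  have dd: "?d = Suc (?d - 1)" using dim by simp
  \<comment> \<open>The substitution \<open>t = norm x * s\<close> replaces the direction
    \<open>sgn x\<close> by the point \<open>x\<close>.\<close>
  have Gsgn: "G (sgn x) = (\<integral>\<^sup>+s. indicator {0<..} s * ennreal (s ^ (?d - 1) * norm x ^ ?d) * f (s *\<^sub>R x) \<partial>lborel)"
    if x: "x \<noteq> 0" for x
  proof -
    have "G (sgn x) = ennreal \<bar>norm x\<bar> * (\<integral>\<^sup>+s. indicator {0<..} (0 + norm x * s) * ennreal ((0 + norm x * s) ^ (?d - 1))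
        * f ((0 + norm x * s) *\<^sub>R sgn x) \<partial>lborel)"
      unfolding G_def using x by (intro nn_integral_real_affine) auto
    also have "\<dots> = (\<integral>\<^sup>+s. ennreal (norm x) * (indicator {0<..} (norm x * s) * ennreal ((norm x * s) ^ (?d - 1))
        * f ((norm x * s) *\<^sub>R sgn x)) \<partial>lborel)"
      by (subst nn_integral_cmult) auto
    also have "\<dots> = (\<integral>\<^sup>+s. indicator {0<..} s * ennreal (s ^ (?d - 1) * norm x ^ ?d) * f (s *\<^sub>R x) \<partial>lborel)"
    proof (rule nn_integral_cong)
      fix s :: real
      have sx: "(norm x * s) *\<^sub>R sgn x = s *\<^sub>R x" by (metis mult.commute norm_scaleR_sgn scaleR_scaleR)
      show "ennreal (norm x) * (indicator {0<..} (norm x * s) * ennreal ((norm x * s) ^ (?d - 1)) * f ((norm x * s) *\<^sub>R sgn x))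
          = indicator {0<..} s * ennreal (s ^ (?d - 1) * norm x ^ ?d) * f (s *\<^sub>R x)"
      proof (cases "0 < s")
        case True
        have "ennreal (norm x) * ennreal ((norm x * s) ^ (?d - 1)) = ennreal (s ^ (?d - 1) * norm x ^ ?d)"
          using True dim by (subst ennreal_mult[symmetric]) (auto simp: power_mult_distrib power_eq_if[of "norm x" "DIM('a)"])
        then show ?thesis using True x by (simp add: sx zero_less_mult_iff flip: mult.assoc)
      qed (use x in \<open>simp add: zero_less_mult_iff\<close>)
    qed
    finally show ?thesis .
  qed
  have "(\<integral>\<^sup>+u. G u \<partial>surface (sphere 0 1))
      = ennreal (slice_const TYPE('a) * ?d) * (\<integral>\<^sup>+x. indicator (cball 0 1) x * G (sgn x) \<partial>lborel)"
    unfolding surface_sphere_eq_cone_measure[OF dim]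
    by (simp add: nn_integral_scale_measure nn_integral_cone_measure)
  also have "(\<integral>\<^sup>+x. indicator (cball 0 1) x * G (sgn x) \<partial>lborel)
      = (\<integral>\<^sup>+x. \<integral>\<^sup>+s. indicator (cball 0 1) x * (indicator {0<..} s * ennreal (s ^ (?d - 1) * norm x ^ ?d) * f (s *\<^sub>R x)) \<partial>lborel \<partial>lborel)"
  proof (rule nn_integral_cong_AE)
    show "AE x in lborel. indicator (cball 0 1) x * G (sgn x)
        = (\<integral>\<^sup>+s. indicator (cball 0 1) x * (indicator {0<..} s * ennreal (s ^ (?d - 1) * norm x ^ ?d) * f (s *\<^sub>R x)) \<partial>lborel)"
      using AE_lborel_singleton[of "0::'a"] by eventually_elim (simp add: Gsgn nn_integral_cmult)
  qed
  also have "\<dots> = (\<integral>\<^sup>+s. \<integral>\<^sup>+x. indicator (cball 0 1) x * (indicator {0<..} s * ennreal (s ^ (?d - 1) * norm x ^ ?d) * f (s *\<^sub>R x)) \<partial>lborel \<partial>lborel)"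
    by (rule lborel_pair.Fubini'[symmetric]) measurable
  \<comment> \<open>For fixed \<open>s\<close> the substitution \<open>z = s * x\<close> turns the
    unit ball into the ball of radius \<open>s\<close>.\<close>
  also have "\<dots> = (\<integral>\<^sup>+s. \<integral>\<^sup>+z. indicator {0<..} s * indicator (cball 0 s) z * ennreal (norm z ^ ?d / s ^ Suc ?d) * f z \<partial>lborel \<partial>lborel)"
  proof (rule nn_integral_cong)
    fix s :: real
    show "(\<integral>\<^sup>+x. indicator (cball 0 1) x * (indicator {0<..} s * ennreal (s ^ (?d - 1) * norm x ^ ?d) * f (s *\<^sub>R x)) \<partial>lborel)
       = (\<integral>\<^sup>+z. indicator {0<..} s * indicator (cball 0 s) z * ennreal (norm z ^ ?d / s ^ Suc ?d) * f z \<partial>lborel)"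
    proof (cases "0 < s")
      case s: True
      have "(\<integral>\<^sup>+z. indicator {0<..} s * indicator (cball 0 s) z * ennreal (norm z ^ ?d / s ^ Suc ?d) * f z \<partial>lborel)
          = ennreal (s ^ ?d) * (\<integral>\<^sup>+x. indicator {0<..} s * indicator (cball 0 s) (s *\<^sub>R x) * ennreal (norm (s *\<^sub>R x) ^ ?d / s ^ Suc ?d) * f (s *\<^sub>R x) \<partial>lborel)"
        using s by (intro nn_integral_lborel_scale) auto
      also have "\<dots> = (\<integral>\<^sup>+x. ennreal (s ^ ?d) * (indicator {0<..} s * indicator (cball 0 s) (s *\<^sub>R x) * ennreal (norm (s *\<^sub>R x) ^ ?d / s ^ Suc ?d) * f (s *\<^sub>R x)) \<partial>lborel)"
        by (subst nn_integral_cmult) auto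
      also have "\<dots> = (\<integral>\<^sup>+x. indicator (cball 0 1) x * (indicator {0<..} s * ennreal (s ^ (?d - 1) * norm x ^ ?d) * f (s *\<^sub>R x)) \<partial>lborel)"
      proof (rule nn_integral_cong)
        fix x :: 'a
        have "s ^ ?d * (norm (s *\<^sub>R x) ^ ?d / s ^ Suc ?d) = s ^ (?d - 1) * norm x ^ ?d"
          using s dim by (simp add: power_mult_distrib power_eq_if[of s "DIM('a)"])
        then have "ennreal (s ^ ?d) * ennreal (norm (s *\<^sub>R x) ^ ?d / s ^ Suc ?d) = ennreal (s ^ (?d - 1) * norm x ^ ?d)"
          using s by (subst ennreal_mult[symmetric]) auto
        moreover have "indicator (cball 0 s) (s *\<^sub>R x) = (indicator (cball 0 1) x :: ennreal)"
          using s by (simp add: indicator_def mult_le_cancel_left1)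
        moreover have "a * (i * j * b * g) = j * (i * (a * b) * g)" for a i j b g :: ennreal by (simp only: mult_ac)
        ultimately show "ennreal (s ^ ?d) * (indicator {0<..} s * indicator (cball 0 s) (s *\<^sub>R x) * ennreal (norm (s *\<^sub>R x) ^ ?d / s ^ Suc ?d) * f (s *\<^sub>R x))
            = indicator (cball 0 1) x * (indicator {0<..} s * ennreal (s ^ (?d - 1) * norm x ^ ?d) * f (s *\<^sub>R x))"
          by (simp only:)
      qed
      finally show ?thesis by simp
    qed simp
  qed
  also have "\<dots> = (\<integral>\<^sup>+z. \<integral>\<^sup>+s. indicator {0<..} s * indicator (cball 0 s) z * ennreal (norm z ^ ?d / s ^ Suc ?d) * f z \<partial>lborel \<partial>lborel)"
  proof (rule lborel_pair.Fubini')
    have "(\<lambda>(z, s). indicator {0<..} s * indicator {p. norm (fst p) \<le> snd p} (z, s) * ennreal (norm z ^ ?d / s ^ Suc ?d) * f z)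
        \<in> borel_measurable (lborel \<Otimes>\<^sub>M lborel)" by measurable
    moreover have "(\<lambda>(z, s). indicator {0<..} s * indicator {p. norm (fst p) \<le> snd p} (z, s) * ennreal (norm z ^ ?d / s ^ Suc ?d) * f z)
       = (\<lambda>(z, s). indicator {0<..} s * indicator (cball 0 s) z * ennreal (norm z ^ ?d / s ^ Suc ?d) * f z)"
      by (auto simp: fun_eq_iff indicator_def)
    ultimately show "(\<lambda>(z, s). indicator {0<..} s * indicator (cball 0 s) z * ennreal (norm z ^ ?d / s ^ Suc ?d) * f z)
        \<in> borel_measurable (lborel \<Otimes>\<^sub>M lborel)" by (simp only:)
  qed
  \<comment> \<open>For fixed \<open>z\<close> the dilations with \<open>s \<ge> norm z\<close>
    remain, and the weight \<open>norm z ^ d / s ^ (d + 1)\<close> integrates to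
    \<open>1 / d\<close>.\<close>
  also have "\<dots> = (\<integral>\<^sup>+z. ennreal (1 / ?d) * f z \<partial>lborel)"
  proof (rule nn_integral_cong_AE)
    show "AE z in lborel. (\<integral>\<^sup>+s. indicator {0<..} s * indicator (cball 0 s) z * ennreal (norm z ^ ?d / s ^ Suc ?d) * f z \<partial>lborel)
        = ennreal (1 / ?d) * f z"
      using AE_lborel_singleton[of "0::'a"]
    proof eventually_elim
      case (elim z)
      have "(\<integral>\<^sup>+s. indicator {0<..} s * indicator (cball 0 s) z * ennreal (norm z ^ ?d / s ^ Suc ?d) * f z \<partial>lborel)
          = (\<integral>\<^sup>+s. (ennreal (norm z ^ ?d) * f z) * (indicator {norm z..} s * ennreal (1 / s ^ Suc ?d)) \<partial>lborel)"
      proof (rule nn_integral_cong)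
        fix s :: real
        show "indicator {0<..} s * indicator (cball 0 s) z * ennreal (norm z ^ ?d / s ^ Suc ?d) * f z
          = (ennreal (norm z ^ ?d) * f z) * (indicator {norm z..} s * ennreal (1 / s ^ Suc ?d))"
        proof (cases "norm z \<le> s")
          case True
          then have s: "0 < s" using elim by (metis less_le_trans zero_less_norm_iff)
          have "ennreal (norm z ^ ?d / s ^ Suc ?d) = ennreal (norm z ^ ?d) * ennreal (1 / s ^ Suc ?d)"
            using s by (subst ennreal_mult[symmetric]) auto
          then show ?thesis using True s by (simp add: mult_ac)
        qed simp
      qed
      also have "\<dots> = (ennreal (norm z ^ ?d) * f z) * ennreal (1 / (real ?d * norm z ^ ?d))"
        using elim nn_integral_inverse_power_tail[of "norm z" ?d] by (subst nn_integral_cmult) auto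
      also have "\<dots> = (ennreal (norm z ^ ?d) * ennreal (1 / (real ?d * norm z ^ ?d))) * f z" by (simp add: mult_ac)
      also have "ennreal (norm z ^ ?d) * ennreal (1 / (real ?d * norm z ^ ?d)) = ennreal (1 / ?d)"
        using elim by (subst ennreal_mult[symmetric]) auto
      finally show ?case .
    qed
  qed
  also have "\<dots> = ennreal (1 / ?d) * (\<integral>\<^sup>+z. f z \<partial>lborel)" by (rule nn_integral_cmult) simp
  also have "ennreal (slice_const TYPE('a) * ?d) * (ennreal (1 / ?d) * (\<integral>\<^sup>+z. f z \<partial>lborel))
      = ennreal (slice_const TYPE('a)) * (\<integral>\<^sup>+z. f z \<partial>lborel)"
    using slice_const_pos[OF dim] dim by (subst mult.assoc[symmetric], subst ennreal_mult[symmetric]) auto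
  finally show ?thesis unfolding G_def .
qed

section \<open>Divergence along a direction\<close>

lemma integral_slices:
  fixes e :: "'a::euclidean_space" and F :: "'a \<Rightarrow> real"
  assumes e: "norm e = 1" and dim: "DIM('a) \<ge> 2" and F: "integrable lborel F"
  shows "AE y in surface (hplane e). integrable lborel (\<lambda>t. F (y + t *\<^sub>R e))"
    and "(\<integral>y. \<integral>t. F (y + t *\<^sub>R e) \<partial>lborel \<partial>surface (hplane e)) = slice_const TYPE('a) * (\<integral>x. F x \<partial>lborel)"
proof -
  have [measurable]: "F \<in> borel_measurable borel" using F by simp
  interpret S: sigma_finite_measure "surface (hplane e)" by (rule sigma_finite_surface_hplane[OF e dim])
  interpret pair_sigma_finite "surface (hplane e)" lborel ..
  have c0: "0 \<le> slice_const TYPE('a)" using slice_const_pos[OF dim] by simp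
  have "integrable (slices e) F"
    unfolding slices_eq_density[OF e dim] using F c0 by (subst integrable_density) auto
  then have int: "integrable (surface (hplane e) \<Otimes>\<^sub>M lborel) (\<lambda>(y, t). F (y + t *\<^sub>R e))"
    unfolding slices_def by (subst (asm) integrable_distr_eq) (auto simp: split_beta')
  show "AE y in surface (hplane e). integrable lborel (\<lambda>t. F (y + t *\<^sub>R e))"
    using AE_integrable_fst[OF int] .
  have "(\<integral>y. \<integral>t. F (y + t *\<^sub>R e) \<partial>lborel \<partial>surface (hplane e))
      = (\<integral>p. F (fst p + snd p *\<^sub>R e) \<partial>(surface (hplane e) \<Otimes>\<^sub>M lborel))"
    using integral_fst'[OF int] by (simp add: split_beta')
  also have "\<dots> = (\<integral>x. F x \<partial>slices e)"
    unfolding slices_def by (subst integral_distr) (auto simp: split_beta')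
  also have "\<dots> = slice_const TYPE('a) * (\<integral>x. F x \<partial>lborel)"
    unfolding slices_eq_density[OF e dim] using c0 by (subst integral_density) auto
  finally show "(\<integral>y. \<integral>t. F (y + t *\<^sub>R e) \<partial>lborel \<partial>surface (hplane e)) = slice_const TYPE('a) * (\<integral>x. F x \<partial>lborel)" .
qed

context smooth_body
begin

lemma projection_real:
  assumes e: "norm e = 1" and f [measurable]: "f \<in> borel_measurable borel"
  shows "(\<integral>x. max 0 (n x \<bullet> e) * f x \<partial>surface S) = (\<integral>y. indicator (shadow e) y * f (top_point e y) \<partial>surface (hplane e))"
    and "integrable (surface S) (\<lambda>x. max 0 (n x \<bullet> e) * f x)
      \<longleftrightarrow> integrable (surface (hplane e)) (\<lambda>y. indicator (shadow e) y * (f (top_point e y) :: real))"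
proof -
  note [measurable] = top_point_measurable[OF e]
  \<comment> \<open>\<open>max 0\<close> makes explicit the truncation done by
    \<open>ennreal\<close>, since \<open>integral_density\<close> works with a nonnegative real
    density.\<close>
  have D: "density (surface S) (\<lambda>x. ennreal (n x \<bullet> e)) = density (surface S) (\<lambda>x. ennreal (max 0 (n x \<bullet> e)))"
    by (simp add: max_def ennreal_neg if_distrib[of ennreal] cong: if_cong)
       (intro arg_cong[where f="density _"] ext, simp add: ennreal_neg)
  have I: "(indicator (shadow e) :: 'a \<Rightarrow> ennreal) = (\<lambda>x. ennreal (indicator (shadow e) x))"
    by (auto simp: fun_eq_iff indicator_def)
  note eq = projection_measure_eq[OF e, unfolded D I]
  have "(\<integral>x. max 0 (n x \<bullet> e) * f x \<partial>surface S) = (\<integral>x. f x \<partial>density (surface S) (\<lambda>x. ennreal (max 0 (n x \<bullet> e))))"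
    by (subst integral_density) auto
  also have "\<dots> = (\<integral>y. f (top_point e y) \<partial>density (surface (hplane e)) (\<lambda>x. ennreal (indicator (shadow e) x)))"
    unfolding eq by (subst integral_distr) auto
  also have "\<dots> = (\<integral>y. indicator (shadow e) y * f (top_point e y) \<partial>surface (hplane e))"
    by (subst integral_density) auto
  finally show "(\<integral>x. max 0 (n x \<bullet> e) * f x \<partial>surface S) = (\<integral>y. indicator (shadow e) y * f (top_point e y) \<partial>surface (hplane e))" .
  have "integrable (surface S) (\<lambda>x. max 0 (n x \<bullet> e) * f x) \<longleftrightarrow> integrable (density (surface S) (\<lambda>x. ennreal (max 0 (n x \<bullet> e)))) f"
    by (subst integrable_density) auto
  also have "\<dots> \<longleftrightarrow> integrable (density (surface (hplane e)) (\<lambda>x. ennreal (indicator (shadow e) x))) (\<lambda>y. f (top_point e y))"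
    unfolding eq by (subst integrable_distr_eq) auto
  also have "\<dots> \<longleftrightarrow> integrable (surface (hplane e)) (\<lambda>y. indicator (shadow e) y * f (top_point e y))"
    by (subst integrable_density) auto
  finally show "integrable (surface S) (\<lambda>x. max 0 (n x \<bullet> e) * f x)
      \<longleftrightarrow> integrable (surface (hplane e)) (\<lambda>y. indicator (shadow e) y * f (top_point e y))" .
qed

lemma shadow_uminus: "shadow (- e) = shadow e"
proof -
  have "(\<exists>t. y + t *\<^sub>R - e \<in> interior K) \<longleftrightarrow> (\<exists>t. y + t *\<^sub>R e \<in> interior K)" for y
    by (metis minus_minus scaleR_minus_left scaleR_minus_right)
  then show ?thesis by (simp add: shadow_def)
qed

text \<open>The lower end of the slice is the upper end in direction \<open>- e\<close>; convexity
  fills the interval between them.\<close>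

lemma line_slice_shadow:
  assumes e: "norm e = 1" and y: "y \<in> shadow e"
  shows "{t. y + t *\<^sub>R e \<in> K} = {- height (- e) y .. height e y}" "- height (- e) y \<le> height e y"
    and "top_point (- e) y = y + (- height (- e) y) *\<^sub>R e"
proof -
  have e': "norm (- e) = 1" using e by simp
  obtain t0 where t0: "y + t0 *\<^sub>R e \<in> K" using y interior_subset by (auto simp: shadow_def)
  have t0': "y + (- t0) *\<^sub>R - e \<in> K" using t0 by simp
  have up: "t \<le> height e y" "- t \<le> height (- e) y" if "y + t *\<^sub>R e \<in> K" for t
    using height_max(2)[OF e that] height_max(2)[OF e', of y "- t"] that by simp_all
  then show le: "- height (- e) y \<le> height e y" using t0 by fastforce
  show bot: "top_point (- e) y = y + (- height (- e) y) *\<^sub>R e" by (simp add: top_point_def)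
  have "y + t *\<^sub>R e \<in> K" if t: "t \<in> {- height (- e) y .. height e y}" for t
  proof (cases "- height (- e) y = height e y")
    case True
    then have "t = height e y" using t by simp
    then show ?thesis using height_max(1)[OF e t0] by (simp add: top_point_def)
  next
    case False
    define l where "l = height e y + height (- e) y"
    have l: "0 < l" using False le by (simp add: l_def)
    define v where "v = (t + height (- e) y) / l"
    have v: "0 \<le> v" "v \<le> 1" using t l by (auto simp: v_def l_def)
    have "(1 - v) *\<^sub>R top_point (- e) y + v *\<^sub>R top_point e y \<in> K"
      using v height_max(1)[OF e t0] height_max(1)[OF e' t0'] convex_K by (intro convexD) auto
    also have "(1 - v) *\<^sub>R top_point (- e) y + v *\<^sub>R top_point e y = y + (v * l - height (- e) y) *\<^sub>R e"
      unfolding bot by (simp add: top_point_def l_def algebra_simps)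
    also have "v * l - height (- e) y = t" using l by (simp add: v_def)
    finally show ?thesis .
  qed
  then show "{t. y + t *\<^sub>R e \<in> K} = {- height (- e) y .. height e y}" using up by force
qed

text \<open>The divergence theorem for a field with the single component \<open>f\<close> in
  direction \<open>e\<close>. On each line the fundamental theorem turns \<open>g\<close> into the
  difference of \<open>f\<close> at the two ends of the chord, and \<open>projection_real\<close>
  for \<open>e\<close> and \<open>- e\<close> turns these values into boundary integrals. The
  exceptional point \<open>p\<close> leaves room for the pole of the kernel.\<close>

lemma divergence_direction:
  assumes e: "norm e = 1"
    and f [measurable]: "f \<in> borel_measurable borel" and g [measurable]: "g \<in> borel_measurable borel"
    and deriv: "\<And>x. x \<noteq> p \<Longrightarrow> ((\<lambda>t. f (x + t *\<^sub>R e)) has_real_derivative g x) (at 0)"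
    and intg: "integrable lborel (\<lambda>x. indicator K x * g x)"
    and intf: "integrable (surface S) f"
  shows "integrable (surface S) (\<lambda>x. f x * (n x \<bullet> e))"
    and "(\<integral>x. f x * (n x \<bullet> e) \<partial>surface S) = slice_const TYPE('a) * (\<integral>x. indicator K x * g x \<partial>lborel)"
proof -
  have e': "norm (- e) = 1" using e by simp
  have ee: "e \<bullet> e = 1" using e by (simp add: norm_eq_1)
  have ne: "\<bar>n x \<bullet> e\<bar> \<le> 1" for x
    using Cauchy_Schwarz_ineq2[of "n x" e] norm_normal_le[of x] e by simp
  have ip: "integrable (surface S) (\<lambda>x. max 0 (n x \<bullet> v) * f x)" if v: "v = e \<or> v = - e" for v
  proof (rule Bochner_Integration.integrable_bound[OF intf])
    have "max 0 (n x \<bullet> v) * \<bar>f x\<bar> \<le> 1 * \<bar>f x\<bar>" for x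
      using ne[of x] v by (intro mult_right_mono) (auto simp: abs_le_iff)
    then show "AE x in surface S. norm (max 0 (n x \<bullet> v) * f x) \<le> norm (f x)"
      by (intro AE_I2) (simp add: abs_mult)
  qed measurable
  \<comment> \<open>The positive part of \<open>n x \<bullet> e\<close> belongs to the upper ends of
    the chords, the negative part to the lower ends.\<close>
  have spl: "f x * (n x \<bullet> e) = max 0 (n x \<bullet> e) * f x - max 0 (n x \<bullet> (- e)) * f x" for x
    by (auto simp: max_def)
  show "integrable (surface S) (\<lambda>x. f x * (n x \<bullet> e))"
    unfolding spl using ip[of e] ip[of "- e"] by (intro Bochner_Integration.integrable_diff) auto
  have hp: "hplane (- e) = hplane e" by simp
  have "(\<integral>x. f x * (n x \<bullet> e) \<partial>surface S)
      = (\<integral>y. indicator (shadow e) y * f (top_point e y) \<partial>surface (hplane e))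
       - (\<integral>y. indicator (shadow e) y * f (top_point (- e) y) \<partial>surface (hplane e))"
    unfolding spl using ip[of e] ip[of "- e"] projection_real(1)[OF e f] projection_real(1)[OF e' f]
    by (subst Bochner_Integration.integral_diff) (auto simp: shadow_uminus hp)
  also have "\<dots> = (\<integral>y. indicator (shadow e) y * f (top_point e y) - indicator (shadow e) y * f (top_point (- e) y) \<partial>surface (hplane e))"
    using ip[of e] ip[of "- e"] projection_real(2)[OF e f] projection_real(2)[OF e' f]
    by (subst Bochner_Integration.integral_diff) (auto simp: shadow_uminus hp)
  also have "\<dots> = (\<integral>y. \<integral>t. indicator K (y + t *\<^sub>R e) * g (y + t *\<^sub>R e) \<partial>lborel \<partial>surface (hplane e))"
  proof (rule integral_cong_AE)
    note [measurable] = top_point_measurable[OF e] top_point_measurable[OF e']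
    show "(\<lambda>y. indicator (shadow e) y * f (top_point e y) - indicator (shadow e) y * f (top_point (- e) y)) \<in> borel_measurable (surface (hplane e))"
      by measurable
    show "(\<lambda>y. \<integral>t. indicator K (y + t *\<^sub>R e) * g (y + t *\<^sub>R e) \<partial>lborel) \<in> borel_measurable (surface (hplane e))"
      by measurable
    show "AE y in surface (hplane e). indicator (shadow e) y * f (top_point e y) - indicator (shadow e) y * f (top_point (- e) y)
        = (\<integral>t. indicator K (y + t *\<^sub>R e) * g (y + t *\<^sub>R e) \<partial>lborel)"
      using AE_surface[OF hplane_borel] AE_shadow[OF e] AE_surface_neq[where T="hplane e" and p="proj_perp e p", OF hplane_borel]
        integral_slices(1)[OF e dim intg]
    proof eventually_elim
      case (elim y)
      show ?case
      proof (cases "y \<in> shadow e")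
        case False
        then have "y + t *\<^sub>R e \<notin> K" for t using elim by auto
        then show ?thesis using False by simp
      next
        case True
        let ?a = "- height (- e) y" and ?b = "height e y"
        note sl = line_slice_shadow[OF e True]
        \<comment> \<open>Only one line of this direction passes through \<open>p\<close>, and a
          single point of the hyperplane is null.\<close>
        have notp: "y + t *\<^sub>R e \<noteq> p" for t
        proof
          assume "y + t *\<^sub>R e = p"
          then have "proj_perp e p = y" using elim by (auto simp: proj_perp_def inner_add_left ee)
          then show False using elim by simp
        qed
        have ind: "indicator K (y + t *\<^sub>R e) = (indicator {?a..?b} t :: real)" for t
          using sl(1) by (auto simp: indicator_def)
        have si: "set_integrable lborel {?a..?b} (\<lambda>t. g (y + t *\<^sub>R e))"
          using elim by (simp add: set_integrable_def ind)
        have "((\<lambda>t. g (y + t *\<^sub>R e)) has_integral f (y + ?b *\<^sub>R e) - f (y + ?a *\<^sub>R e)) {?a..?b}"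
        proof (rule fundamental_theorem_of_calculus[OF sl(2)])
          fix t
          have "((\<lambda>r. f (y + t *\<^sub>R e + r *\<^sub>R e)) has_real_derivative g (y + t *\<^sub>R e)) (at 0)" by (rule deriv[OF notp])
          then have "((\<lambda>r. f (y + (r + t) *\<^sub>R e)) has_real_derivative g (y + t *\<^sub>R e)) (at 0)"
            by (simp add: algebra_simps)
          then have "((\<lambda>r. f (y + r *\<^sub>R e)) has_real_derivative g (y + t *\<^sub>R e)) (at t)"
            using DERIV_shift[of "\<lambda>r. f (y + r *\<^sub>R e)" "g (y + t *\<^sub>R e)" 0 t] by simp
          then show "((\<lambda>r. f (y + r *\<^sub>R e)) has_vector_derivative g (y + t *\<^sub>R e)) (at t within {?a..?b})"
            by (simp add: has_real_derivative_iff_has_vector_derivative has_vector_derivative_at_within)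
        qed
        then have "(LINT t:{?a..?b}|lborel. g (y + t *\<^sub>R e)) = f (y + ?b *\<^sub>R e) - f (y + ?a *\<^sub>R e)"
          using set_borel_integral_eq_integral(2)[OF si] by (simp add: integral_unique)
        then show ?thesis using True sl(3)
          by (simp add: set_lebesgue_integral_def ind top_point_def)
      qed
    qed
  qed
  also have "\<dots> = slice_const TYPE('a) * (\<integral>x. indicator K x * g x \<partial>lborel)"
    by (rule integral_slices(2)[OF e dim intg])
  finally show "(\<integral>x. f x * (n x \<bullet> e) \<partial>surface S) = slice_const TYPE('a) * (\<integral>x. indicator K x * g x \<partial>lborel)" .
qed

end

section \<open>Integrability of the kernels\<close>

text \<open>The order of the singularity in the divergence of the field, cut off outside a ball; in
  polar coordinates it cancels the Jacobian \<open>t ^ (d - 1)\<close>.\<close>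

definition radial_weight :: "real \<Rightarrow> 'a::euclidean_space \<Rightarrow> ennreal" where
  "radial_weight R x = indicator (cball 0 R) x * ennreal (1 / norm x ^ (DIM('a) - 1))"

lemma radial_weight_measurable [measurable]: "radial_weight R \<in> borel_measurable borel"
  unfolding radial_weight_def by measurable

lemma radial_weight_integral_finite:
  assumes dim: "DIM('a::euclidean_space) \<ge> 2" and R: "0 \<le> R"
  shows "(\<integral>\<^sup>+x. radial_weight R (x::'a) \<partial>lborel) < \<infinity>"
proof -
  interpret B: smooth_body "cball 0 1" "\<lambda>x::'a. if x \<in> sphere 0 1 then x else 0"
    by (rule smooth_body_ball[OF dim])
  interpret B: finite_measure "surface (sphere (0::'a) 1)"
    using B.finite_surface by simp
  have "ennreal (slice_const TYPE('a)) * (\<integral>\<^sup>+x. radial_weight R (x::'a) \<partial>lborel)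
      = (\<integral>\<^sup>+u. \<integral>\<^sup>+t. indicator {0<..} t * ennreal (t ^ (DIM('a) - 1)) * radial_weight R (t *\<^sub>R u) \<partial>lborel \<partial>surface (sphere (0::'a) 1))"
    by (rule polar_coordinates[OF dim, symmetric]) measurable
  also have "\<dots> \<le> (\<integral>\<^sup>+u. ennreal R \<partial>surface (sphere (0::'a) 1))"
  proof (rule nn_integral_mono_AE)
    show "AE u in surface (sphere (0::'a) 1). (\<integral>\<^sup>+t. indicator {0<..} t * ennreal (t ^ (DIM('a) - 1)) * radial_weight R (t *\<^sub>R u) \<partial>lborel) \<le> ennreal R"
      using AE_surface[of "sphere (0::'a) 1", OF borel_closed[OF closed_sphere]]
    proof eventually_elim
      case (elim u)
      have "(\<integral>\<^sup>+t. indicator {0<..} t * ennreal (t ^ (DIM('a) - 1)) * radial_weight R (t *\<^sub>R u) \<partial>lborel) \<le> (\<integral>\<^sup>+t. indicator {0..R} t \<partial>lborel)"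
      proof (rule nn_integral_mono)
        fix t :: real
        show "indicator {0<..} t * ennreal (t ^ (DIM('a) - 1)) * radial_weight R (t *\<^sub>R u) \<le> indicator {0..R} t"
        proof (cases "0 < t \<and> t \<le> R")
          case True
          have "ennreal (t ^ (DIM('a) - 1)) * ennreal (1 / t ^ (DIM('a) - 1)) = 1"
            using True by (subst ennreal_mult[symmetric]) auto
          then show ?thesis using True elim by (simp add: radial_weight_def)
        qed (use elim in \<open>auto simp: radial_weight_def indicator_def\<close>)
      qed
      then show ?case using R by simp
    qed
  qed
  also have "\<dots> < \<infinity>"
  proof -
    have "emeasure (surface (sphere (0::'a) 1)) UNIV < top"
      unfolding less_top[symmetric] by (rule B.emeasure_finite[unfolded infinity_ennreal_def])
    then show ?thesis by (simp add: ennreal_mult_less_top)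
  qed
  finally show ?thesis using slice_const_pos[OF dim] by (auto simp: ennreal_mult_less_top)
qed

lemma nn_integral_lborel_translate:
  fixes f :: "'a::euclidean_space \<Rightarrow> ennreal"
  assumes [measurable]: "f \<in> borel_measurable borel"
  shows "(\<integral>\<^sup>+x. f (v + x) \<partial>lborel) = (\<integral>\<^sup>+x. f x \<partial>lborel)"
proof -
  have "(\<integral>\<^sup>+x. f x \<partial>lborel) = (\<integral>\<^sup>+x. f x \<partial>distr lborel borel ((+) v))" by (subst lborel_distr_plus) simp
  also have "\<dots> = (\<integral>\<^sup>+x. f (v + x) \<partial>lborel)" by (subst nn_integral_distr) auto
  finally show ?thesis by simp
qed

context smooth_body
begin

lemma K_bounded: obtains R where "0 < R" "\<And>x. x \<in> K \<Longrightarrow> norm x \<le> R"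
  using compact_imp_bounded[OF compact_K] by (auto simp: bounded_pos)

lemma volume_kernel_integrable:
  assumes p: "p \<in> K"
  shows "integrable lborel (\<lambda>x. indicator K x * (1 / norm (x - p) ^ (DIM('a) - 1)))"
proof (rule integrableI_bounded)
  obtain R where R: "0 < R" "\<And>x. x \<in> K \<Longrightarrow> norm x \<le> R" by (rule K_bounded) blast
  have "(\<integral>\<^sup>+x. ennreal (norm (indicator K x * (1 / norm (x - p) ^ (DIM('a) - 1)))) \<partial>lborel)
      \<le> (\<integral>\<^sup>+x. radial_weight (2 * R) (- p + x) \<partial>lborel)"
  proof (rule nn_integral_mono)
    fix x
    have "norm (x - p) \<le> 2 * R" if "x \<in> K" using norm_triangle_ineq4[of x p] R(2)[OF that] R(2)[OF p] by linarith
    then show "ennreal (norm (indicator K x * (1 / norm (x - p) ^ (DIM('a) - 1)))) \<le> radial_weight (2 * R) (- p + x)"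
      by (auto simp: radial_weight_def indicator_def)
  qed
  also have "\<dots> = (\<integral>\<^sup>+x. radial_weight (2 * R) (x::'a) \<partial>lborel)" by (rule nn_integral_lborel_translate) measurable
  also have "\<dots> < \<infinity>" using R by (intro radial_weight_integral_finite[OF dim]) auto
  finally show "(\<integral>\<^sup>+x. ennreal (norm (indicator K x * (1 / norm (x - p) ^ (DIM('a) - 1)))) \<partial>lborel) < \<infinity>" .
qed measurable

text \<open>Projecting along \<open>e\<close> leaves at most \<open>1 / norm z ^ (d - 2)\<close>,
  with \<open>z\<close> the difference within the hyperplane. The integral of the volume weight over
  the segment from \<open>z\<close> to \<open>z + norm z * e\<close> recovers this up to a power of
  2, so the bound becomes a volume integral that does not depend on \<open>p\<close>.\<close>

lemma surface_kernel_projection_bound: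
  assumes R: "0 < R" "\<And>x. x \<in> K \<Longrightarrow> norm x \<le> R" and p: "p \<in> K" and e: "norm e = 1"
  shows "(\<integral>\<^sup>+x. ennreal (n x \<bullet> e) * ennreal (1 / norm (x - p) ^ (DIM('a) - 2)) \<partial>surface S)
    \<le> ennreal (2 ^ (DIM('a) - 1)) * (ennreal (slice_const TYPE('a)) * (\<integral>\<^sup>+x. radial_weight (4 * R) (x::'a) \<partial>lborel))"
proof -
  note [measurable] = top_point_measurable[OF e]
  let ?d = "DIM('a)" and ?q = "proj_perp e p"
  have ee: "e \<bullet> e = 1" using e by (simp add: norm_eq_1)
  have "(\<integral>\<^sup>+x. ennreal (n x \<bullet> e) * ennreal (1 / norm (x - p) ^ (?d - 2)) \<partial>surface S)
     = (\<integral>\<^sup>+y. indicator (shadow e) y * ennreal (1 / norm (top_point e y - p) ^ (?d - 2)) \<partial>surface (hplane e))"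
    by (rule nn_integral_projection[OF e]) measurable
  also have "\<dots> \<le> (\<integral>\<^sup>+y. ennreal (2 ^ (?d - 1)) * (\<integral>\<^sup>+t. radial_weight (4 * R) (- ?q + y + t *\<^sub>R e) \<partial>lborel) \<partial>surface (hplane e))"
  proof (rule nn_integral_mono_AE)
    show "AE y in surface (hplane e). indicator (shadow e) y * ennreal (1 / norm (top_point e y - p) ^ (?d - 2))
        \<le> ennreal (2 ^ (?d - 1)) * (\<integral>\<^sup>+t. radial_weight (4 * R) (- ?q + y + t *\<^sub>R e) \<partial>lborel)"
      using AE_surface[OF hplane_borel] AE_surface_neq[where T="hplane e" and p="?q", OF hplane_borel]
    proof eventually_elim
      case (elim y)
      show ?case
      proof (cases "y \<in> shadow e")
        case True
        define z where "z = - ?q + y"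
        have z0: "z \<noteq> 0" using elim by (auto simp: z_def)
        have ze: "z \<bullet> e = 0" using elim proj_perp_inner[OF e, of p] by (simp add: z_def inner_diff_left)
        have "proj_perp e (top_point e y - p) = z"
          using top_point_shadow(3)[OF e True] by (simp add: proj_perp_diff z_def)
        then have le: "norm z \<le> norm (top_point e y - p)" using norm_proj_perp_le[OF e] by metis
        have "top_point e y \<in> K" using top_point_shadow(1)[OF e True] S_subset by auto
        then have "norm (top_point e y - p) \<le> 2 * R"
          using norm_triangle_ineq4[of "top_point e y" p] R(2)[of "top_point e y"] R(2)[OF p] by linarith
        then have zR: "norm z \<le> 2 * R" using le by linarith
        have "ennreal (1 / norm (top_point e y - p) ^ (?d - 2)) \<le> ennreal (1 / norm z ^ (?d - 2))"
          using le z0 less_le_trans[OF _ le] by (intro ennreal_leI divide_left_mono power_mono mult_pos_pos zero_less_power) auto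
        also have "1 / norm z ^ (?d - 2) = 2 ^ (?d - 1) * (norm z * (1 / (2 * norm z) ^ (?d - 1)))"
        proof -
          have "?d - 1 = Suc (?d - 2)" using dim by simp
          then show ?thesis using z0 by (simp add: power_mult_distrib)
        qed
        also have "ennreal \<dots> = ennreal (2 ^ (?d - 1)) * ennreal (norm z * (1 / (2 * norm z) ^ (?d - 1)))"
          by (intro ennreal_mult) auto
        also have "ennreal (norm z * (1 / (2 * norm z) ^ (?d - 1)))
            = (\<integral>\<^sup>+t. ennreal (1 / (2 * norm z) ^ (?d - 1)) * indicator {0..norm z} t \<partial>lborel)"
        proof -
          have "(\<integral>\<^sup>+t. ennreal (1 / (2 * norm z) ^ (?d - 1)) * indicator {0..norm z} t \<partial>lborel)
              = ennreal (1 / (2 * norm z) ^ (?d - 1)) * ennreal (norm z)"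
            by (subst nn_integral_cmult) auto
          also have "\<dots> = ennreal (1 / (2 * norm z) ^ (?d - 1) * norm z)"
            by (rule ennreal_mult[symmetric]) auto
          finally show ?thesis by (simp only: mult.commute)
        qed
        also have "\<dots> \<le> (\<integral>\<^sup>+t. radial_weight (4 * R) (z + t *\<^sub>R e) \<partial>lborel)"
        proof (rule nn_integral_mono)
          fix t :: real
          show "ennreal (1 / (2 * norm z) ^ (?d - 1)) * indicator {0..norm z} t \<le> radial_weight (4 * R) (z + t *\<^sub>R e)"
          proof (cases "t \<in> {0..norm z}")
            case t: True
            \<comment> \<open>Hence the factor \<open>2 ^ (d - 1)\<close> and, as
              \<open>norm z \<le> 2 * R\<close>, the radius \<open>4 * R\<close>.\<close>
            have n2: "norm (z + t *\<^sub>R e) \<le> 2 * norm z" using norm_triangle_ineq[of z "t *\<^sub>R e"] e t by simp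
            have "(z + t *\<^sub>R e) \<bullet> z = z \<bullet> z" using ze by (simp add: inner_add_left inner_commute[of e z])
            then have "z + t *\<^sub>R e \<noteq> 0" using z0 by auto
            then have "1 / (2 * norm z) ^ (?d - 1) \<le> 1 / norm (z + t *\<^sub>R e) ^ (?d - 1)"
              using n2 z0 by (intro divide_left_mono power_mono mult_pos_pos) auto
            then show ?thesis using t n2 zR by (simp add: radial_weight_def ennreal_leI)
          qed simp
        qed
        finally show ?thesis using True by (simp add: z_def mult_left_mono)
      qed simp
    qed
  qed
  also have "\<dots> = ennreal (2 ^ (?d - 1)) * (\<integral>\<^sup>+y. (\<integral>\<^sup>+t. radial_weight (4 * R) (- ?q + y + t *\<^sub>R e) \<partial>lborel) \<partial>surface (hplane e))"
    by (rule nn_integral_cmult) measurable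
  also have "(\<integral>\<^sup>+y. (\<integral>\<^sup>+t. radial_weight (4 * R) (- ?q + y + t *\<^sub>R e) \<partial>lborel) \<partial>surface (hplane e))
      = (\<integral>\<^sup>+y. (\<integral>\<^sup>+t. radial_weight (4 * R) (y + t *\<^sub>R e) \<partial>lborel) \<partial>surface (hplane e))"
    using proj_perp_inner[OF e, of p]
    by (intro nn_integral_surface_hplane_translate[OF _ _ dim, where f="\<lambda>y. \<integral>\<^sup>+t. radial_weight (4 * R) (y + t *\<^sub>R e) \<partial>lborel"])
       (simp, measurable)
  also have "\<dots> = ennreal (slice_const TYPE('a)) * (\<integral>\<^sup>+x. radial_weight (4 * R) (x::'a) \<partial>lborel)"
    by (rule nn_integral_slices_eq_lborel[OF e dim]) measurable
  finally show ?thesis .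
qed

text \<open>The \<open>l1\<close> norm of a unit normal is at least 1, so the projections along all
  \<open>b\<close> and \<open>- b\<close> of the basis together dominate the surface measure. The
  bound is uniform in \<open>p\<close>, as the double integral over the boundary will
  require.\<close>

lemma surface_kernel_bound:
  obtains C where "0 \<le> C"
    "\<And>p. p \<in> K \<Longrightarrow> (\<integral>\<^sup>+x. ennreal (1 / norm (x - p) ^ (DIM('a) - 2)) \<partial>surface S) \<le> ennreal C"
proof -
  obtain R where R: "0 < R" "\<And>x. x \<in> K \<Longrightarrow> norm x \<le> R" by (rule K_bounded) blast
  let ?A = "ennreal (2 ^ (DIM('a) - 1)) * (ennreal (slice_const TYPE('a)) * (\<integral>\<^sup>+x. radial_weight (4 * R) (x::'a) \<partial>lborel))"
  let ?B = "\<Sum>b\<in>(Basis::'a set). ?A + ?A"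
  have "?B < \<infinity>" using radial_weight_integral_finite[OF dim, of "4 * R"] R(1) by (simp add: ennreal_mult_less_top of_nat_less_top)
  then obtain C where C: "0 \<le> C" "?B = ennreal C" by (cases ?B) auto
  show ?thesis
  proof (rule that[OF C(1)])
    fix p assume p: "p \<in> K"
    define w where "w x = ennreal (1 / norm (x - p) ^ (DIM('a) - 2))" for x
    have [measurable]: "w \<in> borel_measurable borel" unfolding w_def by measurable
    have "(\<integral>\<^sup>+x. w x \<partial>surface S) \<le> (\<integral>\<^sup>+x. (\<Sum>b\<in>Basis. ennreal (n x \<bullet> b) * w x + ennreal (n x \<bullet> (- b)) * w x) \<partial>surface S)"
    proof (rule nn_integral_mono_AE)
      show "AE x in surface S. w x \<le> (\<Sum>b\<in>Basis. ennreal (n x \<bullet> b) * w x + ennreal (n x \<bullet> (- b)) * w x)"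
        using AE_surface[OF S_borel]
      proof eventually_elim
        case (elim x)
        have "ennreal a + ennreal (- a) = ennreal \<bar>a\<bar>" for a :: real
          by (cases "0 \<le> a") (auto simp: ennreal_neg)
        then have "(\<Sum>b\<in>Basis. ennreal (n x \<bullet> b) * w x + ennreal (n x \<bullet> (- b)) * w x) = (\<Sum>b\<in>Basis. ennreal \<bar>n x \<bullet> b\<bar>) * w x"
          by (simp add: sum_distrib_right del: sum_ennreal flip: distrib_right)
        also have "(\<Sum>b\<in>Basis. ennreal \<bar>n x \<bullet> b\<bar>) = ennreal (\<Sum>b\<in>Basis. \<bar>n x \<bullet> b\<bar>)" by simp
        finally have eq: "(\<Sum>b\<in>Basis. ennreal (n x \<bullet> b) * w x + ennreal (n x \<bullet> (- b)) * w x) = ennreal (\<Sum>b\<in>Basis. \<bar>n x \<bullet> b\<bar>) * w x" .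
        have "1 \<le> (\<Sum>b\<in>Basis. \<bar>n x \<bullet> b\<bar>)" using norm_le_l1[of "n x"] normal_unit[OF elim] by simp
        then have "1 \<le> ennreal (\<Sum>b\<in>Basis. \<bar>n x \<bullet> b\<bar>)" by simp
        then have "1 * w x \<le> ennreal (\<Sum>b\<in>Basis. \<bar>n x \<bullet> b\<bar>) * w x" by (rule mult_right_mono) simp
        then show ?case unfolding eq by simp
      qed
    qed
    also have "\<dots> = (\<Sum>b\<in>Basis. (\<integral>\<^sup>+x. ennreal (n x \<bullet> b) * w x \<partial>surface S) + (\<integral>\<^sup>+x. ennreal (n x \<bullet> (- b)) * w x \<partial>surface S))"
      by (subst nn_integral_sum) (auto simp: nn_integral_add)
    also have "\<dots> \<le> ?B"
      unfolding w_def by (intro sum_mono add_mono surface_kernel_projection_bound[OF R p]) auto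
    finally show "(\<integral>\<^sup>+x. ennreal (1 / norm (x - p) ^ (DIM('a) - 2)) \<partial>surface S) \<le> ennreal C"
      unfolding w_def C(2) .
  qed
qed

end

section \<open>The flux of a field orthogonal to the chord\<close>

lemma has_real_derivative_norm_line:
  fixes z b :: "'a::euclidean_space"
  assumes z: "z \<noteq> 0"
  shows "((\<lambda>t. norm (z + t *\<^sub>R b)) has_real_derivative (z \<bullet> b) / norm z) (at 0)"
proof -
  have eq: "norm (z + t *\<^sub>R b) = sqrt (z \<bullet> z + 2 * t * (z \<bullet> b) + t\<^sup>2 * (b \<bullet> b))" for t
    by (simp add: norm_eq_sqrt_inner inner_add_left inner_add_right inner_commute[of b z] power2_eq_square algebra_simps)
  have "((\<lambda>t. sqrt (z \<bullet> z + 2 * t * (z \<bullet> b) + t\<^sup>2 * (b \<bullet> b))) has_real_derivative (z \<bullet> b) / norm z) (at 0)"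
  proof -
    have "0 < z \<bullet> z" using z by simp
    then show ?thesis
      by (auto intro!: derivative_eq_intros simp: norm_eq_sqrt_inner field_simps) (metis inner_ge_zero not_less)
  qed
  then show ?thesis by (simp add: eq)
qed

text \<open>For a field \<open>V = \<psi>(r)(r\<^sup>2 m - (m \<bullet> z) z)\<close>, which is orthogonal to \<open>z\<close>, the terms with \<open>\<psi>'\<close> cancel in the
  divergence; this is why only \<open>h'\<close> and no second derivative of \<open>h\<close> shows up in the end.\<close>

definition field_comp :: "(real \<Rightarrow> real) \<Rightarrow> 'a::euclidean_space \<Rightarrow> 'a \<Rightarrow> 'a \<Rightarrow> real" where
  "field_comp q m b z = q (norm z) / norm z ^ DIM('a) * ((norm z)\<^sup>2 * (m \<bullet> b) - (m \<bullet> z) * (z \<bullet> b))"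

definition field_deriv :: "(real \<Rightarrow> real) \<Rightarrow> (real \<Rightarrow> real) \<Rightarrow> 'a::euclidean_space \<Rightarrow> 'a \<Rightarrow> 'a \<Rightarrow> real" where
  "field_deriv q q' m b z =
    (q' (norm z) / norm z ^ DIM('a) - real DIM('a) * q (norm z) / norm z ^ Suc DIM('a)) * ((z \<bullet> b) / norm z)
      * ((norm z)\<^sup>2 * (m \<bullet> b) - (m \<bullet> z) * (z \<bullet> b))
    + q (norm z) / norm z ^ DIM('a) * ((z \<bullet> b) * (m \<bullet> b) - (m \<bullet> z))"

lemma field_comp_has_derivative:
  fixes z b m :: "'a::euclidean_space"
  assumes z: "z \<noteq> 0" and b: "b \<bullet> b = 1" and q: "\<And>r. (q has_real_derivative q' r) (at r)"
  shows "((\<lambda>t. field_comp q m b (z + t *\<^sub>R b)) has_real_derivative field_deriv q q' m b z) (at 0)"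
proof -
  let ?d = "DIM('a)" and ?r = "norm z"
  have r: "0 < ?r" using z by simp
  note nd = has_real_derivative_norm_line[OF z, of b]
  have psi: "((\<lambda>r. q r / r ^ ?d) has_real_derivative (q' ?r / ?r ^ ?d - real ?d * q ?r / ?r ^ Suc ?d)) (at ?r)"
  proof -
    have "((\<lambda>r. q r / r ^ ?d) has_real_derivative (q' ?r * ?r ^ ?d - q ?r * (real ?d * ?r ^ (?d - 1))) / (?r ^ ?d * ?r ^ ?d)) (at ?r)"
      using r by (auto intro!: derivative_eq_intros q)
    also have "(q' ?r * ?r ^ ?d - q ?r * (real ?d * ?r ^ (?d - 1))) / (?r ^ ?d * ?r ^ ?d) = q' ?r / ?r ^ ?d - real ?d * q ?r / ?r ^ Suc ?d"
    proof -
      obtain k where k: "?d = Suc k" using DIM_positive[where 'a='a] by (metis Suc_pred)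
      show ?thesis using r unfolding k by (simp add: field_simps)
    qed
    finally show ?thesis .
  qed
  have 1: "((\<lambda>t. q (norm (z + t *\<^sub>R b)) / norm (z + t *\<^sub>R b) ^ ?d) has_real_derivative
      (q' ?r / ?r ^ ?d - real ?d * q ?r / ?r ^ Suc ?d) * ((z \<bullet> b) / ?r)) (at 0)"
    using DERIV_chain2[of "\<lambda>r. q r / r ^ ?d" _ "\<lambda>t. norm (z + t *\<^sub>R b)" 0, OF _ nd] psi by simp
  have eq: "(norm (z + t *\<^sub>R b))\<^sup>2 * (m \<bullet> b) - (m \<bullet> (z + t *\<^sub>R b)) * ((z + t *\<^sub>R b) \<bullet> b)
      = (z \<bullet> z + 2 * t * (z \<bullet> b) + t\<^sup>2) * (m \<bullet> b) - (m \<bullet> z + t * (m \<bullet> b)) * (z \<bullet> b + t)" for t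
    unfolding power2_norm_eq_inner
    by (simp add: inner_add_left inner_add_right inner_commute[of b z] b power2_eq_square algebra_simps)
  have 2: "((\<lambda>t. (norm (z + t *\<^sub>R b))\<^sup>2 * (m \<bullet> b) - (m \<bullet> (z + t *\<^sub>R b)) * ((z + t *\<^sub>R b) \<bullet> b)) has_real_derivative
      ((z \<bullet> b) * (m \<bullet> b) - (m \<bullet> z))) (at 0)"
    unfolding eq by (auto intro!: derivative_eq_intros simp: algebra_simps)
  show ?thesis
    unfolding field_comp_def field_deriv_def
    using DERIV_mult'[OF 1 2] by (simp add: add.commute)
qed

lemma sum_field_comp:
  fixes z m v :: "'a::euclidean_space"
  shows "(\<Sum>b\<in>Basis. field_comp q m b z * (v \<bullet> b))
    = q (norm z) / norm z ^ DIM('a) * ((norm z)\<^sup>2 * (m \<bullet> v) - (m \<bullet> z) * (z \<bullet> v))"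
proof -
  have "(\<Sum>b\<in>Basis. field_comp q m b z * (v \<bullet> b))
     = q (norm z) / norm z ^ DIM('a) * ((norm z)\<^sup>2 * (\<Sum>b\<in>Basis. (m \<bullet> b) * (v \<bullet> b)) - (m \<bullet> z) * (\<Sum>b\<in>Basis. (z \<bullet> b) * (v \<bullet> b)))"
    unfolding field_comp_def sum_distrib_left sum_subtractf[symmetric] by (intro sum.cong) (auto simp: algebra_simps)
  then show ?thesis by (simp add: euclidean_inner[symmetric])
qed

lemma sum_field_deriv:
  fixes z m :: "'a::euclidean_space"
  shows "(\<Sum>b\<in>Basis. field_deriv q q' m b z) = - (real DIM('a) - 1) * (q (norm z) / norm z ^ DIM('a) * (m \<bullet> z))"
proof -
  define P where "P = q' (norm z) / norm z ^ DIM('a) - real DIM('a) * q (norm z) / norm z ^ Suc DIM('a)"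
  define Q where "Q = q (norm z) / norm z ^ DIM('a)"
  have "(\<Sum>b\<in>Basis. field_deriv q q' m b z)
    = P / norm z * ((norm z)\<^sup>2 * (\<Sum>b\<in>Basis. (m \<bullet> b) * (z \<bullet> b)) - (m \<bullet> z) * (\<Sum>b\<in>Basis. (z \<bullet> b) * (z \<bullet> b)))
      + Q * ((\<Sum>b\<in>Basis. (z \<bullet> b) * (m \<bullet> b)) - (\<Sum>b\<in>(Basis::'a set). m \<bullet> z))"
    unfolding sum_distrib_left sum_subtractf[symmetric] sum.distrib[symmetric]
    unfolding field_deriv_def P_def[symmetric] Q_def[symmetric]
    by (intro sum.cong) (auto simp: divide_inverse algebra_simps)
  also have "\<dots> = P / norm z * ((norm z)\<^sup>2 * (m \<bullet> z) - (m \<bullet> z) * (z \<bullet> z)) + Q * (z \<bullet> m - real DIM('a) * (m \<bullet> z))"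
    by (simp add: euclidean_inner[symmetric])
  \<comment> \<open>The bracket after \<open>P\<close> is \<open>norm z ^ 2 * (m \<bullet> z) - (m
    \<bullet> z) * (z \<bullet> z) = 0\<close>, so \<open>P\<close>, which contains
    \<open>q'\<close>, disappears.\<close>
  also have "\<dots> = - (real DIM('a) - 1) * (Q * (m \<bullet> z))"
    by (simp add: power2_norm_eq_inner inner_commute[of z m] algebra_simps)
  finally show ?thesis by (simp add: Q_def)
qed

lemma field_inner_bound:
  fixes z m b :: "'a::euclidean_space"
  assumes "norm m \<le> 1" "norm b \<le> 1"
  shows "\<bar>(norm z)\<^sup>2 * (m \<bullet> b) - (m \<bullet> z) * (z \<bullet> b)\<bar> \<le> 2 * (norm z)\<^sup>2"
proof -
  have 1: "\<bar>m \<bullet> b\<bar> \<le> 1"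
    using Cauchy_Schwarz_ineq2[of m b] mult_mono[OF assms] by simp
  have 2: "\<bar>m \<bullet> z\<bar> \<le> norm z" using Cauchy_Schwarz_ineq2[of m z] mult_right_mono[OF assms(1), of "norm z"] by simp
  have 3: "\<bar>z \<bullet> b\<bar> \<le> norm z" using Cauchy_Schwarz_ineq2[of z b] mult_left_mono[OF assms(2), of "norm z"] by simp
  have "\<bar>(norm z)\<^sup>2 * (m \<bullet> b) - (m \<bullet> z) * (z \<bullet> b)\<bar> \<le> (norm z)\<^sup>2 * \<bar>m \<bullet> b\<bar> + \<bar>m \<bullet> z\<bar> * \<bar>z \<bullet> b\<bar>"
    using abs_triangle_ineq4[of "(norm z)\<^sup>2 * (m \<bullet> b)" "(m \<bullet> z) * (z \<bullet> b)"] by (simp add: abs_mult)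
  also have "\<dots> \<le> (norm z)\<^sup>2 * 1 + norm z * norm z"
    using 1 2 3 by (intro add_mono mult_left_mono mult_mono) auto
  finally show ?thesis by (simp add: power2_eq_square)
qed

lemma kernel_power_simps:
  fixes r :: real
  assumes d: "2 \<le> d" and r: "r \<noteq> 0"
  shows "r\<^sup>2 / r ^ d = 1 / r ^ (d - 2)" "r / r ^ d = 1 / r ^ (d - 1)"
proof -
  obtain k where "d = Suc (Suc k)" using d by (metis One_nat_def Suc_1 Suc_le_D Suc_le_mono)
  then show "r\<^sup>2 / r ^ d = 1 / r ^ (d - 2)" "r / r ^ d = 1 / r ^ (d - 1)"
    using r by (auto simp: power2_eq_square)
qed

lemma field_comp_bound:
  fixes z m b :: "'a::euclidean_space"
  assumes dim: "DIM('a) \<ge> 2" and mb: "norm m \<le> 1" "norm b \<le> 1" and q: "\<bar>q (norm z)\<bar> \<le> Q"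
  shows "\<bar>field_comp q m b z\<bar> \<le> 2 * Q * (1 / norm z ^ (DIM('a) - 2))"
proof (cases "z = 0")
  case False
  have "\<bar>field_comp q m b z\<bar> = \<bar>q (norm z)\<bar> / norm z ^ DIM('a) * \<bar>(norm z)\<^sup>2 * (m \<bullet> b) - (m \<bullet> z) * (z \<bullet> b)\<bar>"
    by (simp add: field_comp_def abs_mult)
  also have "\<dots> \<le> Q / norm z ^ DIM('a) * (2 * (norm z)\<^sup>2)"
    using q by (intro mult_mono divide_right_mono field_inner_bound mb) auto
  also have "\<dots> = 2 * Q * ((norm z)\<^sup>2 / norm z ^ DIM('a))" by simp
  finally show ?thesis using kernel_power_simps(1)[OF dim, of "norm z"] False by simp
next
  case True
  have "0 \<le> Q" using q by linarith
  then show ?thesis using True by (simp add: field_comp_def)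
qed

lemma field_deriv_bound:
  fixes z m b :: "'a::euclidean_space"
  assumes dim: "DIM('a) \<ge> 2" and mb: "norm m \<le> 1" "norm b \<le> 1" and q: "\<bar>q (norm z)\<bar> \<le> Q" "\<bar>q' (norm z)\<bar> \<le> Q'"
    and R: "norm z \<le> R"
  shows "\<bar>field_deriv q q' m b z\<bar> \<le> (2 * (Q' * R + real DIM('a) * Q) + 2 * Q) * (1 / norm z ^ (DIM('a) - 1))"
proof (cases "z = 0")
  case False
  let ?d = "DIM('a)" and ?r = "norm z"
  have r: "0 < ?r" using False by simp
  have Q0: "0 \<le> Q" "0 \<le> Q'" using q by linarith+
  have mz: "\<bar>m \<bullet> z\<bar> \<le> ?r" using Cauchy_Schwarz_ineq2[of m z] mult_right_mono[OF mb(1), of ?r] by simp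
  have zb: "\<bar>z \<bullet> b\<bar> \<le> ?r" using Cauchy_Schwarz_ineq2[of z b] mult_left_mono[OF mb(2), of ?r] by simp
  have mb1: "\<bar>m \<bullet> b\<bar> \<le> 1" using Cauchy_Schwarz_ineq2[of m b] mult_mono[OF mb] by simp
  have zr: "\<bar>(z \<bullet> b) / ?r\<bar> \<le> 1" using zb r by (simp add: abs_mult)
  have "\<bar>q' ?r / ?r ^ ?d - real ?d * q ?r / ?r ^ Suc ?d\<bar> \<le> \<bar>q' ?r\<bar> / ?r ^ ?d + real ?d * \<bar>q ?r\<bar> / ?r ^ Suc ?d"
    using abs_triangle_ineq4[of "q' ?r / ?r ^ ?d" "real ?d * q ?r / ?r ^ Suc ?d"] by (simp add: abs_mult)
  also have "\<dots> \<le> Q' / ?r ^ ?d + real ?d * Q / ?r ^ Suc ?d"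
    using q r by (intro add_mono divide_right_mono mult_left_mono) auto
  also have "\<dots> = (Q' * ?r + real ?d * Q) / ?r ^ Suc ?d" using r by (simp add: field_simps)
  also have "\<dots> \<le> (Q' * R + real ?d * Q) / ?r ^ Suc ?d"
    using R Q0 r by (intro divide_right_mono add_right_mono mult_left_mono) auto
  finally have P: "\<bar>q' ?r / ?r ^ ?d - real ?d * q ?r / ?r ^ Suc ?d\<bar> \<le> (Q' * R + real ?d * Q) / ?r ^ Suc ?d" .
  have "0 \<le> R" using R r by linarith
  then have A0: "0 \<le> Q' * R + real ?d * Q" using Q0 by (intro add_nonneg_nonneg mult_nonneg_nonneg) auto
  have t1: "\<bar>(q' ?r / ?r ^ ?d - real ?d * q ?r / ?r ^ Suc ?d) * ((z \<bullet> b) / ?r) * (?r\<^sup>2 * (m \<bullet> b) - (m \<bullet> z) * (z \<bullet> b))\<bar>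
      \<le> (Q' * R + real ?d * Q) / ?r ^ Suc ?d * 1 * (2 * ?r\<^sup>2)"
    unfolding abs_mult[of "_ * _"] abs_mult[of "_ - _ / _"]
    using P zr A0 r by (intro mult_mono field_inner_bound mb) auto
  have "\<bar>(z \<bullet> b) * (m \<bullet> b) - (m \<bullet> z)\<bar> \<le> \<bar>z \<bullet> b\<bar> * \<bar>m \<bullet> b\<bar> + \<bar>m \<bullet> z\<bar>"
    using abs_triangle_ineq4[of "(z \<bullet> b) * (m \<bullet> b)" "m \<bullet> z"] by (simp add: abs_mult)
  also have "\<dots> \<le> ?r * 1 + ?r" using mz zb mb1 by (intro add_mono mult_mono) auto
  finally have "\<bar>(z \<bullet> b) * (m \<bullet> b) - (m \<bullet> z)\<bar> \<le> 2 * ?r" by simp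
  then have t2: "\<bar>q ?r / ?r ^ ?d * ((z \<bullet> b) * (m \<bullet> b) - (m \<bullet> z))\<bar> \<le> Q / ?r ^ ?d * (2 * ?r)"
    unfolding abs_mult abs_divide using q Q0 r by (intro mult_mono divide_mono) auto
  have "\<bar>field_deriv q q' m b z\<bar> \<le> (Q' * R + real ?d * Q) / ?r ^ Suc ?d * 1 * (2 * ?r\<^sup>2) + Q / ?r ^ ?d * (2 * ?r)"
    unfolding field_deriv_def using t1 t2 by linarith
  also have "\<dots> = (2 * (Q' * R + real ?d * Q) + 2 * Q) * (?r / ?r ^ ?d)"
    using r by (simp add: power2_eq_square add_divide_distrib algebra_simps)
  also have "?r / ?r ^ ?d = 1 / ?r ^ (?d - 1)" using r by (intro kernel_power_simps(2)[OF dim]) simp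
  finally show ?thesis .
next
  case True
  have Q0: "0 \<le> Q" "0 \<le> Q'" "0 \<le> R" using q R norm_ge_zero[of z] by linarith+
  have "field_deriv q q' m b z = 0" using True by (simp add: field_deriv_def)
  then show ?thesis using Q0 by simp
qed

context smooth_body
begin

text \<open>For \<open>q = h'\<close> this is the integrand of the double boundary integral, by
  \<open>angle_product\<close>, written without the unit direction of the chord. For fixed
  \<open>p\<close> it is the normal component of the field with \<open>m = n p\<close>.\<close>

definition chord_kernel :: "(real \<Rightarrow> real) \<Rightarrow> 'a \<Rightarrow> 'a \<Rightarrow> real" where
  "chord_kernel q p x = q (norm (x - p)) / norm (x - p) ^ DIM('a)
      * ((norm (x - p))\<^sup>2 * (n p \<bullet> n x) - (n p \<bullet> (x - p)) * ((x - p) \<bullet> n x))"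

text \<open>Up to the factor \<open>- (d - 1)\<close> this is the divergence of that field, by
  \<open>sum_field_deriv\<close>.\<close>

definition volume_kernel :: "(real \<Rightarrow> real) \<Rightarrow> 'a \<Rightarrow> 'a \<Rightarrow> real" where
  "volume_kernel q p x = q (norm (x - p)) / norm (x - p) ^ DIM('a) * (n p \<bullet> (x - p))"

lemma chord_kernel_bound:
  assumes "\<bar>q (norm (x - p))\<bar> \<le> Q"
  shows "\<bar>chord_kernel q p x\<bar> \<le> 2 * Q * (1 / norm (x - p) ^ (DIM('a) - 2))"
  using field_comp_bound[of "n p" "n x" q "x - p" Q, OF dim norm_normal_le norm_normal_le assms]
  by (simp add: chord_kernel_def field_comp_def)

lemma volume_kernel_bound:
  assumes q: "\<bar>q (norm (x - p))\<bar> \<le> Q"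
  shows "\<bar>volume_kernel q p x\<bar> \<le> Q * (1 / norm (x - p) ^ (DIM('a) - 1))"
proof (cases "x = p")
  case False
  let ?r = "norm (x - p)"
  have "\<bar>n p \<bullet> (x - p)\<bar> \<le> ?r" using Cauchy_Schwarz_ineq2[of "n p" "x - p"] mult_right_mono[OF norm_normal_le[of p], of ?r] by simp
  then have "\<bar>volume_kernel q p x\<bar> \<le> Q / ?r ^ DIM('a) * ?r"
    unfolding volume_kernel_def abs_mult abs_divide using q False by (intro mult_mono divide_mono) auto
  also have "\<dots> = Q * (?r / ?r ^ DIM('a))" by simp
  finally show ?thesis using kernel_power_simps(2)[OF dim, of ?r] False by simp
next
  case True
  have "0 \<le> Q" using q by linarith
  then show ?thesis using True by (simp add: volume_kernel_def)
qed

lemma chord_kernel_measurable [measurable]: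
  assumes [measurable]: "q \<in> borel_measurable borel"
  shows "(\<lambda>(p, x). chord_kernel q p x) \<in> borel_measurable (borel \<Otimes>\<^sub>M borel)" "chord_kernel q p \<in> borel_measurable borel"
  unfolding chord_kernel_def by measurable

lemma volume_kernel_measurable [measurable]:
  assumes [measurable]: "q \<in> borel_measurable borel"
  shows "volume_kernel q p \<in> borel_measurable borel"
  unfolding volume_kernel_def by measurable

lemma surface_kernel_integrable:
  assumes p: "p \<in> K"
  shows "integrable (surface S) (\<lambda>x. 1 / norm (x - p) ^ (DIM('a) - 2))"
proof (rule integrableI_bounded)
  obtain C where C: "\<And>p. p \<in> K \<Longrightarrow> (\<integral>\<^sup>+x. ennreal (1 / norm (x - p) ^ (DIM('a) - 2)) \<partial>surface S) \<le> ennreal C"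
    using surface_kernel_bound by blast
  show "(\<integral>\<^sup>+x. ennreal (norm (1 / norm (x - p) ^ (DIM('a) - 2))) \<partial>surface S) < \<infinity>"
    using C[OF p] by (simp add: order_le_less_trans)
qed measurable

text \<open>The coordinate components of the field are treated one by one with
  \<open>divergence_direction\<close>; its exceptional point is the pole \<open>p\<close> of the
  field.\<close>

lemma flux_smooth:
  assumes p: "p \<in> S" and q: "\<And>r. (q has_real_derivative q' r) (at r)" and q': "continuous_on UNIV q'"
  shows "(\<integral>x. chord_kernel q p x \<partial>surface S)
    = - (real DIM('a) - 1) * slice_const TYPE('a) * (\<integral>x. indicator K x * volume_kernel q p x \<partial>lborel)"
proof -
  have pK: "p \<in> K" using p S_subset by auto
  obtain R where R: "0 < R" "\<And>x. x \<in> K \<Longrightarrow> norm x \<le> R" by (rule K_bounded) blast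
  have xp: "norm (x - p) \<le> 2 * R" if "x \<in> K" for x
    using norm_triangle_ineq4[of x p] R(2)[OF that] R(2)[OF pK] by linarith
  have cq: "continuous_on UNIV q" using q by (meson DERIV_isCont continuous_at_imp_continuous_on)
  have [measurable]: "q \<in> borel_measurable borel" "q' \<in> borel_measurable borel"
    using cq q' by (auto intro: borel_measurable_continuous_onI)
  have bdd: "\<exists>Q. \<forall>r\<in>{0..2*R}. \<bar>f r\<bar> \<le> Q" if "continuous_on UNIV f" for f :: "real \<Rightarrow> real"
  proof -
    have "compact (f ` {0..2*R})" using that by (intro compact_continuous_image continuous_on_subset[OF that]) auto
    then show ?thesis using compact_imp_bounded by (force simp: bounded_iff)
  qed
  obtain Q where Q: "\<And>r. r \<in> {0..2*R} \<Longrightarrow> \<bar>q r\<bar> \<le> Q" using bdd[OF cq] by blast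
  obtain Q' where Q': "\<And>r. r \<in> {0..2*R} \<Longrightarrow> \<bar>q' r\<bar> \<le> Q'" using bdd[OF q'] by blast
  let ?f = "\<lambda>b x. field_comp q (n p) b (x - p)" and ?g = "\<lambda>b x. field_deriv q q' (n p) b (x - p)"
  have fm [measurable]: "?f b \<in> borel_measurable borel" "?g b \<in> borel_measurable borel" for b
    unfolding field_comp_def field_deriv_def by measurable
  have ig: "integrable lborel (\<lambda>x. indicator K x * ?g b x)" if b: "b \<in> Basis" for b
  proof (rule Bochner_Integration.integrable_bound)
    let ?A = "2 * (Q' * (2 * R) + real DIM('a) * Q) + 2 * Q"
    show "integrable lborel (\<lambda>x. ?A * (indicator K x * (1 / norm (x - p) ^ (DIM('a) - 1))))"
      by (intro integrable_mult_right volume_kernel_integrable pK)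
    have "\<bar>indicator K x * ?g b x\<bar> \<le> ?A * (indicator K x * (1 / norm (x - p) ^ (DIM('a) - 1)))" for x
    proof (cases "x \<in> K")
      case True
      have "\<bar>?g b x\<bar> \<le> ?A * (1 / norm (x - p) ^ (DIM('a) - 1))"
        using b xp[OF True] by (intro field_deriv_bound[OF dim norm_normal_le] Q Q') auto
      then show ?thesis using True by simp
    qed simp
    then show "AE x in lborel. norm (indicator K x * ?g b x) \<le> norm (?A * (indicator K x * (1 / norm (x - p) ^ (DIM('a) - 1))))"
      by (intro AE_I2) (metis abs_ge_self order_trans real_norm_def)
  qed measurable
  have if': "integrable (surface S) (?f b)" if b: "b \<in> Basis" for b
  proof (rule Bochner_Integration.integrable_bound)
    show "integrable (surface S) (\<lambda>x. 2 * Q * (1 / norm (x - p) ^ (DIM('a) - 2)))"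
      by (intro integrable_mult_right surface_kernel_integrable pK)
    show "AE x in surface S. norm (?f b x) \<le> norm (2 * Q * (1 / norm (x - p) ^ (DIM('a) - 2)))"
      using AE_surface[OF S_borel]
    proof eventually_elim
      case (elim x)
      then have "norm (x - p) \<le> 2 * R" using S_subset by (intro xp) auto
      then have "\<bar>?f b x\<bar> \<le> 2 * Q * (1 / norm (x - p) ^ (DIM('a) - 2))"
        using b by (intro field_comp_bound[OF dim norm_normal_le] Q) auto
      then show ?case by (metis abs_ge_self order_trans real_norm_def)
    qed
  qed measurable
  have der: "((\<lambda>t. ?f b (x + t *\<^sub>R b)) has_real_derivative ?g b x) (at 0)" if "b \<in> Basis" "x \<noteq> p" for b x
  proof -
    have "((\<lambda>t. field_comp q (n p) b ((x - p) + t *\<^sub>R b)) has_real_derivative ?g b x) (at 0)"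
      using that q by (intro field_comp_has_derivative) auto
    then show ?thesis by (simp add: algebra_simps)
  qed
  have dv: "integrable (surface S) (\<lambda>x. ?f b x * (n x \<bullet> b))"
      "(\<integral>x. ?f b x * (n x \<bullet> b) \<partial>surface S) = slice_const TYPE('a) * (\<integral>x. indicator K x * ?g b x \<partial>lborel)" if b: "b \<in> Basis" for b
    using divergence_direction[where e=b and f="?f b" and g="?g b" and p=p, OF _ fm der[OF b] ig[OF b] if'[OF b]] b by auto
  have "(\<integral>x. chord_kernel q p x \<partial>surface S) = (\<integral>x. (\<Sum>b\<in>Basis. ?f b x * (n x \<bullet> b)) \<partial>surface S)"
    unfolding sum_field_comp chord_kernel_def ..
  also have "\<dots> = (\<Sum>b\<in>Basis. \<integral>x. ?f b x * (n x \<bullet> b) \<partial>surface S)"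
    using dv by (intro Bochner_Integration.integral_sum) auto
  also have "\<dots> = (\<Sum>b\<in>Basis. slice_const TYPE('a) * (\<integral>x. indicator K x * ?g b x \<partial>lborel))"
    using dv by (intro sum.cong) auto
  also have "\<dots> = slice_const TYPE('a) * (\<integral>x. (\<Sum>b\<in>Basis. indicator K x * ?g b x) \<partial>lborel)"
    using ig by (subst Bochner_Integration.integral_sum) (auto simp: sum_distrib_left)
  also have "(\<lambda>x. (\<Sum>b\<in>Basis. indicator K x * ?g b x)) = (\<lambda>x. - (real DIM('a) - 1) * (indicator K x * volume_kernel q p x))"
    unfolding sum_distrib_left[symmetric] sum_field_deriv volume_kernel_def by (simp add: fun_eq_iff mult_ac)
  also have "(\<integral>x. - (real DIM('a) - 1) * (indicator K x * volume_kernel q p x) \<partial>lborel)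
      = - (real DIM('a) - 1) * (\<integral>x. indicator K x * volume_kernel q p x \<partial>lborel)"
    by (rule integral_mult_right_zero)
  finally show ?thesis by (simp add: mult_ac)
qed

end

section \<open>Signed polar coordinates and approximation of the flux\<close>

lemma abs_integral_le:
  fixes f w :: "'a \<Rightarrow> real"
  assumes "integrable M f" "integrable M w" "AE x in M. \<bar>f x\<bar> \<le> w x"
  shows "\<bar>\<integral>x. f x \<partial>M\<bar> \<le> (\<integral>x. w x \<partial>M)"
proof -
  have "\<bar>\<integral>x. f x \<partial>M\<bar> \<le> (\<integral>x. \<bar>f x\<bar> \<partial>M)" by (rule integral_abs_bound)
  also have "\<dots> \<le> (\<integral>x. w x \<partial>M)" using assms by (intro integral_mono_AE) auto
  finally show ?thesis .
qed

lemma integral_polar: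
  fixes F :: "'a::euclidean_space \<Rightarrow> real"
  assumes dim: "DIM('a) \<ge> 2" and F: "integrable lborel F"
  shows "(\<integral>u. \<integral>t. indicator {0<..} t * t ^ (DIM('a) - 1) * F (t *\<^sub>R u) \<partial>lborel \<partial>surface (sphere 0 1))
    = slice_const TYPE('a) * (\<integral>x. F x \<partial>lborel)"
proof -
  have [measurable]: "F \<in> borel_measurable borel" using F by simp
  interpret B: smooth_body "cball 0 1" "\<lambda>x::'a. if x \<in> sphere 0 1 then x else 0"
    by (rule smooth_body_ball[OF dim])
  interpret S: finite_measure "surface (sphere (0::'a) 1)" using B.finite_surface by simp
  define \<rho> where "\<rho> t = indicator {0<..} t * t ^ (DIM('a) - 1)" for t :: real
  have \<rho>0: "0 \<le> \<rho> t" for t by (auto simp: \<rho>_def indicator_def)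
  have [measurable]: "\<rho> \<in> borel_measurable borel" unfolding \<rho>_def by measurable
  \<comment> \<open>With the Jacobian put into a measure on the line, direction and radius carry a
    product measure to which Fubini applies.\<close>
  define N where "N = density lborel (\<lambda>t. ennreal (\<rho> t))"
  have [measurable_cong]: "sets N = sets borel" by (simp add: N_def)
  interpret N: sigma_finite_measure N
    unfolding N_def by (subst sigma_finite_measure.sigma_finite_iff_density_finite[OF lborel.sigma_finite_measure_axioms]) auto
  interpret pair_sigma_finite "surface (sphere (0::'a) 1)" N ..
  let ?P = "surface (sphere (0::'a) 1) \<Otimes>\<^sub>M N"
  have c0: "0 \<le> slice_const TYPE('a)" using slice_const_pos[OF dim] by simp
  have eq: "distr ?P borel (\<lambda>(u, t). t *\<^sub>R u) = density lborel (\<lambda>_. ennreal (slice_const TYPE('a)))"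
  proof (rule measure_eqI)
    fix A assume "A \<in> sets (distr ?P borel (\<lambda>(u, t). t *\<^sub>R u))"
    then have A [measurable]: "A \<in> sets borel" by simp
    have "emeasure (distr ?P borel (\<lambda>(u, t). t *\<^sub>R u)) A = (\<integral>\<^sup>+x. indicator A x \<partial>distr ?P borel (\<lambda>(u, t). t *\<^sub>R u))" by simp
    also have "\<dots> = (\<integral>\<^sup>+p. indicator A (snd p *\<^sub>R fst p) \<partial>?P)" by (subst nn_integral_distr) (auto simp: split_beta')
    also have "\<dots> = (\<integral>\<^sup>+u. \<integral>\<^sup>+t. indicator A (t *\<^sub>R u) \<partial>N \<partial>surface (sphere 0 1))"
      by (subst N.nn_integral_fst[symmetric]) auto
    also have "\<dots> = (\<integral>\<^sup>+u. \<integral>\<^sup>+t. indicator {0<..} t * ennreal (t ^ (DIM('a) - 1)) * indicator A (t *\<^sub>R u) \<partial>lborel \<partial>surface (sphere 0 1))"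
      unfolding N_def by (intro nn_integral_cong, subst nn_integral_density)
        (auto intro!: nn_integral_cong simp: \<rho>_def indicator_def)
    also have "\<dots> = ennreal (slice_const TYPE('a)) * (\<integral>\<^sup>+x. indicator A x \<partial>lborel)"
      by (rule polar_coordinates[OF dim]) measurable
    finally show "emeasure (distr ?P borel (\<lambda>(u, t). t *\<^sub>R u)) A = emeasure (density lborel (\<lambda>_. ennreal (slice_const TYPE('a)))) A"
      by (simp add: emeasure_density nn_integral_cmult)
  qed simp
  have "integrable (density lborel (\<lambda>_. ennreal (slice_const TYPE('a)))) F" using F c0 by (subst integrable_density) auto
  then have int: "integrable ?P (\<lambda>(u, t). F (t *\<^sub>R u))"
    unfolding eq[symmetric] by (subst (asm) integrable_distr_eq) (auto simp: split_beta')
  have "(\<integral>u. \<integral>t. indicator {0<..} t * t ^ (DIM('a) - 1) * F (t *\<^sub>R u) \<partial>lborel \<partial>surface (sphere 0 1))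
      = (\<integral>u. \<integral>t. F (t *\<^sub>R u) \<partial>N \<partial>surface (sphere 0 1))"
    unfolding N_def using \<rho>0 by (subst integral_density) (auto simp: \<rho>_def)
  also have "\<dots> = (\<integral>p. F (snd p *\<^sub>R fst p) \<partial>?P)" using integral_fst'[OF int] by (simp add: split_beta')
  also have "\<dots> = (\<integral>x. F x \<partial>distr ?P borel (\<lambda>(u, t). t *\<^sub>R u))" by (subst integral_distr) (auto simp: split_beta')
  also have "\<dots> = slice_const TYPE('a) * (\<integral>x. F x \<partial>lborel)" unfolding eq using c0 by (subst integral_density) auto
  finally show ?thesis .
qed

context smooth_body
begin

lemma kernel_integrable:
  assumes p: "p \<in> K" and q: "continuous_on UNIV q"
  shows "integrable (surface S) (chord_kernel q p)" "integrable lborel (\<lambda>x. indicator K x * volume_kernel q p x)"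
proof -
  obtain R where R: "0 < R" "\<And>x. x \<in> K \<Longrightarrow> norm x \<le> R" by (rule K_bounded) blast
  have xp: "norm (x - p) \<in> {0..2*R}" if "x \<in> K" for x
    using norm_triangle_ineq4[of x p] R(2)[OF that] R(2)[OF p] by simp
  have [measurable]: "q \<in> borel_measurable borel" using q by (rule borel_measurable_continuous_onI)
  have "compact (q ` {0..2*R})" using q by (intro compact_continuous_image continuous_on_subset[OF q]) auto
  then obtain Q where Q: "\<And>r. r \<in> {0..2*R} \<Longrightarrow> \<bar>q r\<bar> \<le> Q" using compact_imp_bounded by (force simp: bounded_iff)
  show "integrable (surface S) (chord_kernel q p)"
  proof (rule Bochner_Integration.integrable_bound)
    show "integrable (surface S) (\<lambda>x. 2 * Q * (1 / norm (x - p) ^ (DIM('a) - 2)))"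
      by (intro integrable_mult_right surface_kernel_integrable p)
    show "AE x in surface S. norm (chord_kernel q p x) \<le> norm (2 * Q * (1 / norm (x - p) ^ (DIM('a) - 2)))"
      using AE_surface[OF S_borel]
    proof eventually_elim
      case (elim x)
      then have "\<bar>chord_kernel q p x\<bar> \<le> 2 * Q * (1 / norm (x - p) ^ (DIM('a) - 2))"
        using S_subset by (intro chord_kernel_bound Q xp) auto
      then show ?case by (metis abs_ge_self order_trans real_norm_def)
    qed
  qed measurable
  show "integrable lborel (\<lambda>x. indicator K x * volume_kernel q p x)"
  proof (rule Bochner_Integration.integrable_bound)
    show "integrable lborel (\<lambda>x. Q * (indicator K x * (1 / norm (x - p) ^ (DIM('a) - 1))))"
      by (intro integrable_mult_right volume_kernel_integrable p)
    have "\<bar>indicator K x * volume_kernel q p x\<bar> \<le> Q * (indicator K x * (1 / norm (x - p) ^ (DIM('a) - 1)))" for x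
    proof (cases "x \<in> K")
      case True
      then show ?thesis using volume_kernel_bound[of q x p Q, OF Q[OF xp[OF True]]] by simp
    qed simp
    then show "AE x in lborel. norm (indicator K x * volume_kernel q p x) \<le> norm (Q * (indicator K x * (1 / norm (x - p) ^ (DIM('a) - 1))))"
      by (intro AE_I2) (metis abs_ge_self order_trans real_norm_def)
  qed measurable
qed

text \<open>Both sides are linear in \<open>q\<close> and bounded by a multiple of the maximum of
  \<open>\<bar>q\<bar>\<close> on \<open>[0, 2 * R]\<close>, an interval that contains all distances
  within \<open>K\<close>. Polynomials are dense there and satisfy the identity by
  \<open>flux_smooth\<close>.\<close>

lemma flux_continuous:
  assumes p: "p \<in> S" and q: "continuous_on UNIV q"
  shows "(\<integral>x. chord_kernel q p x \<partial>surface S)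
    = - (real DIM('a) - 1) * slice_const TYPE('a) * (\<integral>x. indicator K x * volume_kernel q p x \<partial>lborel)"
proof -
  have pK: "p \<in> K" using p S_subset by auto
  obtain R where R: "0 < R" "\<And>x. x \<in> K \<Longrightarrow> norm x \<le> R" by (rule K_bounded) blast
  have xp: "norm (x - p) \<in> {0..2*R}" if "x \<in> K" for x
    using norm_triangle_ineq4[of x p] R(2)[OF that] R(2)[OF pK] by simp
  let ?A = "\<lambda>q. \<integral>x. chord_kernel q p x \<partial>surface S" and ?V = "\<lambda>q. \<integral>x. indicator K x * volume_kernel q p x \<partial>lborel"
  let ?k = "(real DIM('a) - 1) * slice_const TYPE('a)"
  have k0: "0 \<le> ?k" using dim slice_const_pos[OF dim] by simp
  define W1 where "W1 = (\<integral>x. 1 / norm (x - p) ^ (DIM('a) - 2) \<partial>surface S)"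
  define W2 where "W2 = (\<integral>x. indicator K x * (1 / norm (x - p) ^ (DIM('a) - 1)) \<partial>lborel)"
  have W: "0 \<le> W1" "0 \<le> W2" unfolding W1_def W2_def by (auto intro!: integral_nonneg_AE)
  have est: "\<bar>?A q - (- ?k * ?V q)\<bar> \<le> \<epsilon> * (2 * W1 + ?k * W2)" if \<epsilon>: "0 < \<epsilon>" for \<epsilon>
  proof -
    obtain g where g: "real_polynomial_function g" "\<And>r. r \<in> {0..2*R} \<Longrightarrow> \<bar>q r - g r\<bar> < \<epsilon>"
      using Stone_Weierstrass_real_polynomial_function[of "{0..2*R}" q \<epsilon>] continuous_on_subset[OF q] \<epsilon> by auto
    obtain g' where g': "real_polynomial_function g'" "\<And>r. (g has_real_derivative g' r) (at r)"
      using has_real_derivative_polynomial_function[OF g(1)] by blast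
    have cg: "continuous_on UNIV g" "continuous_on UNIV g'"
      using g(1) g'(1) by (auto intro: continuous_at_imp_continuous_on continuous_real_polymonial_function)
    define d where "d r = q r - g r" for r
    have cd: "continuous_on UNIV d" unfolding d_def by (intro continuous_intros q cg)
    have db: "\<bar>d (norm (x - p))\<bar> \<le> \<epsilon>" if "x \<in> K" for x using g(2)[OF xp[OF that]] by (simp add: d_def)
    have "chord_kernel d p x = chord_kernel q p x - chord_kernel g p x" for x
      by (simp add: chord_kernel_def d_def diff_divide_distrib left_diff_distrib)
    then have A: "?A d = ?A q - ?A g"
      using kernel_integrable(1)[OF pK q] kernel_integrable(1)[OF pK cg(1)] by simp
    have "indicator K x * volume_kernel d p x = indicator K x * volume_kernel q p x - indicator K x * volume_kernel g p x" for x
      by (simp add: volume_kernel_def d_def diff_divide_distrib left_diff_distrib right_diff_distrib)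
    then have V: "?V d = ?V q - ?V g"
      using kernel_integrable(2)[OF pK q] kernel_integrable(2)[OF pK cg(1)] by simp
    have "\<bar>?A d\<bar> \<le> (\<integral>x. 2 * \<epsilon> * (1 / norm (x - p) ^ (DIM('a) - 2)) \<partial>surface S)"
    proof (rule abs_integral_le)
      show "AE x in surface S. \<bar>chord_kernel d p x\<bar> \<le> 2 * \<epsilon> * (1 / norm (x - p) ^ (DIM('a) - 2))"
        using AE_surface[OF S_borel]
      proof eventually_elim
        case (elim x)
        then show ?case using S_subset by (intro chord_kernel_bound db) auto
      qed
    qed (intro kernel_integrable pK cd integrable_mult_right surface_kernel_integrable)+
    also have "\<dots> = 2 * \<epsilon> * W1" unfolding W1_def by (rule integral_mult_right_zero)
    finally have bA: "\<bar>?A d\<bar> \<le> 2 * \<epsilon> * W1" .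
    have "\<bar>?V d\<bar> \<le> (\<integral>x. \<epsilon> * (indicator K x * (1 / norm (x - p) ^ (DIM('a) - 1))) \<partial>lborel)"
    proof (rule abs_integral_le)
      show "AE x in lborel. \<bar>indicator K x * volume_kernel d p x\<bar> \<le> \<epsilon> * (indicator K x * (1 / norm (x - p) ^ (DIM('a) - 1)))"
      proof (rule AE_I2)
        fix x show "\<bar>indicator K x * volume_kernel d p x\<bar> \<le> \<epsilon> * (indicator K x * (1 / norm (x - p) ^ (DIM('a) - 1)))"
        proof (cases "x \<in> K")
          case True
          then show ?thesis using volume_kernel_bound[of d x p \<epsilon>, OF db[OF True]] by simp
        qed simp
      qed
    qed (intro kernel_integrable pK cd integrable_mult_right volume_kernel_integrable)+
    also have "\<dots> = \<epsilon> * W2" unfolding W2_def by (rule integral_mult_right_zero)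
    finally have bV: "\<bar>?V d\<bar> \<le> \<epsilon> * W2" .
    have fg: "?A g = - ?k * ?V g" using flux_smooth[OF p g'(2) cg(2)] by (simp only: mult_minus_left)
    have "?A q - (- ?k * ?V q) = ?A d + ?k * ?V d" unfolding A V fg by (simp add: algebra_simps)
    also have "\<bar>\<dots>\<bar> \<le> \<bar>?A d\<bar> + \<bar>?k * ?V d\<bar>" by (rule abs_triangle_ineq)
    also have "\<bar>?k * ?V d\<bar> = ?k * \<bar>?V d\<bar>" by (subst abs_mult, subst abs_of_nonneg[OF k0]) (rule refl)
    also have "\<bar>?A d\<bar> + ?k * \<bar>?V d\<bar> \<le> 2 * \<epsilon> * W1 + ?k * (\<epsilon> * W2)" using bA bV k0 by (intro add_mono mult_left_mono)
    finally show ?thesis by (simp add: algebra_simps)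
  qed
  define T where "T = 2 * W1 + ?k * W2"
  have T0: "0 \<le> T" using W k0 by (simp add: T_def)
  have "\<bar>?A q - (- ?k * ?V q)\<bar> \<le> 0"
  proof (rule field_le_epsilon)
    fix \<epsilon> :: real assume \<epsilon>: "0 < \<epsilon>"
    have "\<bar>?A q - (- ?k * ?V q)\<bar> \<le> \<epsilon> / (T + 1) * T" unfolding T_def[symmetric] using est[of "\<epsilon> / (T + 1)"] \<epsilon> T0 by (simp add: T_def)
    also have "\<dots> \<le> \<epsilon>" using \<epsilon> T0 by (simp add: field_simps)
    finally show "\<bar>?A q - (- ?k * ?V q)\<bar> \<le> 0 + \<epsilon>" by simp
  qed
  then have "?A q = - ?k * ?V q" by simp
  then show ?thesis by (simp only: mult_minus_left)
qed

text \<open>The length is measured in the parameter \<open>t\<close>, hence defined and jointly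
  measurable for all arguments, and 0 for lines that miss \<open>K\<close>. For a unit vector
  \<open>u\<close> it is the Hausdorff length of the chord, see
  \<open>line_chord_length\<close>.\<close>

definition chord_length :: "'a \<Rightarrow> 'a \<Rightarrow> real" where
  "chord_length x u = measure lborel {t. x + t *\<^sub>R u \<in> K}"

lemma chord_length_measurable [measurable]:
  "(\<lambda>(x, u). chord_length x u) \<in> borel_measurable (borel \<Otimes>\<^sub>M borel)"
proof -
  have "chord_length x u = enn2real (\<integral>\<^sup>+t. indicator K (x + t *\<^sub>R u) \<partial>lborel)" for x u
  proof -
    have "{t. x + t *\<^sub>R u \<in> K} \<in> sets borel" by measurable
    then have "emeasure lborel {t. x + t *\<^sub>R u \<in> K} = (\<integral>\<^sup>+t. indicator {t. x + t *\<^sub>R u \<in> K} t \<partial>lborel)" by simp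
    also have "\<dots> = (\<integral>\<^sup>+t. indicator K (x + t *\<^sub>R u) \<partial>lborel)" by (intro nn_integral_cong) (simp add: indicator_def)
    finally show ?thesis by (simp add: chord_length_def measure_def)
  qed
  then show ?thesis by simp
qed

lemma chord_length_measurable2 [measurable]: "(\<lambda>x. chord_length x u) \<in> borel_measurable borel"
  using measurable_Pair2'[of u borel borel] measurable_compose[OF _ chord_length_measurable, of "\<lambda>x. (x, u)" borel] by simp

text \<open>A line that misses \<open>K\<close> is the case \<open>a > b\<close>.\<close>

lemma line_slice_interval:
  assumes u: "norm u = 1"
  obtains a b where "{t. x + t *\<^sub>R u \<in> K} = {a..b}"
proof -
  have "convex {t. x + t *\<^sub>R u \<in> K}"
  proof (rule convexI)
    fix s t v w :: real assume "s \<in> {t. x + t *\<^sub>R u \<in> K}" "t \<in> {t. x + t *\<^sub>R u \<in> K}" "0 \<le> v" "0 \<le> w" "v + w = 1"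
    moreover from this have "v *\<^sub>R (x + s *\<^sub>R u) + w *\<^sub>R (x + t *\<^sub>R u) \<in> K" by (intro convexD[OF convex_K]) auto
    moreover have "v *\<^sub>R (x + s *\<^sub>R u) + w *\<^sub>R (x + t *\<^sub>R u) = (v + w) *\<^sub>R x + (v * s + w * t) *\<^sub>R u" by (simp add: algebra_simps)
    ultimately show "v *\<^sub>R s + w *\<^sub>R t \<in> {t. x + t *\<^sub>R u \<in> K}" by simp
  qed
  then have "connected {t. x + t *\<^sub>R u \<in> K} \<and> compact {t. x + t *\<^sub>R u \<in> K}"
    using line_slice_compact[OF u] by (simp add: convex_connected)
  then show ?thesis using that by (auto simp: connected_compact_interval_1)
qed

lemma chord_length_bounded:
  obtains D where "0 \<le> D" "\<And>x u. norm u = 1 \<Longrightarrow> chord_length x u \<in> {0..D}"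
proof -
  obtain R where R: "0 < R" "\<And>x. x \<in> K \<Longrightarrow> norm x \<le> R" by (rule K_bounded) blast
  show ?thesis
  proof (rule that[of "2 * R"])
    fix x u :: 'a assume u: "norm u = 1"
    obtain a b where ab: "{t. x + t *\<^sub>R u \<in> K} = {a..b}" using line_slice_interval[OF u, of x] by blast
    show "chord_length x u \<in> {0..2*R}"
    proof (cases "a \<le> b")
      case True
      then have "x + a *\<^sub>R u \<in> K" "x + b *\<^sub>R u \<in> K" using ab by auto
      then have "norm ((x + b *\<^sub>R u) - (x + a *\<^sub>R u)) \<le> 2 * R"         using norm_triangle_ineq4[of "x + b *\<^sub>R u" "x + a *\<^sub>R u"] R(2)[of "x + b *\<^sub>R u"] R(2)[of "x + a *\<^sub>R u"] by linarith
      moreover have "(x + b *\<^sub>R u) - (x + a *\<^sub>R u) = (b - a) *\<^sub>R u" by (simp add: algebra_simps)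
      ultimately have "b - a \<le> 2 * R" using True u by simp
      then show ?thesis using True by (simp add: chord_length_def ab)
    qed (use R in \<open>simp add: chord_length_def ab\<close>)
  qed (use R in auto)
qed

lemma chord_length_shift: "chord_length (x + s *\<^sub>R u) u = chord_length x u"
proof -
  have m: "{t. x + t *\<^sub>R u \<in> K} \<in> sets borel" by measurable
  have "emeasure lborel {t. x + t *\<^sub>R u \<in> K} = emeasure (distr lborel borel ((+) s)) {t. x + t *\<^sub>R u \<in> K}"
    by (subst lborel_distr_plus) simp
  also have "\<dots> = emeasure lborel {t. x + (s + t) *\<^sub>R u \<in> K}" using m by (subst emeasure_distr) (auto simp: vimage_def)
  finally show ?thesis by (simp add: chord_length_def measure_def algebra_simps)
qed

text \<open>The Jacobian \<open>t ^ (d - 1)\<close> cancels the singularity and leaves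
  \<open>(n p \<bullet> u) * h' t\<close>. If \<open>n p \<bullet> u < 0\<close>, the slice of the
  whole line starts at \<open>p\<close>, so integrating \<open>h'\<close> gives \<open>h\<close> of
  the full chord length; if \<open>n p \<bullet> u \<ge> 0\<close>, both sides are 0.\<close>

lemma ray_integral:
  assumes p: "p \<in> S" and u: "norm u = 1"
    and h: "\<And>t. (h has_real_derivative h' t) (at t)" "continuous_on UNIV h'" "h 0 = 0"
  shows "(\<integral>t. indicator {0<..} t * t ^ (DIM('a) - 1) * (indicator K (p + t *\<^sub>R u) * volume_kernel h' p (p + t *\<^sub>R u)) \<partial>lborel)
    = - (max 0 (n p \<bullet> (- u)) * h (chord_length p u))"
proof -
  have pK: "p \<in> K" using p S_subset by auto
  have eq: "indicator {0<..} t * t ^ (DIM('a) - 1) * (indicator K (p + t *\<^sub>R u) * volume_kernel h' p (p + t *\<^sub>R u))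
      = (n p \<bullet> u) * (indicator ({0<..} \<inter> {t. p + t *\<^sub>R u \<in> K}) t * h' t)" for t
  proof (cases "0 < t")
    case True
    have "t ^ (DIM('a) - 1) * (t / t ^ DIM('a)) = 1" using kernel_power_simps(2)[OF dim, of t] True by simp
    then have "t ^ (DIM('a) - 1) * volume_kernel h' p (p + t *\<^sub>R u) = (n p \<bullet> u) * h' t"
      using True u by (simp add: volume_kernel_def)
    then show ?thesis using True by (simp add: indicator_def)
  qed simp
  have neg: "t * (n p \<bullet> u) \<le> 0" if "p + t *\<^sub>R u \<in> K" for t
    using normal_le[OF p that] by (simp add: inner_commute)
  have "(\<integral>t. indicator {0<..} t * t ^ (DIM('a) - 1) * (indicator K (p + t *\<^sub>R u) * volume_kernel h' p (p + t *\<^sub>R u)) \<partial>lborel)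
      = (n p \<bullet> u) * (\<integral>t. indicator ({0<..} \<inter> {t. p + t *\<^sub>R u \<in> K}) t * h' t \<partial>lborel)"
    unfolding eq by (rule integral_mult_right_zero)
  also have "\<dots> = - (max 0 (n p \<bullet> (- u)) * h (chord_length p u))"
  proof (cases "n p \<bullet> u < 0")
    case False
    show ?thesis
    proof (cases "n p \<bullet> u = 0")
      case F: False
      have "{0<..} \<inter> {t. p + t *\<^sub>R u \<in> K} = {}"
      proof -
        have "\<not> 0 < t" if "p + t *\<^sub>R u \<in> K" for t using neg[OF that] False F by (auto simp: mult_le_0_iff)
        then show ?thesis by auto
      qed
      then show ?thesis using False by simp
    qed simp
  next
    case True
    obtain a b where ab: "{t. p + t *\<^sub>R u \<in> K} = {a..b}" using line_slice_interval[OF u, of p] by blast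
    have T: "t \<in> {a..b} \<longleftrightarrow> p + t *\<^sub>R u \<in> K" for t unfolding ab[symmetric] by simp
    have "0 \<in> {a..b}" using pK T[of 0] by simp
    \<comment> \<open>For \<open>n p \<bullet> u < 0\<close> the supporting hyperplane at
      \<open>p\<close> excludes negative parameters.\<close>
    moreover have "0 \<le> a"
    proof -
      have "p + a *\<^sub>R u \<in> K" using T[of a] \<open>0 \<in> {a..b}\<close> by auto
      from neg[OF this] show ?thesis using True by (auto simp: mult_le_0_iff)
    qed
    ultimately have a: "a = 0" and b: "0 \<le> b" by auto
    have len: "chord_length p u = b" using b by (simp add: chord_length_def ab a)
    have "(\<integral>t. indicator ({0<..} \<inter> {t. p + t *\<^sub>R u \<in> K}) t * h' t \<partial>lborel) = (\<integral>t. indicator {0..b} t *\<^sub>R h' t \<partial>lborel)"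
    proof (rule integral_cong_AE)
      have [measurable]: "h' \<in> borel_measurable borel" using h(2) by (rule borel_measurable_continuous_onI)
      show "(\<lambda>t. indicator ({0<..} \<inter> {t. p + t *\<^sub>R u \<in> K}) t * h' t) \<in> borel_measurable lborel" unfolding ab by measurable
      show "(\<lambda>t. indicator {0..b} t *\<^sub>R h' t) \<in> borel_measurable lborel" by measurable
      show "AE t in lborel. indicator ({0<..} \<inter> {t. p + t *\<^sub>R u \<in> K}) t * h' t = indicator {0..b} t *\<^sub>R h' t"
        using AE_lborel_singleton[of "0::real"] by eventually_elim (auto simp: ab a indicator_def)
    qed
    also have "\<dots> = h b - h 0"
      using h b by (intro integral_FTC_Icc) (auto simp: has_real_derivative_iff_has_vector_derivative has_vector_derivative_at_within intro: continuous_on_subset)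
    finally show ?thesis using True h(3) len by (simp add: max_def)
  qed
  finally show ?thesis .
qed

end

section \<open>Chord lengths\<close>

text \<open>The boundary integral in the theorem is taken over measures on the sets themselves; this
  transports them to \<open>surface\<close> on the whole space.\<close>

lemma distr_hausdorff_on:
  fixes T :: "'a::euclidean_space set"
  assumes T: "T \<in> sets borel"
  shows "distr (hausdorff_on (real DIM('a) - 1) T) borel (\<lambda>x. x) = surface T"
    and "(\<lambda>x. x) \<in> measurable (hausdorff_on (real DIM('a) - 1) T) borel"
    and "space (hausdorff_on (real DIM('a) - 1) T) = T"
proof -
  let ?M = "hausdorff_on (real DIM('a) - 1) T"
  show m: "(\<lambda>x. x) \<in> measurable ?M borel"
    unfolding hausdorff_on_eq_restrict[OF T] by (intro measurable_restrict_space1) simp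
  show sp: "space ?M = T" unfolding hausdorff_on_eq_restrict[OF T] by (simp add: space_restrict_space)
  show "distr ?M borel (\<lambda>x. x) = surface T"
  proof (rule measure_eqI)
    fix A assume "A \<in> sets (distr ?M borel (\<lambda>x. x))"
    then have A: "A \<in> sets borel" by simp
    have "emeasure (distr ?M borel (\<lambda>x. x)) A = emeasure ?M (A \<inter> T)" using m A sp by (simp add: emeasure_distr)
    also have "\<dots> = emeasure (hausdorff_measure (real DIM('a) - 1)) (A \<inter> T)"
      unfolding hausdorff_on_eq_restrict[OF T] using T by (intro emeasure_restrict_space) auto
    also have "\<dots> = emeasure (surface T) A" using T A by (simp add: emeasure_surface emeasure_hausdorff_measure Int_commute)
    finally show "emeasure (distr ?M borel (\<lambda>x. x)) A = emeasure (surface T) A" .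
  qed simp
qed

context smooth_body
begin

text \<open>Projection along \<open>- u\<close> parametrizes the points where lines in direction
  \<open>u\<close> enter \<open>K\<close>. The chord length is constant along such a line, and
  \<open>h 0 = 0\<close> removes the lines outside the shadow.\<close>

lemma directional_chord_integral:
  assumes u: "norm u = 1" and h: "h \<in> borel_measurable borel" "h 0 = (0::real)"
  shows "(\<integral>x. max 0 (n x \<bullet> (- u)) * h (chord_length x u) \<partial>surface S) = (\<integral>y. h (chord_length y u) \<partial>surface (hplane u))"
proof -
  have u': "norm (- u) = 1" using u by simp
  note [measurable] = h(1) top_point_measurable[OF u']
  have "(\<integral>x. max 0 (n x \<bullet> (- u)) * h (chord_length x u) \<partial>surface S)
      = (\<integral>y. indicator (shadow (- u)) y * h (chord_length (top_point (- u) y) u) \<partial>surface (hplane (- u)))"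
    by (rule projection_real(1)[OF u', where f="\<lambda>x. h (chord_length x u)"]) measurable
  also have "\<dots> = (\<integral>y. indicator (shadow u) y * h (chord_length y u) \<partial>surface (hplane u))"
  proof -
    have "chord_length (top_point (- u) y) u = chord_length y u" for y
      using chord_length_shift[of y "- height (- u) y" u] by (simp add: top_point_def)
    moreover have "hplane (- u) = hplane u" by simp
    ultimately show ?thesis by (simp only: shadow_uminus)
  qed
  also have "\<dots> = (\<integral>y. h (chord_length y u) \<partial>surface (hplane u))"
  proof (rule integral_cong_AE)
    show "AE y in surface (hplane u). indicator (shadow u) y * h (chord_length y u) = h (chord_length y u)"
      using AE_shadow[OF u]
    proof eventually_elim
      case (elim y)
      show ?case
      proof (cases "y \<in> shadow u")
        case False
        then have "{t. y + t *\<^sub>R u \<in> K} = {}" using elim by auto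
        then show ?thesis using h(2) by (simp add: chord_length_def)
      qed simp
    qed
  qed measurable
  finally show ?thesis .
qed

lemma line_chord_length:
  assumes u: "norm u = 1" and h: "h 0 = (0::real)"
  shows "(if line_through y u \<inter> K \<noteq> {} then h (enn2real (hausdorff_outer 1 (line_through y u \<inter> K))) else 0) = h (chord_length y u)"
proof -
  obtain a b where ab: "{t. y + t *\<^sub>R u \<in> K} = {a..b}" using line_slice_interval[OF u, of y] by blast
  have T: "t \<in> {a..b} \<longleftrightarrow> y + t *\<^sub>R u \<in> K" for t unfolding ab[symmetric] by simp
  have img: "line_through y u \<inter> K = (\<lambda>t. y + t *\<^sub>R u) ` {a..b}"
  proof (intro subset_antisym subsetI)
    fix x assume "x \<in> line_through y u \<inter> K"
    then obtain t where "x = y + t *\<^sub>R u" "y + t *\<^sub>R u \<in> K" by (auto simp: line_through_def)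
    then show "x \<in> (\<lambda>t. y + t *\<^sub>R u) ` {a..b}" using T by blast
  next
    fix x assume "x \<in> (\<lambda>t. y + t *\<^sub>R u) ` {a..b}"
    then obtain t where t: "t \<in> {a..b}" "x = y + t *\<^sub>R u" by blast
    then show "x \<in> line_through y u \<inter> K" using T[of t] unfolding line_through_def by blast
  qed
  show ?thesis
  proof (cases "a \<le> b")
    case True
    have "hausdorff_outer 1 ((\<lambda>t. y + t *\<^sub>R u) ` {a..b}) = hausdorff_outer 1 {a..b}"
    proof (rule hausdorff_outer_isometry)
      fix s t :: real
      have "(y + s *\<^sub>R u) - (y + t *\<^sub>R u) = (s - t) *\<^sub>R u" by (simp add: algebra_simps)
      then show "dist (y + s *\<^sub>R u) (y + t *\<^sub>R u) = dist s t" unfolding dist_norm using u by simp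
    qed simp
    also have "\<dots> = ennreal (b - a)" by (rule hausdorff_outer_1_interval[OF True])
    finally show ?thesis using True by (simp add: img chord_length_def ab)
  qed (use h in \<open>simp add: img chord_length_def ab\<close>)
qed

text \<open>The inner integral is bounded uniformly in the first point by
  \<open>surface_kernel_bound\<close>, and the outer measure is finite.\<close>

lemma chord_kernel_pair_integrable:
  assumes q: "continuous_on UNIV q"
  shows "integrable (surface S \<Otimes>\<^sub>M surface S) (\<lambda>(x, y). chord_kernel q x y)"
proof (rule integrableI_bounded)
  interpret S: finite_measure "surface S" by (rule finite_surface)
  have [measurable]: "q \<in> borel_measurable borel" using q by (rule borel_measurable_continuous_onI)
  show m: "(\<lambda>(x, y). chord_kernel q x y) \<in> borel_measurable (surface S \<Otimes>\<^sub>M surface S)" by measurable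
  obtain R where R: "0 < R" "\<And>x. x \<in> K \<Longrightarrow> norm x \<le> R" by (rule K_bounded) blast
  have "compact (q ` {0..2*R})" using q by (intro compact_continuous_image continuous_on_subset[OF q]) auto
  then obtain Q where Q: "\<And>r. r \<in> {0..2*R} \<Longrightarrow> \<bar>q r\<bar> \<le> Q" using compact_imp_bounded by (force simp: bounded_iff)
  have Q0: "0 \<le> Q" using Q[of 0] R(1) by force
  obtain C where C: "0 \<le> C" "\<And>p. p \<in> K \<Longrightarrow> (\<integral>\<^sup>+x. ennreal (1 / norm (x - p) ^ (DIM('a) - 2)) \<partial>surface S) \<le> ennreal C"
    using surface_kernel_bound by blast
  have "(\<integral>\<^sup>+p. ennreal (norm (case p of (x, y) \<Rightarrow> chord_kernel q x y)) \<partial>(surface S \<Otimes>\<^sub>M surface S))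
      = (\<integral>\<^sup>+x. \<integral>\<^sup>+y. ennreal \<bar>chord_kernel q x y\<bar> \<partial>surface S \<partial>surface S)"
    by (subst S.nn_integral_fst[symmetric]) auto
  also have "\<dots> \<le> (\<integral>\<^sup>+x. ennreal (2 * Q) * ennreal C \<partial>surface S)"
  proof (rule nn_integral_mono_AE)
    show "AE x in surface S. (\<integral>\<^sup>+y. ennreal \<bar>chord_kernel q x y\<bar> \<partial>surface S) \<le> ennreal (2 * Q) * ennreal C"
      using AE_surface[OF S_borel]
    proof eventually_elim
      case (elim x)
      then have xK: "x \<in> K" using S_subset by auto
      have "(\<integral>\<^sup>+y. ennreal \<bar>chord_kernel q x y\<bar> \<partial>surface S) \<le> (\<integral>\<^sup>+y. ennreal (2 * Q) * ennreal (1 / norm (y - x) ^ (DIM('a) - 2)) \<partial>surface S)"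
      proof (rule nn_integral_mono_AE)
        show "AE y in surface S. ennreal \<bar>chord_kernel q x y\<bar> \<le> ennreal (2 * Q) * ennreal (1 / norm (y - x) ^ (DIM('a) - 2))"
          using AE_surface[OF S_borel]
        proof eventually_elim
          case (elim y)
          then have yK: "y \<in> K" using S_subset by auto
          have "norm (y - x) \<in> {0..2*R}" using norm_triangle_ineq4[of y x] R(2)[OF xK] R(2)[OF yK] by simp
          then have "\<bar>chord_kernel q x y\<bar> \<le> 2 * Q * (1 / norm (y - x) ^ (DIM('a) - 2))"
            by (intro chord_kernel_bound Q)
          then show ?case using Q0 by (subst ennreal_mult[symmetric]) (auto intro!: ennreal_leI)
        qed
      qed
      also have "\<dots> = ennreal (2 * Q) * (\<integral>\<^sup>+y. ennreal (1 / norm (y - x) ^ (DIM('a) - 2)) \<partial>surface S)"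
        by (rule nn_integral_cmult) measurable
      also have "\<dots> \<le> ennreal (2 * Q) * ennreal C" by (intro mult_left_mono C(2) xK) auto
      finally show ?case .
    qed
  qed
  also have "\<dots> = ennreal (2 * Q) * ennreal C * emeasure (surface S) UNIV" by simp
  also have "\<dots> < \<infinity>"
  proof -
    have "emeasure (surface S) UNIV < top" unfolding less_top[symmetric] by (rule S.emeasure_finite[unfolded infinity_ennreal_def])
    then show ?thesis by (simp add: ennreal_mult_less_top)
  qed
  finally show "(\<integral>\<^sup>+p. ennreal (norm (case p of (x, y) \<Rightarrow> chord_kernel q x y)) \<partial>(surface S \<Otimes>\<^sub>M surface S)) < \<infinity>" .
qed

text \<open>This is \<open>flux_continuous\<close> in polar coordinates around \<open>p\<close>. The
  sign in its factor \<open>- (d - 1)\<close> cancels the sign in \<open>ray_integral\<close>, and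
  \<open>slice_const\<close> is consumed by \<open>integral_polar\<close>.\<close>

lemma boundary_chord_integral:
  assumes p: "p \<in> S" and h: "\<And>t. (h has_real_derivative h' t) (at t)" "continuous_on UNIV h'" "h 0 = 0"
  shows "(\<integral>x. chord_kernel h' p x \<partial>surface S)
    = (real DIM('a) - 1) * (\<integral>u. indicator (sphere 0 1) u * (max 0 (n p \<bullet> (- u)) * h (chord_length p u)) \<partial>surface (sphere 0 1))"
proof -
  have pK: "p \<in> K" using p S_subset by auto
  have [measurable]: "h' \<in> borel_measurable borel" using h(2) by (rule borel_measurable_continuous_onI)
  have "continuous_on UNIV h" using h(1) by (meson DERIV_isCont continuous_at_imp_continuous_on)
  then have [measurable]: "h \<in> borel_measurable borel" by (rule borel_measurable_continuous_onI)
  define G where "G x = indicator K x * volume_kernel h' p x" for x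
  have [measurable]: "G \<in> borel_measurable borel" unfolding G_def by measurable
  have G: "integrable lborel G" unfolding G_def by (rule kernel_integrable(2)[OF pK h(2)])
  then have "integrable (distr lborel borel ((+) p)) G" by (simp add: lborel_distr_plus)
  then have F: "integrable lborel (\<lambda>z. G (p + z))" by (subst (asm) integrable_distr_eq) auto
  have "(\<integral>x. G x \<partial>lborel) = (\<integral>x. G x \<partial>distr lborel borel ((+) p))" by (simp add: lborel_distr_plus)
  also have "\<dots> = (\<integral>z. G (p + z) \<partial>lborel)" by (subst integral_distr) auto
  finally have "slice_const TYPE('a) * (\<integral>x. G x \<partial>lborel)
      = (\<integral>u. \<integral>t. indicator {0<..} t * t ^ (DIM('a) - 1) * G (p + t *\<^sub>R u) \<partial>lborel \<partial>surface (sphere 0 1))"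
    using integral_polar[OF dim F] by simp
  also have "\<dots> = (\<integral>u. - (indicator (sphere 0 1) u * (max 0 (n p \<bullet> (- u)) * h (chord_length p u))) \<partial>surface (sphere 0 1))"
  proof (rule integral_cong_AE)
    have [measurable]: "(\<lambda>u. chord_length p u) \<in> borel_measurable borel"
      using measurable_compose[OF _ chord_length_measurable, of "\<lambda>u. (p, u)" borel] by simp
    show "AE u in surface (sphere 0 1). (\<integral>t. indicator {0<..} t * t ^ (DIM('a) - 1) * G (p + t *\<^sub>R u) \<partial>lborel)
        = - (indicator (sphere 0 1) u * (max 0 (n p \<bullet> (- u)) * h (chord_length p u)))"
      using AE_surface[of "sphere (0::'a) 1", OF borel_closed[OF closed_sphere]]
    proof eventually_elim
      case (elim u)
      then show ?case unfolding G_def using ray_integral[OF p _ h, of u] by simp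
    qed
    have [measurable]: "sphere (0::'a) 1 \<in> sets borel" by simp
    show "(\<lambda>u. - (indicator (sphere 0 1) u * (max 0 (n p \<bullet> (- u)) * h (chord_length p u)))) \<in> borel_measurable (surface (sphere 0 1))"
      by measurable
  qed measurable
  also have "\<dots> = - (\<integral>u. indicator (sphere 0 1) u * (max 0 (n p \<bullet> (- u)) * h (chord_length p u)) \<partial>surface (sphere 0 1))"
    by (rule integral_minus)
  finally have "slice_const TYPE('a) * (\<integral>x. G x \<partial>lborel)
      = - (\<integral>u. indicator (sphere 0 1) u * (max 0 (n p \<bullet> (- u)) * h (chord_length p u)) \<partial>surface (sphere 0 1))" .
  moreover have "(\<integral>x. chord_kernel h' p x \<partial>surface S) = - (real DIM('a) - 1) * (slice_const TYPE('a) * (\<integral>x. G x \<partial>lborel))"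
    using flux_continuous[OF p h(2)] unfolding G_def by (simp only: mult.assoc)
  ultimately show ?thesis by (simp only: minus_mult_minus)
qed

text \<open>The exchange of \<open>x\<close> and \<open>u\<close> concerns a bounded integrand and
  finite measures, since chord lengths stay in a compact interval. The indicator of the sphere in
  \<open>\<Psi>\<close> extends the bound to all \<open>u\<close>.\<close>

lemma double_chord_integral:
  assumes h: "\<And>t. (h has_real_derivative h' t) (at t)" "continuous_on UNIV h'" "h 0 = 0"
  defines "\<Psi> \<equiv> \<lambda>x u. indicator (sphere 0 1) u * (max 0 (n x \<bullet> (- u)) * h (chord_length x u))"
  shows "(\<lambda>u. \<integral>x. \<Psi> x u \<partial>surface S) \<in> borel_measurable borel"
    and "(\<integral>(x, y). chord_kernel h' x y \<partial>(surface S \<Otimes>\<^sub>M surface S))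
      = (real DIM('a) - 1) * (\<integral>u. \<integral>x. \<Psi> x u \<partial>surface S \<partial>surface (sphere 0 1))"
proof -
  interpret S: finite_measure "surface S" by (rule finite_surface)
  interpret SS: pair_sigma_finite "surface S" "surface S" ..
  interpret B: smooth_body "cball 0 1" "\<lambda>x::'a. if x \<in> sphere 0 1 then x else 0"
    by (rule smooth_body_ball[OF dim])
  interpret U: finite_measure "surface (sphere (0::'a) 1)" using B.finite_surface by simp
  interpret SU: pair_sigma_finite "surface S" "surface (sphere (0::'a) 1)" ..
  have [measurable]: "h' \<in> borel_measurable borel" using h(2) by (rule borel_measurable_continuous_onI)
  have ch: "continuous_on UNIV h" using h(1) by (meson DERIV_isCont continuous_at_imp_continuous_on)
  then have [measurable]: "h \<in> borel_measurable borel" by (rule borel_measurable_continuous_onI)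
  have [measurable]: "sphere (0::'a) 1 \<in> sets borel" by simp
  have \<Psi> [measurable]: "(\<lambda>(x, u). \<Psi> x u) \<in> borel_measurable (borel \<Otimes>\<^sub>M borel)"
    unfolding \<Psi>_def using chord_length_measurable by (simp add: split_beta')
  show "(\<lambda>u. \<integral>x. \<Psi> x u \<partial>surface S) \<in> borel_measurable borel"
  proof -
    have "(\<lambda>(u, x). \<Psi> x u) \<in> borel_measurable (borel \<Otimes>\<^sub>M surface S)"
      using measurable_compose[OF measurable_pair_swap' \<Psi>] by (simp add: split_beta' cong: measurable_cong_sets)
    then show ?thesis by (rule S.borel_measurable_lebesgue_integral)
  qed
  obtain D where D: "0 \<le> D" "\<And>x u. norm u = 1 \<Longrightarrow> chord_length x u \<in> {0..D}" by (rule chord_length_bounded) blast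
  have "compact (h ` {0..D})" by (intro compact_continuous_image continuous_on_subset[OF ch]) auto
  then obtain Q where Q: "\<And>r. r \<in> {0..D} \<Longrightarrow> \<bar>h r\<bar> \<le> Q" using compact_imp_bounded by (force simp: bounded_iff)
  have Q0: "0 \<le> Q" using Q[of 0] D(1) by force
  have bnd: "\<bar>\<Psi> x u\<bar> \<le> Q" for x u
  proof (cases "norm u = 1")
    case True
    have "\<bar>n x \<bullet> u\<bar> \<le> 1" using Cauchy_Schwarz_ineq2[of "n x" u] norm_normal_le[of x] True by simp
    then have "max 0 (n x \<bullet> (- u)) \<le> 1" by (auto simp: abs_le_iff)
    then have "\<bar>max 0 (n x \<bullet> (- u))\<bar> * \<bar>h (chord_length x u)\<bar> \<le> 1 * Q"
      by (intro mult_mono Q D True) auto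
    then show ?thesis using True by (simp add: \<Psi>_def abs_mult)
  qed (use Q0 in \<open>simp add: \<Psi>_def\<close>)
  have "finite_measure (surface S \<Otimes>\<^sub>M surface (sphere (0::'a) 1))"
    by (rule finite_measure_pair_measure[OF U.finite_measure_axioms S.finite_measure_axioms])
  then have int\<Psi>: "integrable (surface S \<Otimes>\<^sub>M surface (sphere 0 1)) (\<lambda>(x, u). \<Psi> x u)"
    by (rule finite_measure.integrable_const_bound[where B=Q]) (use bnd in \<open>auto simp: split_beta'\<close>)
  have "(\<integral>(x, y). chord_kernel h' x y \<partial>(surface S \<Otimes>\<^sub>M surface S)) = (\<integral>x. \<integral>y. chord_kernel h' x y \<partial>surface S \<partial>surface S)"
    using SS.integral_fst'[OF chord_kernel_pair_integrable[OF h(2)]] by simp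
  also have "\<dots> = (\<integral>x. (real DIM('a) - 1) * (\<integral>u. \<Psi> x u \<partial>surface (sphere 0 1)) \<partial>surface S)"
  proof (rule integral_cong_AE)
    show "(\<lambda>x. \<integral>y. chord_kernel h' x y \<partial>surface S) \<in> borel_measurable (surface S)" by measurable
    show "(\<lambda>x. (real DIM('a) - 1) * (\<integral>u. \<Psi> x u \<partial>surface (sphere 0 1))) \<in> borel_measurable (surface S)" by measurable
    show "AE x in surface S. (\<integral>y. chord_kernel h' x y \<partial>surface S) = (real DIM('a) - 1) * (\<integral>u. \<Psi> x u \<partial>surface (sphere 0 1))"
      using AE_surface[OF S_borel]
    proof eventually_elim
      case (elim x)
      then show ?case unfolding \<Psi>_def by (rule boundary_chord_integral[OF _ h])
    qed
  qed
  also have "\<dots> = (real DIM('a) - 1) * (\<integral>x. \<integral>u. \<Psi> x u \<partial>surface (sphere 0 1) \<partial>surface S)"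
    by (rule integral_mult_right_zero)
  also have "(\<integral>x. \<integral>u. \<Psi> x u \<partial>surface (sphere 0 1) \<partial>surface S) = (\<integral>u. \<integral>x. \<Psi> x u \<partial>surface S \<partial>surface (sphere 0 1))"
    by (rule SU.Fubini_integral[OF int\<Psi>, symmetric])
  finally show "(\<integral>(x, y). chord_kernel h' x y \<partial>(surface S \<Otimes>\<^sub>M surface S))
      = (real DIM('a) - 1) * (\<integral>u. \<integral>x. \<Psi> x u \<partial>surface S \<partial>surface (sphere 0 1))" .
qed

end

section \<open>The product of the three cosines\<close>

lemma cos_vangle: "cos (vangle u v) = (u \<bullet> v) / (norm u * norm v)"
proof -
  \<comment> \<open>If one of the vectors is 0, the quotient is 0 by convention and the angle is a
    right one.\<close>
  have "\<bar>(u \<bullet> v) / (norm u * norm v)\<bar> \<le> 1"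
    using Cauchy_Schwarz_ineq2[of u v] by (cases "norm u * norm v = 0") (auto simp: abs_mult divide_le_eq_1)
  then show ?thesis unfolding vangle_def by (intro cos_arccos_abs)
qed

text \<open>The first two cosines are the lengths of the projections of the normals onto the
  orthogonal complement of \<open>u\<close>. They cancel the denominator of the third cosine and
  leave the inner product of these projections, also when one projection is 0.\<close>

lemma angle_product:
  fixes n1 n2 u :: "'a::euclidean_space"
  assumes "norm n1 = 1" "norm n2 = 1" "norm u = 1"
  shows "cos (vangle u (proj_perp n1 u)) * cos (vangle u (proj_perp n2 u)) * cos (vangle (proj_perp u n1) (proj_perp u n2))
    = n1 \<bullet> n2 - (n1 \<bullet> u) * (n2 \<bullet> u)"
proof -
  have sq: "n1 \<bullet> n1 = 1" "n2 \<bullet> n2 = 1" "u \<bullet> u = 1" using assms by (auto simp: norm_eq_1)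
  have np: "(norm (proj_perp a b))\<^sup>2 = 1 - (b \<bullet> a)\<^sup>2" if "a \<bullet> a = 1" "b \<bullet> b = 1" for a b :: 'a
    using that unfolding power2_norm_eq_inner proj_perp_def
    by (simp add: inner_diff_left inner_diff_right inner_commute[of a b] power2_eq_square)
  have ca: "cos (vangle u (proj_perp a u)) = norm (proj_perp u a)" if a: "a \<bullet> a = 1" for a
  proof -
    have "norm (proj_perp a u) = norm (proj_perp u a)"
      using np[OF a sq(3)] np[OF sq(3) a] by (simp add: inner_commute power2_eq_iff_nonneg[symmetric])
    moreover have "u \<bullet> proj_perp a u = (norm (proj_perp a u))\<^sup>2"
      using np[OF a sq(3)] sq by (simp add: proj_perp_def inner_diff_right power2_eq_square)
    ultimately show ?thesis using assms(3) unfolding cos_vangle by (simp add: power2_eq_square)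
  qed
  have "proj_perp u n1 \<bullet> proj_perp u n2 = n1 \<bullet> n2 - (n1 \<bullet> u) * (n2 \<bullet> u)"
    by (simp add: proj_perp_def inner_diff_left inner_diff_right sq inner_commute[of u n2])
  moreover have "norm a * norm b * ((a \<bullet> b) / (norm a * norm b)) = a \<bullet> b" for a b :: 'a by auto
  ultimately show ?thesis using ca[OF sq(1)] ca[OF sq(2)] cos_vangle by metis
qed

section \<open>The main theorem\<close>

text \<open>Every direction \<open>v\<close> with \<open>G \<bullet> v < 0\<close> leads from
  \<open>x\<close> into \<open>K\<close>, so a normal \<open>u\<close> has
  \<open>v \<bullet> u \<le> 0\<close> on this whole open half-space. Hence \<open>u\<close> is a
  nonnegative multiple of the gradient \<open>G\<close>.\<close>

lemma C1_boundary_normal_unique: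
  fixes K :: "'a::euclidean_space set"
  assumes K: "closed K" and C1: "C1_boundary K" and x: "x \<in> frontier K"
  obtains v where "\<And>u. norm u = 1 \<Longrightarrow> (\<And>y. y \<in> K \<Longrightarrow> (y - x) \<bullet> u \<le> 0) \<Longrightarrow> u = v"
proof -
  obtain U g g' where *: "open U \<and> x \<in> U \<and> (\<forall>y\<in>U. (g has_derivative (\<lambda>v. g' y \<bullet> v)) (at y)) \<and>
      continuous_on U g' \<and> (\<forall>y\<in>U. g' y \<noteq> 0) \<and> K \<inter> U = {y\<in>U. g y \<le> (0::real)}"
    using bspec[OF C1[unfolded C1_boundary_def] x] by (elim exE) (rule that)
  have U: "open U" "x \<in> U" and g: "\<forall>y\<in>U. (g has_derivative (\<lambda>v. g' y \<bullet> v)) (at y)"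
    and g0: "\<forall>y\<in>U. g' y \<noteq> 0" and KU: "K \<inter> U = {y\<in>U. g y \<le> 0}"
    using * by blast+
  define G where "G = g' x"
  have G0: "G \<noteq> 0" using g0 U by (auto simp: G_def)
  have xK: "x \<in> K" using x K by (meson frontier_subset_closed subsetD)
  have gx: "g x \<le> 0" using xK U KU by blast
  have der: "((\<lambda>t. g (x + t *\<^sub>R v)) has_real_derivative (G \<bullet> v)) (at 0)" for v
  proof -
    have "(g has_derivative (\<lambda>v. G \<bullet> v)) (at (x + 0 *\<^sub>R v))" using g U by (simp add: G_def)
    then have "((\<lambda>t. g (x + t *\<^sub>R v)) has_derivative (\<lambda>t. G \<bullet> (t *\<^sub>R v))) (at 0)"
      by (rule has_derivative_compose[rotated]) (auto intro!: derivative_eq_intros)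
    moreover have "(\<lambda>t. G \<bullet> (t *\<^sub>R v)) = (*) (G \<bullet> v)" by (rule ext) simp
    ultimately show ?thesis by (simp only: has_field_derivative_def)
  qed
  show ?thesis
  proof (rule that[of "G /\<^sub>R norm G"])
    fix u assume u: "norm u = 1" and le: "\<And>y. y \<in> K \<Longrightarrow> (y - x) \<bullet> u \<le> 0"
    have half: "v \<bullet> u \<le> 0" if v: "G \<bullet> v < 0" for v
    proof -
      obtain d where d: "d > 0" "\<And>t. 0 < t \<Longrightarrow> t < d \<Longrightarrow> g (x + t *\<^sub>R v) < g x"
        using DERIV_neg_dec_right[OF der v] by auto
      have "((\<lambda>t. x + t *\<^sub>R v) \<longlongrightarrow> x + 0 *\<^sub>R v) (at_right 0)" by (intro tendsto_intros)
      then have "\<forall>\<^sub>F t in at_right 0. x + t *\<^sub>R v \<in> U" using U by (auto dest: topological_tendstoD)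
      moreover have "\<forall>\<^sub>F t in at_right (0::real). 0 < t \<and> t < d" using d(1) by (auto intro!: eventually_at_rightI[of 0 d])
      ultimately have "\<forall>\<^sub>F t in at_right (0::real). x + t *\<^sub>R v \<in> U \<and> 0 < t \<and> t < d" by eventually_elim auto
      then obtain t where t: "x + t *\<^sub>R v \<in> U" "0 < t" "t < d"
        using eventually_happens[of _ "at_right (0::real)"] by (auto simp: trivial_limit_at_right_real)
      then have "x + t *\<^sub>R v \<in> K" using d(2)[of t] gx KU by force
      from le[OF this] show ?thesis using t by (simp add: mult_le_0_iff)
    qed
    \<comment> \<open>The part of \<open>u\<close> orthogonal to \<open>G\<close>. Adding a small
      multiple of \<open>- G\<close> makes it admissible for \<open>half\<close>, and in the limit
      \<open>w \<bullet> w \<le> 0\<close>.\<close>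
    define w where "w = u - ((u \<bullet> G) / (G \<bullet> G)) *\<^sub>R G"
    have GG: "0 < G \<bullet> G" using G0 by simp
    have wG: "w \<bullet> G = 0" using GG by (simp add: w_def inner_diff_left)
    have "w \<bullet> u \<le> 0"
    proof (rule field_le_epsilon)
      fix e :: real assume e: "0 < e"
      define k where "k = e / (\<bar>G \<bullet> u\<bar> + 1)"
      have k: "0 < k" using e by (simp add: k_def)
      have "G \<bullet> (w - k *\<^sub>R G) < 0" using k GG wG by (simp add: inner_diff_right inner_commute[of G w])
      then have "w \<bullet> u \<le> k * (G \<bullet> u)" using half by (force simp: inner_diff_left)
      also have "\<dots> \<le> k * (\<bar>G \<bullet> u\<bar> + 1)" using k by (intro mult_left_mono) auto
      also have "\<dots> = e" by (simp add: k_def)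
      finally show "w \<bullet> u \<le> 0 + e" by simp
    qed
    moreover have "w \<bullet> u = w \<bullet> w" using wG by (simp add: w_def inner_diff_right)
    ultimately have "w = 0" by (metis inner_ge_zero inner_eq_zero_iff order_antisym)
    then have uG: "u = ((u \<bullet> G) / (G \<bullet> G)) *\<^sub>R G" by (simp add: w_def)
    define l where "l = (u \<bullet> G) / (G \<bullet> G)"
    have "- G \<bullet> u \<le> 0" using GG by (intro half) simp
    then have l0: "0 \<le> l" using GG by (simp add: l_def inner_commute)
    have "1 = l * norm G" using u uG l0 by (metis l_def abs_of_nonneg norm_scaleR)
    then have "l = inverse (norm G)" using G0 by (simp add: field_simps)
    then show "u = G /\<^sub>R norm G" using uG by (simp add: l_def)
  qed
qed

text \<open>A supporting hyperplane gives existence of a normal and the smooth boundary its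
  uniqueness; together they make the \<open>THE\<close> in \<open>outer_normal\<close>
  meaningful.\<close>

lemma C1_convex_body_smooth:
  fixes K :: "'a::euclidean_space set"
  assumes dim: "DIM('a) \<ge> 2" and K: "convex_body K" and C1: "C1_boundary K"
  shows "smooth_body K (\<lambda>x. if x \<in> frontier K then outer_normal K x else 0)"
proof -
  have cK: "compact K" "convex K" "interior K \<noteq> {}" and cl: "closed K"
    using K by (auto simp: convex_body_def compact_imp_closed)
  have ex: "\<exists>!u. norm u = 1 \<and> (\<forall>y\<in>K. (y - x) \<bullet> u \<le> 0)" if x: "x \<in> frontier K" for x
  proof -
    obtain v where v: "\<And>u. norm u = 1 \<Longrightarrow> (\<And>y. y \<in> K \<Longrightarrow> (y - x) \<bullet> u \<le> 0) \<Longrightarrow> u = v"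
      using C1_boundary_normal_unique[OF cl C1 x] by blast
    have "x \<in> closure K" "x \<notin> rel_interior K"
      using x cK(3) by (auto simp: frontier_def rel_interior_nonempty_interior)
    then obtain a where a: "a \<noteq> 0" "\<And>y. y \<in> closure K \<Longrightarrow> a \<bullet> x \<le> a \<bullet> y"
      using supporting_hyperplane_relative_frontier[OF cK(2), of x] by metis
    define u where "u = - (a /\<^sub>R norm a)"
    have "norm u = 1" using a(1) by (simp add: u_def)
    moreover have "(y - x) \<bullet> u \<le> 0" if "y \<in> K" for y
    proof -
      have "a \<bullet> x \<le> a \<bullet> y" using a(2) that closure_subset by auto
      then show ?thesis using a(1) by (simp add: u_def inner_diff_right inner_commute[of _ a])
    qed
    ultimately show ?thesis using v by (metis (no_types, lifting))
  qed
  have on: "norm (outer_normal K x) = 1 \<and> (\<forall>y\<in>K. (y - x) \<bullet> outer_normal K x \<le> 0)" if "x \<in> frontier K" for x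
    unfolding outer_normal_def by (rule theI'[OF ex[OF that]])
  show ?thesis
  proof
    fix x u assume x: "x \<in> frontier K" and u: "norm u = 1" "\<And>y. y \<in> K \<Longrightarrow> (y - x) \<bullet> u \<le> 0"
    then have "u = outer_normal K x" using ex[OF x] on[OF x] by blast
    then show "u = (if x \<in> frontier K then outer_normal K x else 0)" using x by simp
  qed (use dim cK on in auto)
qed

theorem theorem1:
  fixes K :: "'a::euclidean_space set" and h :: "real \<Rightarrow> real" and h' :: "real \<Rightarrow> real"
  assumes "DIM('a) \<ge> 2"
    and "convex_body K" and "C1_boundary K"
    and "\<And>t. (h has_real_derivative h' t) (at t)" and "continuous_on UNIV h'"
    and "h 0 = 0"
  shows "lines_integral (\<lambda>G. if G \<inter> K \<noteq> {} then h (enn2real (hausdorff_outer 1 (G \<inter> K))) else 0)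
       = 1 / ((real DIM('a) - 1) * omega DIM('a)) *
         (\<integral>p. (case p of (x1, x2) \<Rightarrow>
              h' (dist x1 x2) / dist x1 x2 ^ (DIM('a) - 2)
              * cos (alpha_angle K x1 x2 x1) * cos (alpha_angle K x1 x2 x2)
              * cos (phi0_angle K x1 x2))
           \<partial>(hausdorff_on (real DIM('a) - 1) (frontier K)
              \<Otimes>\<^sub>M hausdorff_on (real DIM('a) - 1) (frontier K)))"
proof -
  define n where "n = (\<lambda>x. if x \<in> frontier K then outer_normal K x else 0)"
  interpret smooth_body K n
    unfolding n_def by (rule C1_convex_body_smooth[OF assms(1-3)])
  note h = assms(4,5,6)
  let ?s = "real DIM('a) - 1"
  let ?M = "hausdorff_on ?s (frontier K)"
  \<comment> \<open>Both sides reduce to the double integral \<open>I\<close> of this function, the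
    boundary integral with the additional factor \<open>d - 1\<close>.\<close>
  define \<Psi> where "\<Psi> = (\<lambda>x u. indicator (sphere 0 1) u * (max 0 (n x \<bullet> (- u)) * h (chord_length x u)))"
  have "continuous_on UNIV h" using h(1) by (meson DERIV_isCont continuous_at_imp_continuous_on)
  then have hm: "h \<in> borel_measurable borel" by (rule borel_measurable_continuous_onI)
  have h'm: "h' \<in> borel_measurable borel" using h(2) by (rule borel_measurable_continuous_onI)
  have dbl: "(\<lambda>u. \<integral>x. \<Psi> x u \<partial>surface (frontier K)) \<in> borel_measurable borel"
    "(\<integral>(x, y). chord_kernel h' x y \<partial>(surface (frontier K) \<Otimes>\<^sub>M surface (frontier K)))
      = (real DIM('a) - 1) * (\<integral>u. \<integral>x. \<Psi> x u \<partial>surface (frontier K) \<partial>surface (sphere 0 1))"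
    unfolding \<Psi>_def by (rule double_chord_integral[OF h])+
  define I where "I = (\<integral>u. \<integral>x. \<Psi> x u \<partial>surface (frontier K) \<partial>surface (sphere 0 1))"
  have sph: "sphere (0::'a) 1 \<in> sets borel" by simp
  have inner: "(\<integral>y. (if line_through y u \<inter> K \<noteq> {} then h (enn2real (hausdorff_outer 1 (line_through y u \<inter> K))) else 0)
          \<partial>hausdorff_on ?s (hplane u)) = (\<integral>x. \<Psi> x u \<partial>surface (frontier K))" if us: "u \<in> sphere 0 1" for u
  proof -
    have u: "norm u = 1" using us by simp
    have "(\<integral>y. (if line_through y u \<inter> K \<noteq> {} then h (enn2real (hausdorff_outer 1 (line_through y u \<inter> K))) else 0)
          \<partial>hausdorff_on ?s (hplane u)) = (\<integral>y. h (chord_length y u) \<partial>hausdorff_on ?s (hplane u))"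
      using line_chord_length[OF u, of h, OF h(3)] by simp
    also have "\<dots> = (\<integral>y. h (chord_length y u) \<partial>surface (hplane u))"
      by (intro integral_hausdorff_on hplane_borel measurable_compose[OF chord_length_measurable2 hm])
    also have "\<dots> = (\<integral>x. max 0 (n x \<bullet> (- u)) * h (chord_length x u) \<partial>surface (frontier K))"
      by (rule directional_chord_integral[OF u hm h(3), symmetric])
    also have "\<dots> = (\<integral>x. \<Psi> x u \<partial>surface (frontier K))" using us by (simp add: \<Psi>_def)
    finally show ?thesis .
  qed
  have "lines_integral (\<lambda>G. if G \<inter> K \<noteq> {} then h (enn2real (hausdorff_outer 1 (G \<inter> K))) else 0)
      = (\<integral>u. (\<integral>x. \<Psi> x u \<partial>surface (frontier K)) \<partial>hausdorff_on ?s (sphere 0 1)) / omega DIM('a)"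
    unfolding lines_integral_def
    by (subst Bochner_Integration.integral_cong[OF refl inner]) (simp_all only: distr_hausdorff_on(3)[OF sph])
  also have "(\<integral>u. (\<integral>x. \<Psi> x u \<partial>surface (frontier K)) \<partial>hausdorff_on ?s (sphere 0 1)) = I"
    unfolding I_def by (rule integral_hausdorff_on[OF sph dbl(1)])
  finally have lhs: "lines_integral (\<lambda>G. if G \<inter> K \<noteq> {} then h (enn2real (hausdorff_outer 1 (G \<inter> K))) else 0) = I / omega DIM('a)" .
  have "(\<integral>p. (case p of (x1, x2) \<Rightarrow> h' (dist x1 x2) / dist x1 x2 ^ (DIM('a) - 2)
              * cos (alpha_angle K x1 x2 x1) * cos (alpha_angle K x1 x2 x2) * cos (phi0_angle K x1 x2)) \<partial>(?M \<Otimes>\<^sub>M ?M))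
      = (\<integral>p. (case p of (x, y) \<Rightarrow> chord_kernel h' x y) \<partial>(?M \<Otimes>\<^sub>M ?M))"
  proof (rule Bochner_Integration.integral_cong[OF refl])
    fix p assume "p \<in> space (?M \<Otimes>\<^sub>M ?M)"
    then obtain x y where p: "p = (x, y)" "x \<in> frontier K" "y \<in> frontier K"
      by (auto simp: space_pair_measure distr_hausdorff_on(3)[OF S_borel])
    have nx: "outer_normal K x = n x" "outer_normal K y = n y" using p by (auto simp: n_def)
    have "h' (dist x y) / dist x y ^ (DIM('a) - 2) * cos (alpha_angle K x y x) * cos (alpha_angle K x y y) * cos (phi0_angle K x y)
        = chord_kernel h' x y"
    proof (cases "x = y")
      case True
      \<comment> \<open>On the diagonal \<open>chord_dir\<close> is 0, so the cosines are 0 by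
        convention. This matters for \<open>d = 2\<close>, where the denominator
        \<open>dist x1 x2 ^ (d - 2)\<close> is 1.\<close>
      then show ?thesis by (simp add: chord_kernel_def alpha_angle_def chord_dir_def cos_vangle)
    next
      case False
      let ?r = "norm (y - x)" and ?u = "chord_dir x y"
      have r: "?r \<noteq> 0" using False by simp
      have u: "norm ?u = 1" using False by (simp add: chord_dir_def)
      have yx: "y - x = ?r *\<^sub>R ?u" using False by (simp add: chord_dir_def)
      have "cos (alpha_angle K x y x) * cos (alpha_angle K x y y) * cos (phi0_angle K x y)
          = n x \<bullet> n y - (n x \<bullet> ?u) * (n y \<bullet> ?u)"
        unfolding alpha_angle_def phi0_angle_def nx
        by (rule angle_product[OF normal_unit[OF p(2)] normal_unit[OF p(3)] u])
      moreover have "chord_kernel h' x y = h' ?r * (?r\<^sup>2 / ?r ^ DIM('a)) * (n x \<bullet> n y - (n x \<bullet> ?u) * (n y \<bullet> ?u))"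
      proof -
        have "?r\<^sup>2 * (n x \<bullet> n y) - (n x \<bullet> (y - x)) * ((y - x) \<bullet> n y) = ?r\<^sup>2 * (n x \<bullet> n y - (n x \<bullet> ?u) * (n y \<bullet> ?u))"
          by (subst (2 3) yx) (simp add: power2_eq_square inner_commute algebra_simps)
        then show ?thesis unfolding chord_kernel_def by simp
      qed
      moreover have "dist x y = ?r" by (simp add: dist_norm norm_minus_commute)
      ultimately show ?thesis unfolding kernel_power_simps(1)[OF dim r] by (simp add: mult.assoc)
    qed
    then show "(case p of (x1, x2) \<Rightarrow> h' (dist x1 x2) / dist x1 x2 ^ (DIM('a) - 2)
              * cos (alpha_angle K x1 x2 x1) * cos (alpha_angle K x1 x2 x2) * cos (phi0_angle K x1 x2))
        = (case p of (x, y) \<Rightarrow> chord_kernel h' x y)" by (simp only: p(1) prod.case)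
  qed
  also have "\<dots> = (\<integral>p. (case p of (x, y) \<Rightarrow> chord_kernel h' x y) \<partial>(surface (frontier K) \<Otimes>\<^sub>M surface (frontier K)))"
  proof -
    note D = distr_hausdorff_on[OF S_borel]
    have "sigma_finite_measure (distr ?M borel (\<lambda>x. x))"
      unfolding D(1) using finite_surface by (simp add: finite_measure_def)
    \<comment> \<open>The identity map carries the product of the measures on the boundary to the
      product of their extensions to the whole space.\<close>
    then have eq: "surface (frontier K) \<Otimes>\<^sub>M surface (frontier K) = distr (?M \<Otimes>\<^sub>M ?M) (borel \<Otimes>\<^sub>M borel) (\<lambda>(x, y). (x, y))"
      using pair_measure_distr[OF D(2) D(2)] unfolding D(1) by simp
    have m: "(\<lambda>(x, y). (x, y)) \<in> measurable (?M \<Otimes>\<^sub>M ?M) (borel \<Otimes>\<^sub>M borel)"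
      using measurable_Pair[OF measurable_compose[OF measurable_fst D(2)] measurable_compose[OF measurable_snd D(2)]]
      by (simp add: split_beta')
    show ?thesis
      unfolding eq using chord_kernel_measurable(1)[OF h'm] by (subst integral_distr[OF m]) (auto simp: split_beta')
  qed
  also have "\<dots> = ?s * I" using dbl(2) by (simp add: I_def)
  finally have rhs: "(\<integral>p. (case p of (x1, x2) \<Rightarrow> h' (dist x1 x2) / dist x1 x2 ^ (DIM('a) - 2)
              * cos (alpha_angle K x1 x2 x1) * cos (alpha_angle K x1 x2 x2) * cos (phi0_angle K x1 x2)) \<partial>(?M \<Otimes>\<^sub>M ?M)) = ?s * I" .
  have "?s \<noteq> 0" using assms(1) by simp
  then show ?thesis unfolding lhs rhs by simp
qed

end
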